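(* Let $n=p_1^{\alpha_1}p_2^{\alpha_2}\cdots p_\ell^{\alpha_\ell}$ with $\ell\ge 1$, $p_k$ prime and $\alpha_k$ a positive integer for $1\le k\le\ell$, and let $a_1,a_2,a_3,b\in\mathbb{Z}_n$ with $a_1a_2a_3\in\mathbb{Z}_n^*$. Suppose that one of the following holds: 1) $b\neq 0$ and $a_1+a_2+a_3\in\mathbb{Z}_n^*$; 2) $b=0$ and $3\nmid n$; 3) $b=0$, $3\mid n$, and $a_1+a_2+a_3\in\mathbb{Z}_3^*$ (that is, $a_1+a_2+a_3\not\equiv 0\pmod 3$). Then $$\operatorname{rb}(\mathbb{Z}_n,\operatorname{eq}(a_1,a_2,a_3,b))=2+\sum_{k=1}^{\ell}\alpha_k\bigl(\operatorname{rb}(\mathbb{Z}_{p_k},\operatorname{eq}(a_1,a_2,a_3,b))-2\bigr).$$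
   Context: $\mathbb{Z}_m$ denotes the integers modulo $m$, $\mathbb{Z}_m^{*}$ its group of units, and $[r]=\{1,\dots,r\}$. An exact $r$-coloring of $\mathbb{Z}_m$ is a surjective function $c:\mathbb{Z}_m\to[r]$. $\operatorname{eq}(a_1,a_2,a_3,b)$ denotes the equation $a_1x_1+a_2x_2+a_3x_3=b$; a solution in $\mathbb{Z}_m$ is an ordered triple $(s_1,s_2,s_3)$ of elements of $\mathbb{Z}_m$ with $a_1s_1+a_2s_2+a_3s_3\equiv b \pmod m$. When the equation is considered over $\mathbb{Z}_m$ with $m\mid n$, the coefficients $a_1,a_2,a_3,b$ are reduced modulo $m$. A solution is rainbow (with respect to $c$) if $|\{c(s_1),c(s_2),c(s_3)\}|=3$. The rainbow number $\operatorname{rb}(\mathbb{Z}_m,eq)$ is the smallest positive integer $r$ such that every exact $r$-coloring of $\mathbb{Z}_m$ has a rainbow solution to $eq$; by convention it equals $m+1$ if an exact $m$-coloring of $\mathbb{Z}_m$ contains no rainbow solution. *)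

theory Defs
  imports "HOL-Number_Theory.Residues"
begin

abbreviation Zmod :: "nat \<Rightarrow> int ring"
  where "Zmod m \<equiv> residue_ring (int m)"

text \<open>Only the values of the coloring on the carrier matter.\<close>

definition exact_coloring :: "nat \<Rightarrow> nat \<Rightarrow> (int \<Rightarrow> nat) \<Rightarrow> bool"
  where "exact_coloring m r c \<longleftrightarrow> c ` carrier (Zmod m) = {1..r}"

text \<open>The coefficients are arbitrary integers and enter only through their classes modulo \<open>m\<close>.\<close>

definition eq_solutions :: "nat \<Rightarrow> int \<Rightarrow> int \<Rightarrow> int \<Rightarrow> int \<Rightarrow> (int \<times> int \<times> int) set"
  where "eq_solutions m a1 a2 a3 b =
    {(s1, s2, s3). s1 \<in> carrier (Zmod m) \<and> s2 \<in> carrier (Zmod m) \<and> s3 \<in> carrier (Zmod m) \<and>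
       [a1 * s1 + a2 * s2 + a3 * s3 = b] (mod int m)}"

definition has_rainbow_solution ::
    "nat \<Rightarrow> int \<Rightarrow> int \<Rightarrow> int \<Rightarrow> int \<Rightarrow> (int \<Rightarrow> nat) \<Rightarrow> bool"
  where "has_rainbow_solution m a1 a2 a3 b c \<longleftrightarrow>
    (\<exists>(s1, s2, s3) \<in> eq_solutions m a1 a2 a3 b. card {c s1, c s2, c s3} = 3)"

text \<open>For \<open>r > m\<close> there is no exact \<open>r\<close>-coloring, so \<open>m + 1\<close> always qualifies vacuously;
  the convention that the rainbow number is \<open>m + 1\<close> when some exact \<open>m\<close>-coloring has no rainbow
  solution is thus part of the definition (see \<open>rainbow_number_convention\<close>).\<close>

definition rainbow_number :: "nat \<Rightarrow> int \<Rightarrow> int \<Rightarrow> int \<Rightarrow> int \<Rightarrow> nat"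
  where "rainbow_number m a1 a2 a3 b =
    (LEAST r. 0 < r \<and> (\<forall>c. exact_coloring m r c \<longrightarrow> has_rainbow_solution m a1 a2 a3 b c))"

lemma rainbow_number_convention:
  assumes c: "exact_coloring m m c" and no: "\<not> has_rainbow_solution m a1 a2 a3 b c"
  shows "rainbow_number m a1 a2 a3 b = m + 1"
proof -
  let ?C = "carrier (Zmod m)"
  have C: "?C = {0..<int m}"
    by (auto simp: residue_ring_def)
  have fin: "finite ?C" and card_C: "card ?C = m"
    by (simp_all add: C)
  have "inj_on c ?C"
    using c fin card_C by (intro eq_card_imp_inj_on) (simp_all add: exact_coloring_def)
  have no': "\<not> has_rainbow_solution m a1 a2 a3 b d" for d
  proof
    assume "has_rainbow_solution m a1 a2 a3 b d"
    then obtain s1 s2 s3 where s: "(s1, s2, s3) \<in> eq_solutions m a1 a2 a3 b"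
      and "card {d s1, d s2, d s3} = 3"
      by (auto simp: has_rainbow_solution_def)
    then have "s1 \<noteq> s2" "s1 \<noteq> s3" "s2 \<noteq> s3"
      by (auto simp: card_insert_if split: if_splits)
    then have "c s1 \<noteq> c s2" "c s1 \<noteq> c s3" "c s2 \<noteq> c s3"
      using s \<open>inj_on c ?C\<close> by (auto simp: eq_solutions_def inj_on_def)
    then show False
      using s no by (auto simp: has_rainbow_solution_def)
  qed
  have ex: "\<exists>d. exact_coloring m r d" if "0 < r" "r \<le> m" for r
  proof -
    have "(\<lambda>x. min (nat x + 1) r) ` {0..<int m} = {1..r}"
    proof (intro equalityI subsetI)
      fix y assume "y \<in> {1..r}"
      then show "y \<in> (\<lambda>x. min (nat x + 1) r) ` {0..<int m}"
        using that by (intro image_eqI[of _ _ "int y - 1"]) auto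
    qed (use that in auto)
    then show ?thesis
      by (auto simp: exact_coloring_def C)
  qed
  have none: "\<not> exact_coloring m (m + 1) d" for d
  proof
    assume "exact_coloring m (m + 1) d"
    then have "card (d ` ?C) = m + 1"
      by (simp add: exact_coloring_def)
    then show False
      using card_image_le[OF fin, of d] card_C by simp
  qed
  show ?thesis
    unfolding rainbow_number_def
  proof (rule Least_equality)
    fix r assume r: "0 < r \<and> (\<forall>d. exact_coloring m r d \<longrightarrow> has_rainbow_solution m a1 a2 a3 b d)"
    show "m + 1 \<le> r"
      using ex[of r] r no' by (metis Suc_eq_plus1 not_less_eq_eq)
  qed (use none in auto)
qed

end

(*
  Call a prime p splitting if some proper nonempty set of units modulo p is closed under the maps
  x -> -(a_u / a_v) x. Coloring the units modulo p by one color, or by two colors if p is splitting,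
  and iterating along the multiples of p gives a rainbow-free coloring of Z_n for b = 0 in which
  each prime factor, with multiplicity, contributes 1 or 2 colors beyond the first; a translation
  moves it to any b in the range of multiplication by s = a_1 + a_2 + a_3.

  That no rainbow-free coloring has more colors is proved by induction on n for every b, as long as
  3 does not divide both n and s. For n = d m compare the color sets of the residue classes
  modulo d with that of a base class. If two colors of class i are missing from class j and (i, j, l)
  solves the equation modulo d, then the colors of class l all occur in class j. So all classes but
  at most one have at most one color outside the base class, and recording that color gives a
  rainbow-free coloring of Z_d. The base class is a rainbow-free coloring of Z_m, if it can be chosen
  as a solution of the constant equation s i = b (mod d).

  For prime p >= 5 let P(x) be the vector of Fourier coefficients at x of the color indicators of a
  rainbow-free coloring. Rainbow-freeness is a bilinear identity between the 2x2 minors of these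
  vectors; with Galois conjugation of the p-th roots of unity it shows that the vectors at a_1 x
  and a_2 x are parallel. If all P(x) are, up to scalars, real and there are four colors, the
  Sylvester-Gallai theorem provides a line through exactly two directions, and Gaussian periods
  lead to a contradiction; otherwise all of them lie in a plane. If p is not splitting, only the
  directions P(1) and P(-1) occur, which leaves at most two colors.

  The remaining case is that every prime divisor of n divides s but not b, so that no class modulo d
  solves the constant equation. A class of any i is then paired with the class of
  (b - (a_1 + a_2) i) / a_3, and the Cauchy-Davenport inequality together with the same Fourier
  identities shows that some class modulo n / p has as few colors as a rainbow-free coloring of Z_p.
*)
theory Submission
  imports Defs
begin

text \<open>The theorem only concerns b in the range of multiplication by s, but the induction
  cannot stay there: substituting x = i + d t turns the class of i into a coloring modulo m with
  constant (b - s i) / d, and for a class chosen by its colors nothing is known about this constant.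
  Hence the upper bound is proved for every b, which creates the case without a fixed class. There
  the coloring F of one class is tied only to the coloring G of another one, so the Fourier part is
  stated for pairs F, G; a single coloring modulo p is the case G = F. The condition on 3 excludes a
  genuine exception: modulo 3, three distinct residues add up to 0, so giving them three colors is
  rainbow-free for x + y + z = 1, although 3 is not splitting for these coefficients. The constant 2
  in the formula is 1 + 1: one color is shared by all steps of the iteration, and the rainbow number
  exceeds the largest rainbow-free number of colors by one.\<close>

section \<open>Functions on residue classes, as periodic functions on the integers\<close>

definition periodic :: "int \<Rightarrow> (int \<Rightarrow> 'a) \<Rightarrow> bool"
  where "periodic m f \<longleftrightarrow> (\<forall>x. f (x mod m) = f x)"

lemma periodicD: "periodic m f \<Longrightarrow> f (x mod m) = f x"
  by (simp add: periodic_def)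

lemma periodic_cong: "periodic m f \<Longrightarrow> m dvd x - y \<Longrightarrow> f x = f y"
  by (metis periodic_def mod_eq_dvd_iff)

lemma periodicI: "(\<And>x y. m dvd x - y \<Longrightarrow> f x = f y) \<Longrightarrow> periodic m f"
  unfolding periodic_def by (metis mod_eq_dvd_iff mod_mod_trivial)

lemma periodic_range: "m > 0 \<Longrightarrow> periodic m f \<Longrightarrow> range f = f ` {0..<m}"
  by (auto simp: periodic_def image_iff) (metis atLeastLessThan_iff pos_mod_bound pos_mod_sign)

lemma bij_betw_affine_mod:
  fixes m k c :: int
  assumes "m > 0" "coprime k m"
  shows "bij_betw (\<lambda>t. (k * t + c) mod m) {0..<m} {0..<m}"
proof -
  have "inj_on (\<lambda>t. (k * t + c) mod m) {0..<m}"
  proof (rule inj_onI)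
    fix x y assume xy: "x \<in> {0..<m}" "y \<in> {0..<m}" "(k * x + c) mod m = (k * y + c) mod m"
    then have "m dvd k * (x - y)"
      by (simp add: mod_eq_dvd_iff algebra_simps)
    then have "m dvd x - y"
      using assms by (simp add: coprime_dvd_mult_right_iff coprime_commute)
    then have "x mod m = y mod m" by (simp add: mod_eq_dvd_iff)
    with xy show "x = y" by simp
  qed
  moreover have "(\<lambda>t. (k * t + c) mod m) ` {0..<m} \<subseteq> {0..<m}"
    using assms by auto
  ultimately show ?thesis
    by (simp add: bij_betw_def endo_inj_surj)
qed

lemma sum_periodic_affine:
  fixes m k c :: int and f :: "int \<Rightarrow> 'a :: comm_monoid_add"
  assumes "m > 0" "coprime k m" "periodic m f"
  shows "(\<Sum>t\<in>{0..<m}. f (k * t + c)) = (\<Sum>t\<in>{0..<m}. f t)"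
proof -
  have "(\<Sum>t\<in>{0..<m}. f (k * t + c)) = (\<Sum>t\<in>{0..<m}. f ((k * t + c) mod m))"
    using assms by (simp add: periodicD)
  also have "\<dots> = (\<Sum>t\<in>{0..<m}. f t)"
    by (rule sum.reindex_bij_betw[OF bij_betw_affine_mod]) (use assms in auto)
  finally show ?thesis .
qed

lemma sum_periodic_shift:
  fixes m c :: int and f :: "int \<Rightarrow> 'a :: comm_monoid_add"
  assumes "m > 0" "periodic m f"
  shows "(\<Sum>t\<in>{0..<m}. f (t + c)) = (\<Sum>t\<in>{0..<m}. f t)"
  using sum_periodic_affine[of m 1 f c] assms by simp

section \<open>Roots of unity\<close>

definition ew :: "nat \<Rightarrow> int \<Rightarrow> complex"
  where "ew p k = cis (2 * pi * of_int k / of_nat p)"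

lemma ew_0 [simp]: "ew p 0 = 1"
  by (simp add: ew_def)

lemma ew_add: "ew p (j + k) = ew p j * ew p k"
  by (simp add: ew_def cis_mult add_divide_distrib distrib_left)

lemma ew_nz [simp]: "ew p k \<noteq> 0"
  by (simp add: ew_def)

lemma ew_minus: "ew p (- k) = cnj (ew p k)"
  by (simp add: ew_def cis_cnj)

lemma norm_ew [simp]: "norm (ew p k) = 1"
  by (simp add: ew_def)

lemma ew_eq_1_iff:
  assumes "p > 0"
  shows "ew p k = 1 \<longleftrightarrow> int p dvd k"
proof
  assume "ew p k = 1"
  then have "cos (2 * pi * of_int k / of_nat p) = 1"
    by (metis cis.sel(1) ew_def one_complex.sel(1))
  then obtain j :: int where "2 * pi * of_int k / of_nat p = j * 2 * pi"
    using cos_one_2pi_int by auto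
  then have "real_of_int k = real_of_int (j * int p)"
    using assms by (simp add: field_simps)
  then show "int p dvd k" by (metis dvd_triv_right of_int_eq_iff)
next
  assume "int p dvd k"
  then obtain j where j: "k = int p * j" by blast
  have "2 * pi * of_int k / of_nat p = 2 * pi * of_int j"
    using assms by (simp add: j)
  then show "ew p k = 1"
    by (simp add: ew_def complex_eq_iff)
qed

lemma ew_cong: "p > 0 \<Longrightarrow> int p dvd j - k \<Longrightarrow> ew p j = ew p k"
  using ew_eq_1_iff[of p "j - k"] ew_add[of p "j - k" k] by simp

lemma periodic_ew: "p > 0 \<Longrightarrow> periodic (int p) (\<lambda>t. ew p (k * t))"
  by (rule periodicI, rule ew_cong) (auto simp flip: right_diff_distrib)

lemma sum_ew:
  assumes "p > 0"
  shows "(\<Sum>t\<in>{0..<int p}. ew p (k * t)) = (if int p dvd k then of_nat p else 0)"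
proof (cases "int p dvd k")
  case True
  then have "ew p (k * t) = 1" for t
    using assms by (simp add: ew_eq_1_iff)
  then show ?thesis using True by simp
next
  case False
  let ?S = "\<Sum>t\<in>{0..<int p}. ew p (k * t)"
  have "?S = (\<Sum>t\<in>{0..<int p}. ew p (k * (t + 1)))"
    using sum_periodic_shift[of "int p" "\<lambda>t. ew p (k * t)" 1] assms periodic_ew by simp
  also have "\<dots> = ew p k * ?S"
    by (simp add: distrib_left ew_add sum_distrib_left mult_ac)
  finally have "(1 - ew p k) * ?S = 0" by (simp add: algebra_simps)
  then show ?thesis using False assms by (simp add: ew_eq_1_iff)
qed

text \<open>Expanding the product over all conjugates of \<open>\<Sum>t. c t * \<omega>\<^sup>t\<close> gives coefficients that
  are invariant under dilation, hence an integer congruent to \<open>(\<Sum>t. c t) ^ p\<close> modulo \<open>p\<close>.\<close>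

lemma vanishing_sum_dvd:
  fixes c :: "int \<Rightarrow> int"
  assumes p: "prime p" and z: "(\<Sum>t\<in>{0..<int p}. of_int (c t) * ew p t) = 0"
  shows "int p dvd (\<Sum>t\<in>{0..<int p}. c t)"
proof -
  let ?Z = "{0..<int p}"
  have p0: "p > 0" using p by (simp add: prime_gt_0_nat)
  \<comment> \<open>A member of \<open>PI\<close> picks one term from each factor \<open>k\<close>
    of the product of the sums with \<open>ew p (k * t)\<close>; \<open>s\<close> is the resulting
    exponent, \<open>w\<close> the coefficient, and \<open>A j\<close> collects the coefficients
    with exponent \<open>j\<close>. The factor \<open>k = 0\<close> is the plain sum of the
    coefficients.\<close>
  define PI where "PI = PiE ?Z (\<lambda>_. ?Z)"
  define s where "s \<tau> = (\<Sum>k\<in>?Z. k * \<tau> k) mod int p" for \<tau> :: "int \<Rightarrow> int"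
  define w where "w \<tau> = (\<Prod>k\<in>?Z. c (\<tau> k))" for \<tau>
  define A where "A j = (\<Sum>\<tau> | \<tau> \<in> PI \<and> s \<tau> = j. w \<tau>)" for j
  have finPI: "finite PI" by (simp add: PI_def finite_PiE)
  have s_in: "s \<tau> \<in> ?Z" for \<tau> using p0 by (simp add: s_def)
  have group: "(\<Sum>\<tau>\<in>PI. g (s \<tau>) * of_int (w \<tau>)) = (\<Sum>j\<in>?Z. g j * of_int (A j))"
    for g :: "int \<Rightarrow> 'b :: comm_ring_1"
  proof -
    have "(\<Sum>j\<in>?Z. g j * of_int (A j)) = (\<Sum>j\<in>?Z. \<Sum>\<tau> | \<tau> \<in> PI \<and> s \<tau> = j. g (s \<tau>) * of_int (w \<tau>))"
      by (intro sum.cong refl) (simp add: A_def sum_distrib_left)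
    also have "\<dots> = (\<Sum>\<tau>\<in>PI. g (s \<tau>) * of_int (w \<tau>))"
      by (rule sum.group) (use finPI s_in in auto)
    finally show ?thesis by simp
  qed
  have inv: "A ((j * k) mod int p) = A j" if k: "coprime k (int p)" and j: "j \<in> ?Z" for j k
  proof -
    have bij: "bij_betw (\<lambda>t. (k * t) mod int p) ?Z ?Z"
      using bij_betw_affine_mod[of "int p" k 0] k p0 by simp
    define T where "T \<tau> = (\<lambda>t. if t \<in> ?Z then \<tau> ((k * t) mod int p) else undefined)"
      for \<tau> :: "int \<Rightarrow> int"
    have TPI: "T \<tau> \<in> PI" if "\<tau> \<in> PI" for \<tau>
      using that p0 by (auto simp: T_def PI_def)
    have injT: "inj_on T PI"
    proof (rule inj_onI)
      fix \<tau> \<sigma> assume a: "\<tau> \<in> PI" "\<sigma> \<in> PI" "T \<tau> = T \<sigma>"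
      have "\<tau> t = \<sigma> t" if t: "t \<in> ?Z" for t
      proof -
        obtain u where u: "u \<in> ?Z" "t = (k * u) mod int p"
          using bij t unfolding bij_betw_def by blast
        then show ?thesis using a(3) by (metis T_def)
      qed
      then show "\<tau> = \<sigma>" using a(1,2) unfolding PI_def by (metis PiE_ext)
    qed
    have surjT: "T ` PI = PI"
      using injT TPI finPI by (simp add: endo_inj_surj image_subsetI)
    have wT: "w (T \<tau>) = w \<tau>" for \<tau>
    proof -
      have "w (T \<tau>) = (\<Prod>t\<in>?Z. c (\<tau> ((k * t) mod int p)))"
        unfolding w_def by (rule prod.cong) (auto simp: T_def)
      also have "\<dots> = w \<tau>"
        unfolding w_def by (rule prod.reindex_bij_betw[OF bij])
      finally show ?thesis .
    qed
    have sT: "s \<tau> = (k * s (T \<tau>)) mod int p" for \<tau>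
    proof -
      have "(\<Sum>t\<in>?Z. t * \<tau> t) = (\<Sum>t\<in>?Z. ((k * t) mod int p) * \<tau> ((k * t) mod int p))"
        by (rule sum.reindex_bij_betw[OF bij, symmetric])
      also have "\<dots> = (\<Sum>t\<in>?Z. ((k * t) mod int p) * T \<tau> t)"
        by (rule sum.cong) (auto simp: T_def)
      also have "\<dots> mod int p = (\<Sum>t\<in>?Z. k * t * T \<tau> t) mod int p"
        by (subst (1 2) mod_sum_eq[symmetric]) (simp add: mod_mult_left_eq)
      also have "(\<Sum>t\<in>?Z. k * t * T \<tau> t) = k * (\<Sum>t\<in>?Z. t * T \<tau> t)"
        by (simp add: sum_distrib_left mult.assoc)
      finally show ?thesis by (simp add: s_def mod_mult_right_eq)
    qed
    have "A ((j * k) mod int p) = (\<Sum>\<tau>\<in>PI. if s \<tau> = (j * k) mod int p then w \<tau> else 0)"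
      unfolding A_def by (rule sum.inter_filter) (rule finPI)
    also have "\<dots> = (\<Sum>\<tau>\<in>PI. if s (T \<tau>) = j then w (T \<tau>) else 0)"
    proof (rule sum.cong[OF refl])
      fix \<tau> assume "\<tau> \<in> PI"
      have "s \<tau> = (j * k) mod int p \<longleftrightarrow> s (T \<tau>) = j"
      proof -
        have "s \<tau> = (j * k) mod int p \<longleftrightarrow> (k * s (T \<tau>)) mod int p = (k * j) mod int p"
          by (metis sT mult.commute)
        also have "\<dots> \<longleftrightarrow> s (T \<tau>) = j"
          using bij j s_in[of "T \<tau>"] unfolding bij_betw_def inj_on_def by blast
        finally show ?thesis .
      qed
      then show "(if s \<tau> = (j * k) mod int p then w \<tau> else 0)
          = (if s (T \<tau>) = j then w (T \<tau>) else 0)"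
        by (simp add: wT)
    qed
    also have "\<dots> = (\<Sum>\<tau>\<in>T ` PI. if s \<tau> = j then w \<tau> else 0)"
      using injT by (simp add: sum.reindex)
    also have "\<dots> = A j"
      unfolding surjT A_def by (rule sum.inter_filter[symmetric]) (rule finPI)
    finally show ?thesis .
  qed
  have A1: "A j = A 1" if "j \<in> ?Z - {0}" for j
  proof -
    have "\<not> int p dvd j"
      using that by (auto dest: zdvd_imp_le)
    then have "coprime j (int p)"
      using p by (metis coprime_commute prime_imp_coprime prime_nat_int_transfer)
    then have "A ((1 * j) mod int p) = A 1"
      by (rule inv) (use p prime_gt_1_nat in fastforce)
    then show ?thesis using that by simp
  qed
  have prod_exp: "(\<Prod>k\<in>?Z. \<Sum>t\<in>?Z. of_int (c t) * ew p (k * t)) = (\<Sum>j\<in>?Z. ew p j * of_int (A j))"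
  proof -
    have "(\<Prod>k\<in>?Z. \<Sum>t\<in>?Z. of_int (c t) * ew p (k * t)) =
        (\<Sum>\<tau>\<in>PI. \<Prod>k\<in>?Z. of_int (c (\<tau> k)) * ew p (k * \<tau> k))"
      unfolding PI_def by (rule prod_sum_PiE) auto
    also have "\<dots> = (\<Sum>\<tau>\<in>PI. ew p (s \<tau>) * of_int (w \<tau>))"
    proof (rule sum.cong[OF refl])
      fix \<tau>
      have "(\<Prod>k\<in>K. ew p (k * \<tau> k)) = ew p (\<Sum>k\<in>K. k * \<tau> k)" if "finite K" for K
        using that by induction (auto simp: ew_add)
      then have "(\<Prod>k\<in>?Z. ew p (k * \<tau> k)) = ew p (\<Sum>k\<in>?Z. k * \<tau> k)" by simp
      also have "\<dots> = ew p (s \<tau>)"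
        unfolding s_def by (rule ew_cong[OF p0]) (simp add: mod_eq_dvd_iff[symmetric])
      finally show "(\<Prod>k\<in>?Z. of_int (c (\<tau> k)) * ew p (k * \<tau> k)) = ew p (s \<tau>) * of_int (w \<tau>)"
        by (simp add: prod.distrib w_def mult.commute)
    qed
    also have "\<dots> = (\<Sum>j\<in>?Z. ew p j * of_int (A j))" by (rule group)
    finally show ?thesis .
  qed
  have Zsplit: "?Z = insert 0 (?Z - {0})" using p0 by auto
  \<comment> \<open>The factor \<open>k = 1\<close> is the given relation. As all \<open>A j\<close>
    with \<open>j \<noteq> 0\<close> agree and the nontrivial roots add up to -1, the vanishing of
    the product means \<open>A 0 = A 1\<close>.\<close>
  have "(\<Prod>k\<in>?Z. \<Sum>t\<in>?Z. of_int (c t) * ew p (k * t)) = (0::complex)"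
    by (rule prod_zero) (use z p prime_gt_1_nat in \<open>auto intro!: bexI[of _ 1]\<close>)
  then have "0 = (\<Sum>j\<in>?Z. ew p j * of_int (A j))" by (simp add: prod_exp)
  also have "\<dots> = of_int (A 0) + (\<Sum>j\<in>?Z - {0}. ew p j * of_int (A j))"
    by (subst Zsplit, subst sum.insert) auto
  also have "(\<Sum>j\<in>?Z - {0}. ew p j * of_int (A j)) = (\<Sum>j\<in>?Z - {0}. ew p j) * of_int (A 1)"
    unfolding sum_distrib_right by (rule sum.cong[OF refl]) (metis A1)
  also have "(\<Sum>j\<in>?Z - {0}. ew p j) = - 1"
  proof -
    have "(\<Sum>j\<in>?Z. ew p j) = 0"
      using sum_ew[OF p0, of 1] p prime_gt_1_nat[OF p] by (simp add: zdvd1_eq)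
    moreover have "(\<Sum>j\<in>?Z. ew p j) = 1 + (\<Sum>j\<in>?Z - {0}. ew p j)"
      by (subst Zsplit, subst sum.insert) auto
    ultimately show ?thesis by (simp add: add_eq_0_iff)
  qed
  finally have "of_int (A 0) = (of_int (A 1) :: complex)" by simp
  then have A01: "A 0 = A 1" unfolding of_int_eq_iff .
  have Aall: "A j = A 1" if "j \<in> ?Z" for j
  proof (cases "j = 0")
    case True
    then show ?thesis by (simp only: A01)
  next
    case False
    then show ?thesis using that by (intro A1) simp
  qed
  have "(\<Sum>t\<in>?Z. c t) ^ p = (\<Prod>k\<in>?Z. \<Sum>t\<in>?Z. c t)" by simp
  also have "\<dots> = (\<Sum>\<tau>\<in>PI. w \<tau>)"
    unfolding PI_def w_def by (rule prod_sum_PiE) auto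
  also have "\<dots> = (\<Sum>j\<in>?Z. A j)" using group[of "\<lambda>_. 1 :: int"] by simp
  also have "\<dots> = (\<Sum>j\<in>?Z. A 1)" by (rule sum.cong[OF refl]) (metis Aall)
  also have "\<dots> = int p * A 1" by simp
  finally have "int p dvd (\<Sum>t\<in>?Z. c t) ^ p" by simp
  then show ?thesis using p by (meson prime_dvd_power prime_nat_int_transfer)
qed

section \<open>Integer relations between p-th roots of unity\<close>

definition vanishing :: "nat \<Rightarrow> (int \<Rightarrow> int) \<Rightarrow> bool"
  where "vanishing p c \<longleftrightarrow> periodic (int p) c \<and> (\<Sum>t\<in>{0..<int p}. of_int (c t) * ew p t) = 0"

text \<open>On periodic coefficients this is multiplication of the sum of
  \<open>d t * ew p t\<close> by \<open>1 - ew p 1\<close>.\<close>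

definition bdiff :: "(int \<Rightarrow> int) \<Rightarrow> int \<Rightarrow> int"
  where "bdiff d t = d t - d (t - 1)"

text \<open>Division by \<open>1 - ew p 1\<close>: after subtraction of the mean, an integer by
  \<open>vanishing_sum_dvd\<close>, the partial sums of the coefficients are periodic, and their sum
  vanishes because \<open>1 - ew p 1\<close> is not zero.\<close>

lemma vanishing_antidiff:
  assumes p: "prime p" and c: "vanishing p c"
  shows "\<exists>k d. vanishing p d \<and> c = (\<lambda>t. k + bdiff d t)"
proof -
  let ?Z = "{0..<int p}"
  have p0: "p > 0" and p1: "p > 1" using p prime_gt_0_nat prime_gt_1_nat by blast+
  have per: "periodic (int p) c" and z: "(\<Sum>t\<in>?Z. of_int (c t) * ew p t) = 0"
    using c by (auto simp: vanishing_def)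
  obtain k where k: "(\<Sum>t\<in>?Z. c t) = int p * k"
    using vanishing_sum_dvd[OF p z] by blast
  define b where "b t = c t - k" for t
  have b_per: "periodic (int p) b" using per by (auto simp: b_def periodic_def)
  have b0: "(\<Sum>t\<in>?Z. b t) = 0" by (simp add: b_def sum_subtractf k)
  define d where "d t = (\<Sum>i\<in>{0..t mod int p}. b i)" for t
  have d_per: "periodic (int p) d" by (simp add: d_def periodic_def)
  have db: "bdiff d t = b t" for t
  proof (cases "t mod int p = 0")
    case True
    have "(t - 1) mod int p = (t mod int p - 1) mod int p" by (simp add: mod_diff_left_eq)
    also have "\<dots> = int p - 1" using p1 by (simp add: True zmod_minus1)
    finally have "d (t - 1) = (\<Sum>i\<in>{0..int p - 1}. b i)" by (simp add: d_def)
    also have "{0..int p - 1} = ?Z" by auto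
    finally have "d (t - 1) = 0" by (simp add: b0)
    moreover have "d t = b t" using True periodicD[OF b_per, of t] by (simp add: d_def)
    ultimately show ?thesis by (simp add: bdiff_def)
  next
    case False
    define r where "r = t mod int p"
    have r: "1 \<le> r" "r < int p" using False p0 pos_mod_sign[of "int p" t] pos_mod_bound[of "int p" t]
    unfolding r_def by linarith+
    have "(t - 1) mod int p = (r - 1) mod int p" by (simp add: r_def mod_diff_left_eq)
    also have "\<dots> = r - 1" using r by simp
    finally have "d (t - 1) = (\<Sum>i\<in>{0..r - 1}. b i)" by (simp add: d_def)
    moreover have "d t = (\<Sum>i\<in>insert r {0..r - 1}. b i)"
      unfolding d_def by (rule sum.cong) (use r in \<open>auto simp: r_def\<close>)
    ultimately have "bdiff d t = b r" by (simp add: bdiff_def)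
    then show ?thesis using periodicD[OF b_per, of t] by (simp add: r_def)
  qed
  have "(\<Sum>t\<in>?Z. of_int (d t) * ew p t) = 0"
  proof -
    let ?S = "\<Sum>t\<in>?Z. of_int (d t) * ew p t"
    have per': "periodic (int p) (\<lambda>t. of_int (d t) * ew p t :: complex)"
      using d_per periodic_ew[OF p0, of 1] by (simp add: periodic_def)
    have "?S = (\<Sum>t\<in>?Z. of_int (d (t + (-1))) * ew p (t + (-1)))"
      by (rule sum_periodic_shift[symmetric, OF _ per']) (use p0 in simp)
    then have "ew p 1 * ?S = (\<Sum>t\<in>?Z. of_int (d (t - 1)) * (ew p (t - 1) * ew p 1))"
      by (simp add: sum_distrib_left mult_ac)
    also have "\<dots> = (\<Sum>t\<in>?Z. of_int (d (t - 1)) * ew p t)"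
      by (simp flip: ew_add)
    finally have "(1 - ew p 1) * ?S = (\<Sum>t\<in>?Z. of_int (bdiff d t) * ew p t)"
      by (simp add: left_diff_distrib bdiff_def sum_subtractf)
    also have "\<dots> = (\<Sum>t\<in>?Z. of_int (c t) * ew p t) - of_int k * (\<Sum>t\<in>?Z. ew p t)"
      by (simp add: db b_def left_diff_distrib sum_subtractf sum_distrib_left)
    also have "\<dots> = 0" using z sum_ew[OF p0, of 1] p1 by (simp add: zdvd1_eq)
    finally show ?thesis using p1 by (simp add: ew_eq_1_iff[OF p0, of 1, simplified] zdvd1_eq)
  qed
  then have "vanishing p d" using d_per by (simp add: vanishing_def)
  moreover have "c = (\<lambda>t. k + bdiff d t)" by (simp add: db b_def)
  ultimately show ?thesis by blast
qed

lemma bdiff_funpow_const: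
  "(bdiff ^^ j) (\<lambda>t. k + e t) = (\<lambda>t. (if j = 0 then k else 0) + (bdiff ^^ j) e t)"
  by (induction j) (auto simp: bdiff_def fun_eq_iff)

lemma vanishing_antidiff_iter:
  assumes p: "prime p" and c: "vanishing p c"
  shows "\<exists>k d. vanishing p d \<and> c = (\<lambda>t. k + (bdiff ^^ j) d t)"
proof (induction j)
  case 0
  then show ?case using c by (intro exI[of _ 0] exI[of _ c]) simp
next
  case (Suc j)
  then obtain k d where d: "vanishing p d" "c = (\<lambda>t. k + (bdiff ^^ j) d t)" by blast
  obtain k' d' where d': "vanishing p d'" "d = (\<lambda>t. k' + bdiff d' t)"
    using vanishing_antidiff[OF p d(1)] by blast
  have "c = (\<lambda>t. (k + (if j = 0 then k' else 0)) + (bdiff ^^ Suc j) d' t)"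
    unfolding d(2) d'(2) bdiff_funpow_const by (simp add: funpow_swap1 fun_eq_iff)
  then show ?case using d'(1) by blast
qed

lemma bdiff_funpow:
  "(bdiff ^^ j) d t = (\<Sum>i\<le>j. (-1) ^ i * int (j choose i) * d (t - int i))"
proof (induction j arbitrary: t)
  case 0
  then show ?case by simp
next
  case (Suc j)
  let ?g = "\<lambda>j i. (-1) ^ i * int (j choose i) * d (t - int i)"
  have "(bdiff ^^ Suc j) d t = (\<Sum>i\<le>j. ?g j i) - (\<Sum>i\<le>j. (-1) ^ i * int (j choose i) * d (t - 1 - int i))"
    by (simp add: bdiff_def Suc.IH)
  also have "(\<Sum>i\<le>j. ?g j i) = (\<Sum>i\<le>Suc j. ?g j i)" by simp
  also have "\<dots> = d t + (\<Sum>i\<le>j. ?g j (Suc i))"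
    by (subst sum.atMost_Suc_shift) simp
  also have "\<dots> - (\<Sum>i\<le>j. (-1) ^ i * int (j choose i) * d (t - 1 - int i))
      = d t + (\<Sum>i\<le>j. ?g (Suc j) (Suc i))"
    unfolding add_diff_eq[symmetric] sum_subtractf[symmetric]
    by (intro arg_cong[where f = "\<lambda>x. d t + x"] sum.cong refl) (simp add: algebra_simps)
  also have "\<dots> = (\<Sum>i\<le>Suc j. ?g (Suc j) i)"
    by (subst sum.atMost_Suc_shift) simp
  finally show ?case .
qed

text \<open>The analogue of (1 - w)^p being congruent to 1 - w^p modulo p: the inner binomial
  coefficients are divisible by p, and the two outer terms cancel by periodicity, p being
  odd.\<close>

lemma bdiff_funpow_prime:
  assumes p: "prime p" "odd p" and d: "periodic (int p) d"
  shows "int p dvd (bdiff ^^ p) d t"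
proof -
  let ?g = "\<lambda>i. (-1) ^ i * int (p choose i) * d (t - int i)"
  have p0: "p > 0" using p by (simp add: prime_gt_0_nat)
  have "{..p} = insert 0 (insert p {0<..<p})" using p0 by auto
  then have "(bdiff ^^ p) d t = ?g 0 + ?g p + (\<Sum>i\<in>{0<..<p}. ?g i)"
    using p0 by (simp add: bdiff_funpow)
  also have "?g 0 + ?g p = 0"
    using p periodic_cong[OF d, of "t - int p" t] by simp
  finally have eq: "(bdiff ^^ p) d t = (\<Sum>i\<in>{0<..<p}. ?g i)" by simp
  have "int p dvd ?g i" if "i \<in> {0<..<p}" for i
  proof -
    have "p dvd p choose i" using that p by (intro dvd_choose_prime) auto
    then show ?thesis by simp
  qed
  then show ?thesis unfolding eq by (rule dvd_sum)
qed

text \<open>This amounts to the irreducibility of the p-th cyclotomic polynomial, and is proved by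
  descent. Writing \<open>c\<close> as a constant plus a p-fold difference shows that its values are
  all congruent modulo p; \<open>(c t - c 0) div p\<close> is a relation again, with smaller
  absolute values unless \<open>c\<close> is constant.\<close>

lemma vanishing_const:
  assumes p: "prime p" "odd p" and c: "vanishing p c"
  shows "c t = c 0"
  using c
proof (induction "nat (\<Sum>t\<in>{0..<int p}. \<bar>c t - c 0\<bar>)" arbitrary: c t rule: less_induct)
  case less
  let ?Z = "{0..<int p}"
  have p0: "p > 0" and p1: "p > 1" using p prime_gt_0_nat prime_gt_1_nat by blast+
  have per: "periodic (int p) c" and z: "(\<Sum>t\<in>?Z. of_int (c t) * ew p t) = 0"
    using less.prems by (auto simp: vanishing_def)
  obtain k d where d: "vanishing p d" "c = (\<lambda>t. k + (bdiff ^^ p) d t)"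
    using vanishing_antidiff_iter[OF p(1) less.prems] by blast
  have dvd: "int p dvd c t - c 0" for t
    using bdiff_funpow_prime[OF p, of d] d by (simp add: vanishing_def)
  define e where "e t = (c t - c 0) div int p" for t
  have ce: "c t = c 0 + int p * e t" for t using dvd[of t] by (simp add: e_def)
  have e0: "e 0 = 0" by (simp add: e_def)
  have "of_nat p * (\<Sum>t\<in>?Z. of_int (e t) * ew p t) =
      (\<Sum>t\<in>?Z. of_int (c t) * ew p t) - of_int (c 0) * (\<Sum>t\<in>?Z. ew p t)"
    by (subst ce) (simp add: sum_distrib_left algebra_simps flip: sum_subtractf)
  also have "\<dots> = 0" using z sum_ew[OF p0, of 1] p1 by (simp add: zdvd1_eq)
  finally have "vanishing p e"
    using per p0 by (simp add: vanishing_def e_def periodic_def)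
  show ?case
  proof (rule ccontr)
    assume ne: "c t \<noteq> c 0"
    let ?M = "\<lambda>c. \<Sum>t\<in>?Z. \<bar>c t - c 0\<bar>"
    have Mc: "?M c = int p * ?M e"
    proof -
      have "\<bar>c t - c 0\<bar> = int p * \<bar>e t - e 0\<bar>" for t
        by (subst ce) (simp add: e0 abs_mult)
      then show ?thesis by (simp add: sum_distrib_left)
    qed
    have "?M c \<noteq> 0"
    proof
      assume "?M c = 0"
      then have "\<forall>u\<in>?Z. \<bar>c u - c 0\<bar> = 0"
        by (intro iffD1[OF sum_nonneg_eq_0_iff]) auto
      moreover have "t mod int p \<in> ?Z" using p0 by simp
      ultimately have "\<bar>c (t mod int p) - c 0\<bar> = 0" by blast
      then have "c (t mod int p) = c 0" by linarith
      then show False using ne periodicD[OF per] by metis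
    qed
    then have "?M e \<noteq> 0" unfolding Mc by (metis mult_zero_right)
    moreover have "0 \<le> ?M e" by (rule sum_nonneg) simp
    ultimately have "?M e > 0" by linarith
    then have "?M e < ?M c" unfolding Mc using p1 by simp
    then have "nat (?M e) < nat (?M c)" using \<open>?M e > 0\<close> by simp
    then have "e t = e 0" by (rule less.hyps[OF _ \<open>vanishing p e\<close>])
    then show False using ne ce[of t] e0 by simp
  qed
qed

text \<open>Galois conjugation. Collecting the coefficients by exponent modulo p gives a constant
  function, and constant coefficients give zero at every nontrivial power.\<close>

lemma root_relation_conjugate:
  assumes p: "prime p" "odd p" and fin: "finite I"
    and z: "(\<Sum>i\<in>I. of_int (m i) * ew p (e i)) = 0" and k: "\<not> int p dvd k"
  shows "(\<Sum>i\<in>I. of_int (m i) * ew p (k * e i)) = 0"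
proof -
  let ?Z = "{0..<int p}"
  have p0: "p > 0" using p by (simp add: prime_gt_0_nat)
  define c where "c t = (\<Sum>i | i \<in> I \<and> e i mod int p = t mod int p. m i)" for t
  have sum_c: "(\<Sum>t\<in>?Z. of_int (c t) * ew p (k * t)) = (\<Sum>i\<in>I. of_int (m i) * ew p (k * e i))" for k
  proof -
    have "(\<Sum>t\<in>?Z. of_int (c t) * ew p (k * t))
        = (\<Sum>t\<in>?Z. \<Sum>i | i \<in> I \<and> e i mod int p = t. of_int (m i) * ew p (k * e i))"
    proof (rule sum.cong[OF refl])
      fix t assume t: "t \<in> ?Z"
      have "ew p (k * e i) = ew p (k * t)" if "e i mod int p = t" for i
        using that periodic_ew[OF p0, of k] by (metis periodicD)
      with t show "of_int (c t) * ew p (k * t)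
          = (\<Sum>i | i \<in> I \<and> e i mod int p = t. of_int (m i) * ew p (k * e i))"
        by (auto simp: c_def sum_distrib_right intro!: sum.cong)
    qed
    also have "\<dots> = (\<Sum>i\<in>I. of_int (m i) * ew p (k * e i))"
      by (rule sum.group) (use fin p0 in auto)
    finally show ?thesis .
  qed
  have "vanishing p c"
    using sum_c[of 1] z by (simp add: vanishing_def periodic_def c_def)
  then have const: "c t = c 0" for t by (rule vanishing_const[OF p])
  have "(\<Sum>t\<in>?Z. of_int (c t) * ew p (k * t)) = of_int (c 0) * (\<Sum>t\<in>?Z. ew p (k * t))"
    unfolding sum_distrib_left by (rule sum.cong[OF refl]) (metis const)
  also have "\<dots> = 0" using sum_ew[OF p0] k by simp
  finally show ?thesis by (simp add: sum_c)
qed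

section \<open>Finite Fourier transform\<close>

definition ft :: "nat \<Rightarrow> (int \<Rightarrow> complex) \<Rightarrow> int \<Rightarrow> complex"
  where "ft p f \<xi> = (\<Sum>t\<in>{0..<int p}. f t * ew p (\<xi> * t))"

lemma ft_inversion:
  assumes "p > 0" "periodic (int p) f"
  shows "(\<Sum>\<xi>\<in>{0..<int p}. ft p f \<xi> * ew p (- (\<xi> * x))) = of_nat p * f x"
proof -
  let ?Z = "{0..<int p}"
  have "(\<Sum>\<xi>\<in>?Z. ft p f \<xi> * ew p (- (\<xi> * x)))
      = (\<Sum>\<xi>\<in>?Z. \<Sum>t\<in>?Z. f t * ew p ((t - x) * \<xi>))"
    unfolding ft_def sum_distrib_right
    by (intro sum.cong refl) (simp add: mult.assoc algebra_simps flip: ew_add)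
  also have "\<dots> = (\<Sum>t\<in>?Z. f t * (\<Sum>\<xi>\<in>?Z. ew p ((t - x) * \<xi>)))"
    by (subst sum.swap) (simp add: sum_distrib_left)
  also have "\<dots> = (\<Sum>t\<in>?Z. if t = x mod int p then of_nat p * f t else 0)"
  proof (rule sum.cong[OF refl])
    fix t assume t: "t \<in> ?Z"
    then have "int p dvd t - x \<longleftrightarrow> t = x mod int p"
      by (metis atLeastLessThan_iff mod_eq_dvd_iff mod_pos_pos_trivial)
    then show "f t * (\<Sum>\<xi>\<in>?Z. ew p ((t - x) * \<xi>)) = (if t = x mod int p then of_nat p * f t else 0)"
      by (simp add: sum_ew[OF assms(1)])
  qed
  also have "\<dots> = of_nat p * f x"
    using assms by (simp add: periodicD)
  finally show ?thesis .
qed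

lemma ft_zero_const:
  assumes "p > 0" "periodic (int p) f" and z: "\<And>\<xi>. \<not> int p dvd \<xi> \<Longrightarrow> ft p f \<xi> = 0"
  shows "f x = f y"
proof -
  have "of_nat p * f x = ft p f 0" for x
  proof -
    have "{0..<int p} = insert 0 ({0..<int p} - {0})" using assms(1) by auto
    then have "(\<Sum>\<xi>\<in>{0..<int p}. ft p f \<xi> * ew p (- (\<xi> * x)))
        = ft p f 0 + (\<Sum>\<xi>\<in>{0..<int p} - {0}. ft p f \<xi> * ew p (- (\<xi> * x)))"
      by (subst (1) \<open>_ = insert 0 _\<close>, subst sum.insert) auto
    also have "(\<Sum>\<xi>\<in>{0..<int p} - {0}. ft p f \<xi> * ew p (- (\<xi> * x))) = 0"
      by (rule sum.neutral) (auto dest: zdvd_imp_le intro!: z)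
    finally show ?thesis using ft_inversion[OF assms(1,2), of x] by simp
  qed
  then have "of_nat p * f x = of_nat p * f y" by simp
  then show ?thesis using assms(1) by simp
qed

lemma periodic_ft: "p > 0 \<Longrightarrow> periodic (int p) (ft p f)"
proof (rule periodicI)
  fix x y assume "p > 0" "int p dvd x - y"
  then have "ew p (x * t) = ew p (y * t)" for t
    by (intro ew_cong) (auto simp flip: left_diff_distrib)
  then show "ft p f x = ft p f y" by (simp add: ft_def)
qed

lemma ft_plancherel:
  assumes "p > 0" "periodic (int p) f"
  shows "(\<Sum>\<xi>\<in>{0..<int p}. ft p f \<xi> * ft p g (- \<xi>)) = of_nat p * (\<Sum>t\<in>{0..<int p}. f t * g t)"
proof -
  let ?Z = "{0..<int p}"
  have "(\<Sum>\<xi>\<in>?Z. ft p f \<xi> * ft p g (- \<xi>))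
      = (\<Sum>\<xi>\<in>?Z. \<Sum>t\<in>?Z. g t * (ft p f \<xi> * ew p (- (\<xi> * t))))"
    by (intro sum.cong refl) (simp add: ft_def[of p g] sum_distrib_left mult_ac)
  also have "\<dots> = (\<Sum>t\<in>?Z. g t * (of_nat p * f t))"
    by (subst sum.swap) (simp add: ft_inversion[OF assms] flip: sum_distrib_left)
  finally show ?thesis by (simp add: sum_distrib_left mult_ac)
qed

section \<open>Fourier transforms of colorings\<close>

text \<open>Three colorings with a common set of colors are allowed because the three variables may
  run through different residue classes.\<close>

definition rf3 :: "nat \<Rightarrow> int \<Rightarrow> int \<Rightarrow> int \<Rightarrow> int \<Rightarrow> (int \<Rightarrow> 'c) \<Rightarrow> (int \<Rightarrow> 'c) \<Rightarrow> (int \<Rightarrow> 'c) \<Rightarrow> bool"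
  where "rf3 m a1 a2 a3 b f g h \<longleftrightarrow>
    (\<forall>x y z. int m dvd a1 * x + a2 * y + a3 * z - b \<longrightarrow> f x = g y \<or> g y = h z \<or> f x = h z)"

lemma rf3_swap12: "rf3 m a1 a2 a3 b f g h \<Longrightarrow> rf3 m a2 a1 a3 b g f h"
  unfolding rf3_def by (metis add.commute)

lemma rf3_rotate: "rf3 m a1 a2 a3 b f g h \<Longrightarrow> rf3 m a3 a1 a2 b h f g"
  unfolding rf3_def by (metis add.assoc add.commute)

definition cft :: "nat \<Rightarrow> (int \<Rightarrow> 'c) \<Rightarrow> int \<Rightarrow> 'c \<Rightarrow> complex"
  where "cft p F \<xi> X = ft p (\<lambda>t. of_bool (F t = X)) \<xi>"

definition minor :: "('c \<Rightarrow> complex) \<Rightarrow> ('c \<Rightarrow> complex) \<Rightarrow> 'c \<Rightarrow> 'c \<Rightarrow> complex"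
  where "minor u v X Y = u X * v Y - u Y * v X"

text \<open>The zero vector is parallel to everything, so transitivity needs a middle vector with a
  nonzero coordinate, as in \<open>par_trans\<close>.\<close>

definition par :: "('c \<Rightarrow> complex) \<Rightarrow> ('c \<Rightarrow> complex) \<Rightarrow> bool"
  where "par u v \<longleftrightarrow> (\<forall>X Y. minor u v X Y = 0)"

lemma par_refl [simp]: "par u u"
  by (simp add: par_def minor_def)

lemma minor_commute: "minor v u X Y = - minor u v X Y"
  by (simp add: minor_def)

lemma par_commute: "par u v \<longleftrightarrow> par v u"
  by (auto simp: par_def minor_commute[of v u])

lemma parD: "par u v \<Longrightarrow> u X * v Y = u Y * v X"
  by (simp add: par_def minor_def)

lemma par_scalar:
  assumes "par u v" "u X \<noteq> 0" "v X \<noteq> 0"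
  shows "\<exists>r. r \<noteq> 0 \<and> v = (\<lambda>Y. r * u Y)"
  by (rule exI[of _ "v X / u X"]) (use parD[OF assms(1), of _ X] assms(2,3) in \<open>auto simp: field_simps\<close>)

lemma par_trans:
  assumes "par u v" "par v w" "v X \<noteq> 0"
  shows "par u w"
proof -
  have uY: "u Y = u X * v Y / v X" for Y
    using parD[OF assms(1), of X Y] assms(3) by (simp add: field_simps)
  have wY: "w Y = w X * v Y / v X" for Y
    using parD[OF assms(2), of X Y] assms(3) by (simp add: field_simps)
  have "u X1 * w Y1 = u Y1 * w X1" for X1 Y1
    unfolding uY[of X1] wY[of Y1] uY[of Y1] wY[of X1] by simp
  then show ?thesis by (simp add: par_def minor_def)
qed

lemma periodic_cft: "p > 0 \<Longrightarrow> periodic (int p) (cft p F)"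
  using periodic_ft[of p] by (simp add: periodic_def cft_def fun_eq_iff)

lemma cft_cong: "p > 0 \<Longrightarrow> int p dvd x - y \<Longrightarrow> cft p F x = cft p F y"
  using periodic_cft periodic_cong by blast

lemma cft_minus: "cft p F (- \<xi>) X = cnj (cft p F \<xi> X)"
  by (simp add: cft_def ft_def ew_minus)

lemma par_cft_uminus: "par (cft p F (- x)) (cft p F (- y)) \<longleftrightarrow> par (cft p F x) (cft p F y)"
proof -
  have "minor (cft p F (- x)) (cft p F (- y)) X Y = cnj (minor (cft p F x) (cft p F y) X Y)" for X Y
    by (simp add: minor_def cft_minus)
  then show ?thesis by (simp add: par_def)
qed

lemma cft_0: "cft p F 0 X = of_nat (card {t \<in> {0..<int p}. F t = X})"
  by (simp add: cft_def ft_def of_bool_def sum.If_cases Int_def)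

lemma card_color_0_iff:
  assumes "p > 0" "periodic (int p) F"
  shows "card {t \<in> {0..<int p}. F t = X} = 0 \<longleftrightarrow> X \<notin> range F"
proof -
  have "finite {t \<in> {0..<int p}. F t = X}" by (rule finite_subset[of _ "{0..<int p}"]) auto
  then show ?thesis
    using periodic_range[of "int p" F] assms by (auto simp: card_eq_0_iff image_iff)
qed

lemma card_color_full_iff:
  assumes "p > 0" "periodic (int p) F"
  shows "card {t \<in> {0..<int p}. F t = X} = p \<longleftrightarrow> range F = {X}"
proof -
  have "card {t \<in> {0..<int p}. F t = X} = p \<longleftrightarrow> {t \<in> {0..<int p}. F t = X} = {0..<int p}"
  proof
    assume "card {t \<in> {0..<int p}. F t = X} = p"
    then show "{t \<in> {0..<int p}. F t = X} = {0..<int p}"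
      by (intro card_subset_eq) auto
  next
    assume "{t \<in> {0..<int p}. F t = X} = {0..<int p}"
    then show "card {t \<in> {0..<int p}. F t = X} = p" by (simp only:) simp
  qed
  also have "\<dots> \<longleftrightarrow> (\<forall>t\<in>{0..<int p}. F t = X)" by blast
  also have "\<dots> \<longleftrightarrow> F ` {0..<int p} = {X}"
  proof -
    have "0 \<in> {0..<int p}" using assms(1) by simp
    then have "F ` {0..<int p} = {X} \<longleftrightarrow> F ` {0..<int p} \<subseteq> {X}"
      by (metis empty_iff image_is_empty order_refl subset_singletonD)
    then show ?thesis by (simp only: image_subset_iff singleton_iff)
  qed
  finally show ?thesis using periodic_range[of "int p" F] assms by simp
qed

lemma cft_outside: "X \<notin> range F \<Longrightarrow> cft p F \<xi> X = 0"
  unfolding cft_def ft_def by (rule sum.neutral) auto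

lemma solve_cong_prime:
  fixes k c :: int
  assumes "prime p" "\<not> int p dvd k"
  obtains x where "int p dvd k * x - c"
proof -
  have "coprime k (int p)"
    using assms by (metis coprime_commute prime_imp_coprime prime_nat_int_transfer)
  then obtain y where "[k * y = 1] (mod int p)" by (metis cong_solve_coprime_int)
  then have "int p dvd (k * y - 1) * c" by (simp add: cong_iff_dvd_diff)
  also have "(k * y - 1) * c = k * (y * c) - c" by (simp add: algebra_simps)
  finally show thesis by (rule that)
qed

lemma prime_int_dvd_mult_iff:
  "prime p \<Longrightarrow> int p dvd a * b \<longleftrightarrow> int p dvd a \<or> int p dvd b"
  by (simp add: prime_dvd_mult_iff)

locale odd_prime =
  fixes p :: nat
  assumes prime: "prime p" and odd: "odd p"
begin

lemma p_pos: "p > 0" using prime by (simp add: prime_gt_0_nat)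

text \<open>A minor of two transforms is an integer combination of p-th roots of unity, and
  conjugating the roots multiplies both frequencies by \<open>k\<close>.\<close>

lemma minor_cft_scale:
  assumes "minor (cft p F x) (cft p F y) X Y = 0" "\<not> int p dvd k"
  shows "minor (cft p F (k * x)) (cft p F (k * y)) X Y = 0"
proof -
  let ?Z = "{0..<int p}"
  have *: "minor (cft p F x) (cft p F y) X Y = (\<Sum>(s, t)\<in>?Z \<times> ?Z.
      of_int (of_bool (F s = X) * of_bool (F t = Y) - of_bool (F s = Y) * of_bool (F t = X)) * ew p (x * s + y * t))"
    for x y X Y
    unfolding minor_def cft_def ft_def sum_product sum.cartesian_product
    by (simp add: sum_subtractf[symmetric] ew_add algebra_simps split_def
      del: sum_of_bool_mult_eq sum_mult_of_bool_eq)
  show ?thesis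
    using assms(1) root_relation_conjugate[OF prime odd _ _ assms(2), of "?Z \<times> ?Z"
        "\<lambda>(s, t). of_bool (F s = X) * of_bool (F t = Y) - of_bool (F s = Y) * of_bool (F t = X)"
        "\<lambda>(s, t). x * s + y * t"]
    by (simp add: * split_def distrib_left mult.assoc)
qed

lemma par_cft_scale:
  assumes "par (cft p F x) (cft p F y)" "\<not> int p dvd k"
  shows "par (cft p F (k * x)) (cft p F (k * y))"
  unfolding par_def
  by (intro allI minor_cft_scale[OF _ assms(2)]) (use assms(1) in \<open>simp add: par_def\<close>)

text \<open>By conjugation a zero at one nontrivial frequency would be a zero at all of them, and
  the indicator of the color would be constant.\<close>

lemma cft_nonzero:
  assumes per: "periodic (int p) F" and xi: "\<not> int p dvd \<xi>" and X: "F s = X" "F t \<noteq> X"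
  shows "cft p F \<xi> X \<noteq> 0"
proof
  assume z: "cft p F \<xi> X = 0"
  have "ft p (\<lambda>t. of_bool (F t = X)) \<eta> = 0" if eta: "\<not> int p dvd \<eta>" for \<eta>
  proof -
    obtain k where k: "int p dvd \<xi> * k - \<eta>" using solve_cong_prime[OF prime xi] by blast
    have nk: "\<not> int p dvd k"
      using k eta by (metis dvd_diff_right_iff dvd_mult)
    have "(\<Sum>t\<in>{0..<int p}. of_int (of_bool (F t = X)) * ew p (k * (\<xi> * t))) = 0"
      by (rule root_relation_conjugate[OF prime odd _ _ nk]) (use z in \<open>auto simp: cft_def ft_def\<close>)
    then have "cft p F (k * \<xi>) X = 0" by (simp add: cft_def ft_def mult.assoc)
    moreover have "cft p F (k * \<xi>) = cft p F \<eta>"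
      by (rule cft_cong[OF p_pos]) (use k in \<open>simp add: mult.commute\<close>)
    ultimately show ?thesis by (simp add: cft_def)
  qed
  moreover have "periodic (int p) (\<lambda>t. of_bool (F t = X) :: complex)"
    using per by (simp add: periodic_def)
  ultimately have "(of_bool (F s = X) :: complex) = of_bool (F t = X)"
    by (intro ft_zero_const[OF p_pos])
  then show False using X by simp
qed

end

text \<open>The solutions are parametrized by \<open>x\<close> and \<open>y\<close>. Each summand
  contains only two of the three functions, so the equation can be used to remove the remaining
  variable from the character; this leaves a product of two transforms and a phase from
  \<open>b\<close>.\<close>

lemma rf3_fourier_aux:
  fixes f g h :: "int \<Rightarrow> complex"
  assumes p: "prime p" and per: "periodic (int p) f" "periodic (int p) g" "periodic (int p) h"
    and a: "\<not> int p dvd a1" "\<not> int p dvd a2" "\<not> int p dvd a3"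
    and c: "int p dvd a3 * c - 1"
    and z_def: "\<And>x y. z x y = c * (b - a1 * x - a2 * y)"
  shows "(\<Sum>x\<in>{0..<int p}. \<Sum>y\<in>{0..<int p}. f x * g y * ew p (a1 * u1 * x + a2 * u2 * y + a3 * u3 * z x y))
      = ew p (u3 * b) * (ft p f (a1 * (u1 - u3)) * ft p g (a2 * (u2 - u3)))" (is ?t12)
    and "(\<Sum>x\<in>{0..<int p}. \<Sum>y\<in>{0..<int p}. g y * h (z x y) * ew p (a1 * u1 * x + a2 * u2 * y + a3 * u3 * z x y))
      = ew p (u1 * b) * (ft p g (a2 * (u2 - u1)) * ft p h (a3 * (u3 - u1)))" (is ?t23)
    and "(\<Sum>x\<in>{0..<int p}. \<Sum>y\<in>{0..<int p}. h (z x y) * f x * ew p (a1 * u1 * x + a2 * u2 * y + a3 * u3 * z x y))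
      = ew p (u2 * b) * (ft p h (a3 * (u3 - u2)) * ft p f (a1 * (u1 - u2)))" (is ?t31)
proof -
  let ?Z = "{0..<int p}"
  have p0: "p > 0" using p by (simp add: prime_gt_0_nat)
  have z: "int p dvd a1 * x + a2 * y + a3 * z x y - b" for x y
  proof -
    have "a1 * x + a2 * y + a3 * z x y - b = (a3 * c - 1) * (b - a1 * x - a2 * y)"
      by (simp add: z_def algebra_simps)
    then show ?thesis using c by simp
  qed
  have pc: "\<not> int p dvd c"
    using c by (metis dvd_diff_right_iff dvd_mult not_prime_unit p prime_nat_int_transfer)
  have cop: "coprime k (int p)" if "\<not> int p dvd k" for k
    using that p by (metis coprime_commute prime_imp_coprime prime_nat_int_transfer)
  have e12: "ew p (a1 * u1 * x + a2 * u2 * y + a3 * u3 * z x y)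
      = ew p (u3 * b) * (ew p (a1 * (u1 - u3) * x) * ew p (a2 * (u2 - u3) * y))" for x y
  proof -
    have "ew p (a1 * u1 * x + a2 * u2 * y + a3 * u3 * z x y)
        = ew p (u3 * b + (a1 * (u1 - u3) * x + a2 * (u2 - u3) * y))"
      by (rule ew_cong[OF p0]) (use dvd_mult[OF z[of x y], of u3] in \<open>simp add: algebra_simps\<close>)
    then show ?thesis by (simp only: ew_add)
  qed
  have e23: "ew p (a1 * u1 * x + a2 * u2 * y + a3 * u3 * z x y)
      = ew p (u1 * b) * (ew p (a2 * (u2 - u1) * y) * ew p (a3 * (u3 - u1) * z x y))" for x y
  proof -
    have "ew p (a1 * u1 * x + a2 * u2 * y + a3 * u3 * z x y)
        = ew p (u1 * b + (a2 * (u2 - u1) * y + a3 * (u3 - u1) * z x y))"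
      by (rule ew_cong[OF p0]) (use dvd_mult[OF z[of x y], of u1] in \<open>simp add: algebra_simps\<close>)
    then show ?thesis by (simp only: ew_add)
  qed
  have e31: "ew p (a1 * u1 * x + a2 * u2 * y + a3 * u3 * z x y)
      = ew p (u2 * b) * (ew p (a3 * (u3 - u2) * z x y) * ew p (a1 * (u1 - u2) * x))" for x y
  proof -
    have "ew p (a1 * u1 * x + a2 * u2 * y + a3 * u3 * z x y)
        = ew p (u2 * b + (a3 * (u3 - u2) * z x y + a1 * (u1 - u2) * x))"
      by (rule ew_cong[OF p0]) (use dvd_mult[OF z[of x y], of u2] in \<open>simp add: algebra_simps\<close>)
    then show ?thesis by (simp only: ew_add)
  qed
  show ?t12
    unfolding e12 ft_def sum_product by (simp add: sum_distrib_left mult_ac)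
  have per_h: "periodic (int p) (\<lambda>t. h t * ew p (k * t))" for k
    using per periodic_ew[OF p0, of k] by (simp add: periodic_def)
  have hx: "(\<Sum>x\<in>?Z. h (z x y) * ew p (k * z x y)) = ft p h k" for y k
  proof -
    have "z x y = (- c * a1) * x + c * (b - a2 * y)" for x by (simp add: z_def algebra_simps)
    moreover have "coprime (- c * a1) (int p)"
      using pc a p by (intro cop) (simp add: prime_int_dvd_mult_iff)
    ultimately show ?thesis
      unfolding ft_def using sum_periodic_affine[OF _ _ per_h, of "- c * a1" "c * (b - a2 * y)" k] p0 by simp
  qed
  have hy: "(\<Sum>y\<in>?Z. h (z x y) * ew p (k * z x y)) = ft p h k" for x k
  proof -
    have "z x y = (- c * a2) * y + c * (b - a1 * x)" for y by (simp add: z_def algebra_simps)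
    moreover have "coprime (- c * a2) (int p)"
      using pc a p by (intro cop) (simp add: prime_int_dvd_mult_iff)
    ultimately show ?thesis
      unfolding ft_def using sum_periodic_affine[OF _ _ per_h, of "- c * a2" "c * (b - a1 * x)" k] p0 by simp
  qed
  have "(\<Sum>x\<in>?Z. \<Sum>y\<in>?Z. g y * h (z x y) * ew p (a1 * u1 * x + a2 * u2 * y + a3 * u3 * z x y))
      = (\<Sum>y\<in>?Z. ew p (u1 * b) * (g y * ew p (a2 * (u2 - u1) * y)) *
          (\<Sum>x\<in>?Z. h (z x y) * ew p (a3 * (u3 - u1) * z x y)))"
    unfolding e23 sum_distrib_left by (subst sum.swap) (simp add: mult_ac)
  also have "\<dots> = ew p (u1 * b) * (ft p g (a2 * (u2 - u1)) * ft p h (a3 * (u3 - u1)))"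
    unfolding hx by (simp add: ft_def[of p g] sum_distrib_left sum_distrib_right mult_ac)
  finally show ?t23 .
  have "(\<Sum>x\<in>?Z. \<Sum>y\<in>?Z. h (z x y) * f x * ew p (a1 * u1 * x + a2 * u2 * y + a3 * u3 * z x y))
      = (\<Sum>x\<in>?Z. ew p (u2 * b) * (f x * ew p (a1 * (u1 - u2) * x)) *
          (\<Sum>y\<in>?Z. h (z x y) * ew p (a3 * (u3 - u2) * z x y)))"
    unfolding e31 sum_distrib_left by (simp add: mult_ac)
  also have "\<dots> = ew p (u2 * b) * (ft p h (a3 * (u3 - u2)) * ft p f (a1 * (u1 - u2)))"
    unfolding hy by (simp add: ft_def[of p f] sum_distrib_left sum_distrib_right mult_ac)
  finally show ?t31 .
qed

text \<open>For a rainbow-free triple the alternating sum \<open>D(x,y) + D(y,z) + D(z,x)\<close>, where \<open>D\<close> is the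
  minor of the indicators of two colors, vanishes on all solutions; no term involves three
  colorings at once, so its Fourier transform stays quadratic.\<close>

lemma rf3_fourier:
  assumes p: "prime p" and rf: "rf3 p a1 a2 a3 b f g h"
    and per: "periodic (int p) f" "periodic (int p) g" "periodic (int p) h"
    and a: "\<not> int p dvd a1" "\<not> int p dvd a2" "\<not> int p dvd a3"
  shows "ew p (u3 * b) * minor (cft p f (a1 * (u1 - u3))) (cft p g (a2 * (u2 - u3))) X Y
       + ew p (u1 * b) * minor (cft p g (a2 * (u2 - u1))) (cft p h (a3 * (u3 - u1))) X Y
       + ew p (u2 * b) * minor (cft p h (a3 * (u3 - u2))) (cft p f (a1 * (u1 - u2))) X Y = 0"
proof -
  let ?Z = "{0..<int p}"
  obtain c where c: "int p dvd a3 * c - 1" using solve_cong_prime[OF p a(3)] by blast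
  define z where "z x y = c * (b - a1 * x - a2 * y)" for x y
  let ?i = "\<lambda>F X t. of_bool (F t = X) :: complex"
  have per': "periodic (int p) (?i f X)" "periodic (int p) (?i g X)" "periodic (int p) (?i h X)" for X
    using per by (auto simp: periodic_def)
  note aux = rf3_fourier_aux[OF p per' a c, of z b, OF z_def]
  have zero: "(?i f X x * ?i g Y y - ?i f Y x * ?i g X y)
      + (?i g X y * ?i h Y (z x y) - ?i g Y y * ?i h X (z x y))
      + (?i h X (z x y) * ?i f Y x - ?i h Y (z x y) * ?i f X x) = 0" for x y
  proof -
    have "a1 * x + a2 * y + a3 * z x y - b = (a3 * c - 1) * (b - a1 * x - a2 * y)"
      by (simp add: z_def algebra_simps)
    then have "int p dvd a1 * x + a2 * y + a3 * z x y - b" using c by simp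
    then have "f x = g y \<or> g y = h (z x y) \<or> f x = h (z x y)"
      using rf unfolding rf3_def by blast
    then show ?thesis by (elim disjE) simp_all
  qed
  let ?e = "\<lambda>x y. ew p (a1 * u1 * x + a2 * u2 * y + a3 * u3 * z x y)"
  have "0 = (\<Sum>x\<in>?Z. \<Sum>y\<in>?Z. ((?i f X x * ?i g Y y - ?i f Y x * ?i g X y)
      + (?i g X y * ?i h Y (z x y) - ?i g Y y * ?i h X (z x y))
      + (?i h X (z x y) * ?i f Y x - ?i h Y (z x y) * ?i f X x)) * ?e x y)"
    unfolding zero by simp
  also have "\<dots> = (\<Sum>x\<in>?Z. \<Sum>y\<in>?Z. ?i f X x * ?i g Y y * ?e x y) - (\<Sum>x\<in>?Z. \<Sum>y\<in>?Z. ?i f Y x * ?i g X y * ?e x y)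
      + (\<Sum>x\<in>?Z. \<Sum>y\<in>?Z. ?i g X y * ?i h Y (z x y) * ?e x y) - (\<Sum>x\<in>?Z. \<Sum>y\<in>?Z. ?i g Y y * ?i h X (z x y) * ?e x y)
      + (\<Sum>x\<in>?Z. \<Sum>y\<in>?Z. ?i h X (z x y) * ?i f Y x * ?e x y) - (\<Sum>x\<in>?Z. \<Sum>y\<in>?Z. ?i h Y (z x y) * ?i f X x * ?e x y)"
    by (simp only: distrib_right left_diff_distrib sum.distrib sum_subtractf) (simp only: algebra_simps)
  also have "\<dots> = ew p (u3 * b) * minor (cft p f (a1 * (u1 - u3))) (cft p g (a2 * (u2 - u3))) X Y
       + ew p (u1 * b) * minor (cft p g (a2 * (u2 - u1))) (cft p h (a3 * (u3 - u1))) X Y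
       + ew p (u2 * b) * minor (cft p h (a3 * (u3 - u2))) (cft p f (a1 * (u1 - u2))) X Y"
    unfolding aux(1) aux(2) aux(3) minor_def cft_def by (simp add: algebra_simps)
  finally show ?thesis by simp
qed

section \<open>Identities for a coloring F at two positions and a coloring G at the third\<close>

context odd_prime
begin

text \<open>\<open>G\<close> is called the successor of \<open>F\<close>: for residue classes it is
  the class that contains the third variable when the first two lie in the class of
  \<open>F\<close>. A common shift of the three frequency parameters only changes a phase, so the
  one belonging to \<open>G\<close> is set to 0.\<close>

lemma succ_identity:
  assumes rf: "rf3 p a1 a2 a3 b F F G" and per: "periodic (int p) F" "periodic (int p) G"
    and a: "\<not> int p dvd a1" "\<not> int p dvd a2" "\<not> int p dvd a3"
  shows "minor (cft p F (a1 * x)) (cft p F (a2 * y)) X Y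
       + ew p (x * b) * minor (cft p F (a2 * (y - x))) (cft p G (- a3 * x)) X Y
       + ew p (y * b) * minor (cft p G (- a3 * y)) (cft p F (a1 * (x - y))) X Y = 0"
  using rf3_fourier[OF prime rf per(1) per(1) per(2) a, of 0 x y X Y] by simp

text \<open>With a nonzero frequency parameter only at the position of \<open>G\<close>, the two
  terms that involve \<open>G\<close> are opposite minors and cancel, whatever \<open>G\<close>
  is.\<close>

lemma succ_par:
  assumes rf: "rf3 p a1 a2 a3 b F F G" and per: "periodic (int p) F" "periodic (int p) G"
    and a: "\<not> int p dvd a1" "\<not> int p dvd a2" "\<not> int p dvd a3"
  shows "par (cft p F (a1 * x)) (cft p F (a2 * x))"
proof -
  have "minor (cft p F (a1 * - x)) (cft p F (a2 * - x)) X Y = 0" for X Y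
    using rf3_fourier[OF prime rf3_rotate[OF rf] per(2) per(1) per(1) a(3) a(1) a(2), of 0 x 0 X Y]
    by (simp add: minor_commute[of "cft p G (a3 * x)"])
  then have "par (cft p F (- (a1 * x))) (cft p F (- (a2 * x)))" by (simp add: par_def)
  then show ?thesis by (simp add: par_cft_uminus)
qed

text \<open>The case \<open>y = 0\<close>: the failure of \<open>F\<close> and \<open>G\<close> to
  be parallel is measured by the difference of their color counts, which are the transforms at
  frequency 0.\<close>

lemma succ_diff:
  assumes rf: "rf3 p a1 a2 a3 b F F G" and per: "periodic (int p) F" "periodic (int p) G"
    and a: "\<not> int p dvd a1" "\<not> int p dvd a2" "\<not> int p dvd a3"
  shows "ew p (x * b) * minor (cft p F (- a2 * x)) (cft p G (- a3 * x)) X Y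
       = minor (\<lambda>X. cft p F 0 X - cft p G 0 X) (cft p F (a1 * x)) X Y"
proof -
  have "minor (cft p F (a1 * x)) (cft p F 0) X Y
       + ew p (x * b) * minor (cft p F (- a2 * x)) (cft p G (- a3 * x)) X Y
       + minor (cft p G 0) (cft p F (a1 * x)) X Y = 0"
    using succ_identity[OF rf per a, of x 0 X Y] by simp
  then have "ew p (x * b) * minor (cft p F (- a2 * x)) (cft p G (- a3 * x)) X Y
      = - minor (cft p F (a1 * x)) (cft p F 0) X Y - minor (cft p G 0) (cft p F (a1 * x)) X Y"
    by (simp only: add_eq_0_iff) (simp add: algebra_simps add_eq_0_iff)
  then show ?thesis by (simp add: minor_def algebra_simps)
qed

end

text \<open>Modulo \<open>p\<close>, the set \<open>S\<close> is closed under the six maps \<open>x \<mapsto> - (a\<^sub>u / a\<^sub>v) * x\<close>.\<close>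

definition ratio_closed :: "nat \<Rightarrow> int \<Rightarrow> int \<Rightarrow> int \<Rightarrow> int set \<Rightarrow> bool"
  where "ratio_closed p a1 a2 a3 S \<longleftrightarrow> (\<forall>x\<in>S. \<forall>y.
    int p dvd a1 * x + a2 * y \<or> int p dvd a1 * x + a3 * y \<or> int p dvd a2 * x + a1 * y \<or>
    int p dvd a2 * x + a3 * y \<or> int p dvd a3 * x + a1 * y \<or> int p dvd a3 * x + a2 * y \<longrightarrow> y \<in> S)"

definition splits :: "nat \<Rightarrow> int \<Rightarrow> int \<Rightarrow> int \<Rightarrow> bool"
  where "splits p a1 a2 a3 \<longleftrightarrow> (\<exists>S. ratio_closed p a1 a2 a3 S \<and>
    (\<exists>x\<in>S. \<not> int p dvd x) \<and> (\<exists>y. \<not> int p dvd y \<and> y \<notin> S))"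

section \<open>Colorings with one direction for each frequency\<close>

text \<open>The vectors at \<open>a1 * x\<close>, \<open>a2 * x\<close> and \<open>a3 * x\<close>
  have one common direction, represented by \<open>P x\<close>. By \<open>succ_par\<close> this is
  available as soon as \<open>F\<close> has successors at both the third and the second
  position.\<close>

locale aligned_coloring = odd_prime p for p :: nat +
  fixes a1 a2 a3 :: int and F :: "int \<Rightarrow> 'c"
  assumes a: "\<not> int p dvd a1" "\<not> int p dvd a2" "\<not> int p dvd a3"
    and per: "periodic (int p) F"
    and dir2: "\<And>x. par (cft p F (a1 * x)) (cft p F (a2 * x))"
    and dir3: "\<And>x. par (cft p F (a1 * x)) (cft p F (a3 * x))"
    and nonconst: "\<exists>s t. F s \<noteq> F t"
begin

abbreviation P :: "int \<Rightarrow> 'c \<Rightarrow> complex"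
  where "P x \<equiv> cft p F (a1 * x)"

lemma ndvd_mult: "\<not> int p dvd x \<Longrightarrow> \<not> int p dvd y \<Longrightarrow> \<not> int p dvd x * y"
  using prime by (simp add: prime_int_dvd_mult_iff)

lemma cft_range_nonzero: "X \<in> range F \<Longrightarrow> \<not> int p dvd x \<Longrightarrow> cft p F x X \<noteq> 0"
  using nonconst cft_nonzero[OF per] by (metis imageE)

lemma P_nonzero: "X \<in> range F \<Longrightarrow> \<not> int p dvd x \<Longrightarrow> P x X \<noteq> 0"
  by (simp add: cft_range_nonzero ndvd_mult a)

lemma P_uminus: "P (- x) X = cnj (P x X)"
  using cft_minus[of p F "a1 * x" X] by simp

lemma P_cong: "int p dvd x - y \<Longrightarrow> P x = P y"
  by (rule cft_cong[OF p_pos]) (simp flip: right_diff_distrib)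

lemma par_P_trans: "par (P x) (P y) \<Longrightarrow> par (P y) (P z) \<Longrightarrow> \<not> int p dvd y \<Longrightarrow> par (P x) (P z)"
  using par_trans[of "P x" "P y" "P z" "F 0"] P_nonzero[of "F 0" y] by simp

lemma par_P_scale: "par (P x) (P y) \<Longrightarrow> \<not> int p dvd k \<Longrightarrow> par (P (k * x)) (P (k * y))"
  using par_cft_scale[of F "a1 * x" "a1 * y" k] by (simp add: mult_ac)

lemma par_P_uminus: "par (P (- x)) (P (- y)) \<longleftrightarrow> par (P x) (P y)"
  using par_cft_uminus[of p F "a1 * x" "a1 * y"] by simp

lemma par_P_unscale:
  assumes "par (P (k * x)) (P (k * y))" "\<not> int p dvd k"
  shows "par (P x) (P y)"
proof -
  obtain l where l: "int p dvd k * l - 1" using solve_cong_prime[OF prime assms(2)] by blast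
  have "\<not> int p dvd l"
    using l by (metis dvd_diff_right_iff dvd_mult not_prime_unit prime prime_nat_int_transfer)
  then have "par (P (l * (k * x))) (P (l * (k * y)))" using assms(1) by (rule par_P_scale[rotated])
  moreover have "P (l * (k * x)) = P x" for x
  proof (rule P_cong)
    have "l * (k * x) - x = (k * l - 1) * x" by (simp add: algebra_simps)
    then show "int p dvd l * (k * x) - x" using l by simp
  qed
  ultimately show ?thesis by simp
qed

text \<open>\<open>P (- x)\<close> is the complex conjugate of \<open>P x\<close>, so being parallel
  to it means being real up to a factor. By conjugation of the roots this holds at all nontrivial
  frequencies or at none.\<close>

lemma real_iff: "\<not> int p dvd x \<Longrightarrow> par (P x) (P (- x)) \<longleftrightarrow> par (P 1) (P (- 1))"
  using par_P_scale[of 1 "-1" x] par_P_unscale[of x 1 "-1"] by auto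

text \<open>A linear relation between colors at all nontrivial frequencies makes the same
  combination of their indicators constant. Comparing a point of one of these colors with a point of
  a further color then isolates a coefficient.\<close>

lemma P_const_colors:
  assumes "\<And>x. \<not> int p dvd x \<Longrightarrow> c1 * P x X1 + c2 * P x X2 + c3 * P x X3 = 0"
  shows "c1 * of_bool (F s = X1) + c2 * of_bool (F s = X2) + c3 * of_bool (F s = X3)
       = c1 * of_bool (F t = X1) + c2 * of_bool (F t = X2) + c3 * of_bool (F t = X3)"
proof -
  let ?f = "\<lambda>t. c1 * of_bool (F t = X1) + c2 * of_bool (F t = X2) + c3 * of_bool (F t = X3)"
  have "ft p ?f \<xi> = c1 * cft p F \<xi> X1 + c2 * cft p F \<xi> X2 + c3 * cft p F \<xi> X3" for \<xi>
    by (simp add: cft_def ft_def sum_distrib_left sum.distrib algebra_simps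
        del: sum_of_bool_mult_eq sum_mult_of_bool_eq)
  moreover have "c1 * cft p F \<xi> X1 + c2 * cft p F \<xi> X2 + c3 * cft p F \<xi> X3 = 0" if "\<not> int p dvd \<xi>" for \<xi>
  proof -
    obtain x where x: "int p dvd a1 * x - \<xi>" using solve_cong_prime[OF prime a(1)] by blast
    then have "\<not> int p dvd x" using that by (metis dvd_diff_right_iff dvd_mult)
    moreover have "P x = cft p F \<xi>" by (rule cft_cong[OF p_pos x])
    ultimately show ?thesis using assms by metis
  qed
  moreover have "periodic (int p) ?f" using per by (simp add: periodic_def)
  ultimately show ?thesis using ft_zero_const[OF p_pos, of ?f s t] by simp
qed

lemma all_par_two_colors:
  assumes "\<And>x. \<not> int p dvd x \<Longrightarrow> par (P 1) (P x)"
  shows "card (range F) \<le> 2"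
proof (rule ccontr)
  assume "\<not> ?thesis"
  then have "card (range F) \<ge> 3" by simp
  then obtain T where "T \<subseteq> range F" "card T = 3" by (metis obtain_subset_with_card_n)
  then obtain X Y Z where "T = {X, Y, Z}" "X \<noteq> Y" "Y \<noteq> Z" "X \<noteq> Z" by (metis card_3_iff)
  then have XYZ: "X \<in> range F" "Y \<in> range F" "Z \<in> range F" "X \<noteq> Y" "Y \<noteq> Z" "X \<noteq> Z"
    using \<open>T \<subseteq> range F\<close> by auto
  then obtain s t where st: "F s = X" "F t = Z" by (metis imageE)
  have "P 1 Y * P x X + (- P 1 X) * P x Y + 0 * P x Y = 0" if "\<not> int p dvd x" for x
    using parD[OF assms[OF that], of X Y] by (simp add: algebra_simps)
  from P_const_colors[OF this, of s t] st XYZ have "P 1 Y = 0" by simp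
  moreover have "\<not> int p dvd 1" using prime by (metis not_prime_unit prime_nat_int_transfer)
  ultimately show False using P_nonzero[of Y 1] XYZ by simp
qed

lemma ndvd_1: "\<not> int p dvd 1"
  using prime by (metis not_prime_unit prime_nat_int_transfer)

text \<open>For equal color counts \<open>succ_diff\<close> makes the transform of \<open>G\<close>
  at \<open>- a3 * x\<close> parallel to \<open>P (- x)\<close>. Every vector in
  \<open>succ_identity\<close> is then a nonzero multiple of some \<open>P\<close>, and
  \<open>G\<close> disappears.\<close>

lemma reduced_identity:
  assumes rf: "rf3 p a1 a2 a3 b F F G" and perG: "periodic (int p) G"
    and D: "\<And>X. cft p G 0 X = cft p F 0 X"
    and xy: "\<not> int p dvd x" "\<not> int p dvd y" "\<not> int p dvd y - x"
  shows "\<exists>A B C. A \<noteq> 0 \<and> B \<noteq> 0 \<and> C \<noteq> 0 \<and> (\<forall>X Y. A * minor (P x) (P y) X Y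
      + B * minor (P (y - x)) (P (- x)) X Y + C * minor (P (- y)) (P (x - y)) X Y = 0)"
proof -
  obtain s t where st: "F s \<noteq> F t" using nonconst by blast
  let ?X = "F s"
  have "range F \<noteq> {?X}" using st by (metis rangeI singletonD)
  moreover have eqc: "card {u \<in> {0..<int p}. G u = ?X} = card {u \<in> {0..<int p}. F u = ?X}"
    using D[of ?X] unfolding cft_0 of_nat_eq_iff .
  moreover have "?X \<in> range G"
    using card_color_0_iff[OF p_pos per, of ?X] card_color_0_iff[OF p_pos perG, of ?X] eqc by (metis rangeI)
  ultimately have "?X \<in> range G" "range G \<noteq> {?X}"
    using card_color_full_iff[OF p_pos per, of ?X] card_color_full_iff[OF p_pos perG, of ?X] by metis+
  then have G_st: "\<exists>u v. G u = ?X \<and> G v \<noteq> ?X" by (metis (no_types) UNIV_I UNIV_not_empty image_cong image_constant_conv imageE)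
  have q_nz: "cft p G x ?X \<noteq> 0" if "\<not> int p dvd x" for x
    using G_st cft_nonzero[OF perG that] by blast
  have q_par: "par (P (- x)) (cft p G (- a3 * x))" if "\<not> int p dvd x" for x
  proof -
    have "minor (cft p F (- a2 * x)) (cft p G (- a3 * x)) X Y = 0" for X Y
      using succ_diff[OF rf per perG a, of x X Y] D by (simp add: minor_def)
    then have "par (cft p F (a2 * - x)) (cft p G (- a3 * x))" by (simp add: par_def)
    then show ?thesis
      using par_trans[OF dir2, of "- x" "cft p G (- a3 * x)" ?X] that
      by (metis cft_range_nonzero a(2) dvd_minus_iff ndvd_mult rangeI)
  qed
  have q_sc: "\<exists>r. r \<noteq> 0 \<and> cft p G (- a3 * x) = (\<lambda>Y. r * P (- x) Y)" if "\<not> int p dvd x" for x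
    by (rule par_scalar[OF q_par[OF that], of ?X])
      (use that P_nonzero[of ?X "- x"] q_nz[of "- a3 * x"] a(3) ndvd_mult[of a3 x] in auto)
  have d_sc: "\<exists>r. r \<noteq> 0 \<and> cft p F (a2 * x) = (\<lambda>Y. r * P x Y)" if "\<not> int p dvd x" for x
    by (rule par_scalar[OF dir2, of _ ?X])
      (use that P_nonzero[of ?X x] cft_range_nonzero[of ?X "a2 * x"] a(2) ndvd_mult[of a2 x] in auto)
  obtain r1 where r1: "r1 \<noteq> 0" "cft p F (a2 * y) = (\<lambda>Y. r1 * P y Y)" using d_sc xy by blast
  obtain r2 where r2: "r2 \<noteq> 0" "cft p F (a2 * (y - x)) = (\<lambda>Y. r2 * P (y - x) Y)" using d_sc xy by blast
  obtain r3 where r3: "r3 \<noteq> 0" "cft p G (- a3 * x) = (\<lambda>Y. r3 * P (- x) Y)" using q_sc xy by blast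
  obtain r4 where r4: "r4 \<noteq> 0" "cft p G (- a3 * y) = (\<lambda>Y. r4 * P (- y) Y)" using q_sc xy by blast
  have "r1 * minor (P x) (P y) X Y + (ew p (x * b) * (r2 * r3)) * minor (P (y - x)) (P (- x)) X Y
      + (ew p (y * b) * r4) * minor (P (- y)) (P (x - y)) X Y = 0" for X Y
    using succ_identity[OF rf per perG a, of x y X Y] unfolding r1(2) r2(2) r3(2) r4(2)
    by (simp add: minor_def algebra_simps)
  then show ?thesis using r1(1) r2(1) r3(1) r4(1)
    by (intro exI[of _ r1] exI[of _ "ew p (x * b) * (r2 * r3)"] exI[of _ "ew p (y * b) * r4"]) auto
qed

text \<open>When no direction is real, the set of \<open>x\<close> for which both \<open>P x\<close> and \<open>P (- x)\<close> lie in the plane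
  of \<open>P 1\<close> and \<open>P (- 1)\<close> is closed under subtraction, hence everything.\<close>

lemma nonreal_three_colors:
  assumes rf: "rf3 p a1 a2 a3 b F F G" and perG: "periodic (int p) G"
    and D: "\<And>X. cft p G 0 X = cft p F 0 X"
    and nonreal: "\<not> par (P 1) (P (- 1))"
  shows "card (range F) \<le> 3"
proof (rule ccontr)
  assume "\<not> ?thesis"
  then have card4: "card (range F) \<ge> 4" by simp
  obtain X1 X2 where X12: "minor (P 1) (P (- 1)) X1 X2 \<noteq> 0" using nonreal by (auto simp: par_def)
  then have ne12: "X1 \<noteq> X2" by (auto simp: minor_def)
  have X1: "X1 \<in> range F"
  proof (rule ccontr)
    assume "X1 \<notin> range F"
    then show False using X12 by (simp add: minor_def cft_outside)
  qed
  have X2: "X2 \<in> range F"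
  proof (rule ccontr)
    assume "X2 \<notin> range F"
    then show False using X12 by (simp add: minor_def cft_outside)
  qed
  have fin: "finite (range F)" using card4 by (metis card.infinite not_numeral_le_zero)
  have "card (range F - {X1, X2}) \<ge> 2"
    using card4 ne12 fin X1 X2 by (subst card_Diff_subset) auto
  then obtain X3 X4 where X34: "X3 \<in> range F - {X1, X2}" "X4 \<in> range F - {X1, X2}" "X3 \<noteq> X4"
    by (metis card_le_Suc0_iff_eq finite_Diff fin not_less_eq_eq numeral_2_eq_2)
  \<comment> \<open>These are the coordinates of the cross product of \<open>P 1\<close> and
    \<open>P (- 1)\<close> on three colors, so \<open>\<phi>\<close> vanishes on both vectors, and
    \<open>c3 \<noteq> 0\<close> by the choice of \<open>X1\<close> and \<open>X2\<close>.\<close>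
  define c1 where "c1 = minor (P 1) (P (- 1)) X2 X3"
  define c2 where "c2 = minor (P 1) (P (- 1)) X3 X1"
  define c3 where "c3 = minor (P 1) (P (- 1)) X1 X2"
  define \<phi> where "\<phi> u = c1 * u X1 + c2 * u X2 + c3 * u X3" for u :: "'c \<Rightarrow> complex"
  have \<phi>_sc: "\<phi> (\<lambda>Y. r * u Y) = r * \<phi> u" for r u by (simp add: \<phi>_def algebra_simps)
  have contract: "c1 * minor u v X1 Y + c2 * minor u v X2 Y + c3 * minor u v X3 Y = \<phi> u * v Y - \<phi> v * u Y"
    for u v Y by (simp add: \<phi>_def minor_def algebra_simps)
  define N where "N = {x. int p dvd x \<or> \<phi> (P x) = 0 \<and> \<phi> (P (- x)) = 0}"
  have N1: "1 \<in> N"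
    by (simp add: N_def \<phi>_def c1_def c2_def c3_def minor_def algebra_simps)
  have Nsub: "x - y \<in> N" if xN: "x \<in> N" and yN: "y \<in> N" for x y
  proof -
    consider "int p dvd x" | "int p dvd y" | "int p dvd x - y"
      | "\<not> int p dvd x" "\<not> int p dvd y" "\<not> int p dvd x - y" by blast
    then show ?thesis
    proof cases
      case 1
      then have "P (x - y) = P (- y)" "P (- (x - y)) = P y"
        using P_cong[of "x - y" "- y"] P_cong[of "- (x - y)" y] by simp_all
      then show ?thesis using yN 1 by (auto simp: N_def simp del: mult_minus_right)
    next
      case 2
      then have "P (x - y) = P x" "P (- (x - y)) = P (- x)"
        using P_cong[of "x - y" x] P_cong[of "- (x - y)" "- x"] by simp_all
      then show ?thesis using xN 2 by (auto simp: N_def simp del: mult_minus_right)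
    next
      case 3
      then show ?thesis by (simp add: N_def)
    next
      case 4
      have nd: "\<not> int p dvd y - x" using 4(3) by (metis dvd_diff_commute)
      let ?z = "P (y - x)" and ?z' = "P (x - y)"
      have kill: "\<phi> (P x) = 0" "\<phi> (P (- x)) = 0" "\<phi> (P y) = 0" "\<phi> (P (- y)) = 0"
        using xN yN 4 by (auto simp: N_def)
      obtain A B C where ABC: "A \<noteq> 0" "B \<noteq> 0" "C \<noteq> 0"
        and id: "\<And>X Y. A * minor (P x) (P y) X Y + B * minor ?z (P (- x)) X Y + C * minor (P (- y)) ?z' X Y = 0"
        using reduced_identity[OF rf perG D 4(1,2) nd] by blast
      have "\<phi> ?z = 0 \<and> \<phi> ?z' = 0"
      proof (cases "par (P x) (P y)")
        case False
        have con: "B * \<phi> ?z * P (- x) Y = C * \<phi> ?z' * P (- y) Y" for Y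
        proof -
          let ?I = "\<lambda>X. A * minor (P x) (P y) X Y + B * minor ?z (P (- x)) X Y + C * minor (P (- y)) ?z' X Y"
          have "0 = c1 * ?I X1 + c2 * ?I X2 + c3 * ?I X3" by (simp only: id) simp
          also have "\<dots> = A * (c1 * minor (P x) (P y) X1 Y + c2 * minor (P x) (P y) X2 Y + c3 * minor (P x) (P y) X3 Y)
             + B * (c1 * minor ?z (P (- x)) X1 Y + c2 * minor ?z (P (- x)) X2 Y + c3 * minor ?z (P (- x)) X3 Y)
             + C * (c1 * minor (P (- y)) ?z' X1 Y + c2 * minor (P (- y)) ?z' X2 Y + c3 * minor (P (- y)) ?z' X3 Y)"
            by (simp only: algebra_simps)
          also have "\<dots> = B * \<phi> ?z * P (- x) Y - C * \<phi> ?z' * P (- y) Y"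
            unfolding contract kill by simp
          finally show ?thesis by simp
        qed
        have z0: "\<phi> ?z = 0"
        proof (rule ccontr)
          assume "\<phi> ?z \<noteq> 0"
          then have "P (- x) Y = (C * \<phi> ?z' / (B * \<phi> ?z)) * P (- y) Y" for Y
            using con[of Y] ABC by (simp add: field_simps)
          then have "par (P (- x)) (P (- y))" unfolding par_def minor_def by simp
          then show False using False par_P_uminus by simp
        qed
        then show ?thesis using con[of "F 0"] ABC P_nonzero[of "F 0" "- y"] 4(2) by auto
      next
        \<comment> \<open>Now the identity only says that \<open>B * ?z - C * l * ?z'\<close> is a
          multiple \<open>m\<close> of \<open>P (- x)\<close>. As \<open>?z'\<close> is the
          conjugate of \<open>?z\<close>, conjugation gives a second equation. If
          \<open>\<phi> ?z \<noteq> 0\<close>, the two left sides are proportional; eliminating them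
          makes \<open>P x\<close> and \<open>P (- x)\<close> parallel, or, for
          \<open>m = 0\<close>, \<open>?z\<close> and \<open>?z'\<close>. Both would be a real
          direction.\<close>
        case True
        then have "par (P (- x)) (P (- y))" using par_P_uminus by simp
        moreover have "P (- x) (F 0) \<noteq> 0" "P (- y) (F 0) \<noteq> 0"
          using P_nonzero[of "F 0" "- x"] P_nonzero[of "F 0" "- y"] 4 by (simp_all del: mult_minus_right)
        ultimately obtain l where l: "l \<noteq> 0" "P (- y) = (\<lambda>Y. l * P (- x) Y)"
          using par_scalar[of "P (- x)" "P (- y)" "F 0"] by blast
        define m where "m = (B * ?z (F 0) - C * l * ?z' (F 0)) / P (- x) (F 0)"
        have x0: "P (- x) (F 0) \<noteq> 0" using P_nonzero[of "F 0" "- x"] 4 by auto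
        have Dm: "B * ?z Y - C * l * ?z' Y = m * P (- x) Y" for Y
        proof -
          have "B * minor ?z (P (- x)) (F 0) Y + C * minor (P (- y)) ?z' (F 0) Y = 0"
            using id[of "F 0" Y] True by (simp add: par_def)
          then show ?thesis using x0 unfolding m_def l(2) minor_def
            by (simp add: field_simps) algebra
        qed
        have Dm': "cnj B * ?z' Y - cnj C * cnj l * ?z Y = cnj m * P x Y" for Y
          using arg_cong[OF Dm[of Y], of cnj] P_uminus[of "y - x" Y] P_uminus[of "x - y" Y] P_uminus[of x Y]
          by simp
        have p1: "B * \<phi> ?z = C * l * \<phi> ?z'"
        proof -
          have "B * \<phi> ?z - C * l * \<phi> ?z' = \<phi> (\<lambda>Y. B * ?z Y - C * l * ?z' Y)"
            by (simp add: \<phi>_def algebra_simps)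
          also have "\<dots> = 0" unfolding Dm \<phi>_sc kill by simp
          finally show ?thesis by simp
        qed
        have p2: "cnj B * \<phi> ?z' = cnj C * cnj l * \<phi> ?z"
        proof -
          have "cnj B * \<phi> ?z' - cnj C * cnj l * \<phi> ?z = \<phi> (\<lambda>Y. cnj B * ?z' Y - cnj C * cnj l * ?z Y)"
            by (simp add: \<phi>_def algebra_simps)
          also have "\<dots> = 0" unfolding Dm' \<phi>_sc kill by simp
          finally show ?thesis by simp
        qed
        have "\<phi> ?z = 0"
        proof (rule ccontr)
          assume nz: "\<phi> ?z \<noteq> 0"
          then have nz': "\<phi> ?z' \<noteq> 0" using p1 ABC(2) by auto
          have "(B * cnj B) * (\<phi> ?z * \<phi> ?z') = (C * l * (cnj C * cnj l)) * (\<phi> ?z * \<phi> ?z')"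
            using arg_cong2[OF p1 p2, of "(*)"] by (simp add: mult_ac)
          then have BC: "B * cnj B = C * l * (cnj C * cnj l)" using nz nz' by simp
          have rel: "C * l * cnj m * P x Y = - cnj B * m * P (- x) Y" for Y
          proof -
            have "C * l * cnj m * P x Y = C * l * (cnj B * ?z' Y - cnj C * cnj l * ?z Y)"
              unfolding Dm' by simp
            also have "\<dots> = C * l * cnj B * ?z' Y - (C * l * (cnj C * cnj l)) * ?z Y"
              by (simp add: algebra_simps)
            also have "\<dots> = - cnj B * (B * ?z Y - C * l * ?z' Y)"
              unfolding BC[symmetric] by (simp add: algebra_simps)
            finally show ?thesis unfolding Dm by simp
          qed
          show False
          proof (cases "m = 0")
            case True
            then have "?z Y = (C * l / B) * ?z' Y" for Y
              using Dm[of Y] ABC by (simp add: field_simps)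
            then have "par ?z ?z'" unfolding par_def minor_def by simp
            then show False using real_iff[OF nd] nonreal by simp
          next
            case False
            then have "P x Y = (- cnj B * m / (C * l * cnj m)) * P (- x) Y" for Y
              using rel[of Y] ABC l by (simp add: field_simps)
            then have "par (P x) (P (- x))" unfolding par_def minor_def by simp
            then show False using real_iff[OF 4(1)] nonreal by simp
          qed
        qed
        then show ?thesis using p1 ABC l by simp
      qed
      then show ?thesis by (simp add: N_def del: mult_minus_right)
    qed
  qed
  have N0: "0 \<in> N" by (simp add: N_def)
  have Nneg: "- x \<in> N" if "x \<in> N" for x using Nsub[OF N0 that] by simp
  have Nnat: "int n \<in> N" for n
  proof (induction n)
    case (Suc n)
    then show ?case using Nsub[OF Suc Nneg[OF N1]] by (simp add: add.commute)
  qed (simp add: N0)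
  have Nall: "x \<in> N" for x
    using Nnat[of "nat x"] Nneg[OF Nnat[of "nat (- x)"]] by (cases "x \<ge> 0") auto
  have "c1 * P x X1 + c2 * P x X2 + c3 * P x X3 = 0" if "\<not> int p dvd x" for x
    using Nall[of x] that by (simp add: N_def \<phi>_def)
  note const = P_const_colors[OF this]
  obtain s t where "F s = X1" "F t = X4" "X3 \<in> range F" using X1 X34 by blast
  obtain u where "F u = X3" using \<open>X3 \<in> range F\<close> by blast
  \<comment> \<open>A point of the fourth color makes the constant combination 0, a point of color
    \<open>X3\<close> makes it \<open>c3\<close>.\<close>
  have "c3 = 0" using const[of u t] \<open>F u = X3\<close> \<open>F t = X4\<close> X34 ne12 by auto
  then show False using X12 by (simp add: c3_def)
qed

text \<open>Without a splitting set, the directions \<open>P 1\<close> and \<open>P (- 1)\<close> are the only ones.\<close>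

lemma nosplit_directions:
  assumes ns: "\<not> splits p a1 a2 a3" and x: "\<not> int p dvd x"
  shows "par (P x) (P 1) \<or> par (P x) (P (- 1))"
proof -
  define S where "S = {x. \<not> int p dvd x \<and> (par (P x) (P 1) \<or> par (P x) (P (- 1)))}"
  have step: "y \<in> S" if "x \<in> S" and d: "int p dvd au * x + av * y"
    and au: "\<not> int p dvd au" "par (P (- x)) (cft p F (au * - x))"
    and av: "\<not> int p dvd av" "par (P y) (cft p F (av * y))" for x y au av
  proof -
    have x: "\<not> int p dvd x" "par (P x) (P 1) \<or> par (P x) (P (- 1))" using \<open>x \<in> S\<close> by (auto simp: S_def)
    have y: "\<not> int p dvd y" using d x(1) au(1) by (metis dvd_add_left_iff dvd_mult ndvd_mult)
    have "cft p F (av * y) = cft p F (au * - x)"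
      by (rule cft_cong[OF p_pos]) (use d in \<open>simp add: add.commute\<close>)
    then have "par (P y) (P (- x))"
      using par_trans[OF av(2), of "P (- x)" "F 0"] au(2) par_commute
        cft_range_nonzero[of "F 0" "av * y"] ndvd_mult[OF av(1) y] by (metis rangeI)
    moreover have "par (P (- x)) (P (- 1)) \<or> par (P (- x)) (P 1)"
      using x(2) par_P_uminus[of x 1] par_P_uminus[of x "- 1"] by auto
    ultimately have "par (P y) (P (- 1)) \<or> par (P y) (P 1)"
      using x(1) par_P_trans[of y "- x" "- 1"] par_P_trans[of y "- x" 1] by fastforce
    then show ?thesis using y by (auto simp: S_def)
  qed
  have "ratio_closed p a1 a2 a3 S"
    unfolding ratio_closed_def
    using step[of _ a1 a2] step[of _ a1 a3] step[of _ a2 a1] step[of _ a2 a3] step[of _ a3 a1] step[of _ a3 a2]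
      a dir2 dir3 par_refl by blast
  moreover have "1 \<in> S" using ndvd_1 by (simp add: S_def)
  ultimately have "x \<in> S" using ns x ndvd_1 unfolding splits_def by blast
  then show ?thesis by (simp add: S_def)
qed

lemma nosplit_real:
  assumes ns: "\<not> splits p a1 a2 a3" and real: "par (P 1) (P (- 1))"
  shows "card (range F) \<le> 2"
proof (rule all_par_two_colors)
  fix x assume "\<not> int p dvd x"
  then show "par (P 1) (P x)"
    using nosplit_directions[OF ns] par_P_trans[OF real, of x] ndvd_1 par_commute by (metis dvd_minus_iff)
qed

text \<open>Every unit lies in \<open>T\<close> or in \<open>- T\<close>, and the reduced identity
  forbids \<open>x\<close>, \<open>y\<close> and \<open>y - x\<close> to lie in \<open>T\<close>
  together. The multiples 1, 2, 3 already violate this, provided that 3 is a unit.\<close>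

lemma nosplit_nonreal:
  assumes ns: "\<not> splits p a1 a2 a3" and nonreal: "\<not> par (P 1) (P (- 1))" and p3: "p \<noteq> 3"
    and rf: "rf3 p a1 a2 a3 b F F G" and perG: "periodic (int p) G"
    and D: "\<And>X. cft p G 0 X = cft p F 0 X"
  shows False
proof -
  define T where "T = {x. \<not> int p dvd x \<and> par (P x) (P 1)}"
  have T: "x \<in> T \<or> - x \<in> T" if "\<not> int p dvd x" for x
    using nosplit_directions[OF ns that] that par_P_uminus[of x "- 1"] by (auto simp: T_def)
  have par_T: "par (P x) (P y)" if "x \<in> T" "y \<in> T" for x y
    using that par_P_trans[of x 1 y] ndvd_1 par_commute by (auto simp: T_def)
  have bad: False if "x \<in> T" "y \<in> T" "y - x \<in> T" for x y
  proof -
    have "\<not> int p dvd x" "\<not> int p dvd y" "\<not> int p dvd y - x" using that by (auto simp: T_def)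
    then obtain A B C where "B \<noteq> 0" and id: "\<And>X Y. A * minor (P x) (P y) X Y + B * minor (P (y - x)) (P (- x)) X Y
        + C * minor (P (- y)) (P (x - y)) X Y = 0"
      using reduced_identity[OF rf perG D] by blast
    moreover have "minor (P x) (P y) X Y = 0" for X Y using par_T that by (auto simp: par_def)
    moreover have "minor (P (- y)) (P (x - y)) X Y = 0" for X Y
      using par_T[OF that(2,3)] par_P_uminus[of y "y - x"] by (simp add: par_def)
    ultimately have "par (P (y - x)) (P (- x))" by (simp add: par_def)
    then have "par (P x) (P (- x))"
      using par_P_trans[of x "y - x" "- x"] par_T[OF that(1,3)] that(3) by (simp add: T_def)
    then show False using real_iff[of x] nonreal that(1) by (simp add: T_def)
  qed
  have p5: "p > 3" using prime odd p3 by (metis One_nat_def Suc_1 Suc_lessI even_numeral le_neq_implies_less numeral_3_eq_3 prime_ge_2_nat)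
  have "1 \<in> T" using ndvd_1 by (simp add: T_def)
  have n2: "\<not> int p dvd 2" and n3: "\<not> int p dvd 3"
    using p5 by (auto dest!: zdvd_imp_le)
  from T[OF n2] show False
  proof
    assume "2 \<in> T"
    then show False using bad[OF \<open>1 \<in> T\<close>, of 2] \<open>1 \<in> T\<close> by simp
  next
    assume m2: "- 2 \<in> T"
    from T[OF n3] show False
    proof
      assume "3 \<in> T"
      then show False using bad[OF m2 \<open>1 \<in> T\<close>] by simp
    next
      assume "- 3 \<in> T"
      then show False using bad[OF \<open>1 \<in> T\<close> m2] by simp
    qed
  qed
qed

end

section \<open>The real case: ordinary lines and Gaussian periods\<close>

definition area :: "real \<times> real \<Rightarrow> real \<times> real \<Rightarrow> real \<times> real \<Rightarrow> real"
  where "area A B C = (fst B - fst A) * (snd C - snd A) - (snd B - snd A) * (fst C - fst A)"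

definition sqdist :: "real \<times> real \<Rightarrow> real \<times> real \<Rightarrow> real"
  where "sqdist A B = (fst B - fst A)\<^sup>2 + (snd B - snd A)\<^sup>2"

lemma sqdist_pos: "A \<noteq> B \<Longrightarrow> sqdist A B > 0"
  unfolding sqdist_def by (cases A, cases B) (auto simp: sum_power2_gt_zero_iff)

text \<open>Kelly's argument: of three points on a line, two lie on the same side of the foot of the
  perpendicular from \<open>C\<close>, and the nearer one is closer to the line through \<open>C\<close> and the farther one.\<close>

lemma sylvester_gallai:
  fixes S :: "(real \<times> real) set"
  assumes fin: "finite S" and abc: "\<exists>A\<in>S. \<exists>B\<in>S. \<exists>C\<in>S. area A B C \<noteq> 0"
  shows "\<exists>A\<in>S. \<exists>B\<in>S. A \<noteq> B \<and> (\<forall>D\<in>S. area A B D = 0 \<longrightarrow> D = A \<or> D = B)"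
proof -
  define Q where "Q = {(A, B, C). A \<in> S \<and> B \<in> S \<and> C \<in> S \<and> area A B C \<noteq> 0}"
  define h where "h = (\<lambda>(A, B, C). (area A B C)\<^sup>2 / sqdist A B)"
  have "Q \<subseteq> S \<times> S \<times> S" by (auto simp: Q_def)
  then have finQ: "finite Q" using fin by (meson finite_SigmaI finite_subset)
  have "Q \<noteq> {}" using abc unfolding Q_def by fast
  then obtain T where T: "T \<in> Q" "\<And>T'. T' \<in> Q \<Longrightarrow> h T \<le> h T'"
    using finQ arg_min_if_finite[of Q h] by (metis not_le)
  obtain A B C where ABC: "T = (A, B, C)" by (cases T) auto
  have inS: "A \<in> S" "B \<in> S" "C \<in> S" and ar0: "area A B C \<noteq> 0" using T(1) by (auto simp: ABC Q_def)
  have AB: "A \<noteq> B" using ar0 by (auto simp: area_def)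
  define u v w z where "u = fst B - fst A" and "v = snd B - snd A" and "w = fst C - fst A" and "z = snd C - snd A"
  define L where "L = sqdist A B"
  have L: "L > 0" "L = u\<^sup>2 + v\<^sup>2" using sqdist_pos[OF AB] by (auto simp: L_def sqdist_def u_def v_def)
  have ar: "area A B C = u * z - v * w" by (simp add: area_def u_def v_def w_def z_def)
  \<comment> \<open>\<open>X t\<close> runs through the line of \<open>A = X 0\<close> and
    \<open>B = X 1\<close>, and \<open>\<tau>\<close> is the parameter of the foot of the
    perpendicular from \<open>C\<close>.\<close>
  define X where "X t = (fst A + t * u, snd A + t * v)" for t
  define \<tau> where "\<tau> = (u * w + v * z) / L"
  have key: False if pq: "p \<noteq> q" "(p - \<tau>) * (q - \<tau>) \<ge> 0" "\<bar>p - \<tau>\<bar> \<le> \<bar>q - \<tau>\<bar>" and XS: "X p \<in> S" "X q \<in> S" for p q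
  proof -
    have ar': "area C (X q) (X p) = (p - q) * area A B C"
      unfolding ar by (simp add: area_def X_def w_def z_def algebra_simps)
    then have Q': "(C, X q, X p) \<in> Q" using XS inS ar0 pq by (simp add: Q_def)
    have CX: "C \<noteq> X q" using ar' ar0 pq by (auto simp: area_def)
    have sd: "sqdist C (X q) = (q * u - w)\<^sup>2 + (q * v - z)\<^sup>2"
      by (simp add: sqdist_def X_def w_def z_def algebra_simps)
    \<comment> \<open>Lagrange's identity: dot product squared plus cross product squared.\<close>
    have "L * sqdist C (X q) = (q * L - (u * w + v * z))\<^sup>2 + (area A B C)\<^sup>2"
      unfolding sd ar L(2) by (simp add: power2_eq_square algebra_simps)
    also have "q * L - (u * w + v * z) = L * (q - \<tau>)" using L(1) by (simp add: \<tau>_def field_simps)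
    finally have lag: "L * sqdist C (X q) = L\<^sup>2 * (q - \<tau>)\<^sup>2 + (area A B C)\<^sup>2"
      by (simp add: power_mult_distrib)
    have "(p - q)\<^sup>2 \<le> (q - \<tau>)\<^sup>2"
    proof -
      have "\<bar>p - q\<bar> \<le> \<bar>q - \<tau>\<bar>"
        using pq(2,3) by (auto simp: abs_if zero_le_mult_iff split: if_splits)
      then show ?thesis by (simp add: abs_le_square_iff)
    qed
    then have "L\<^sup>2 * (p - q)\<^sup>2 < L * sqdist C (X q)"
    proof -
      have "L\<^sup>2 * (p - q)\<^sup>2 \<le> L\<^sup>2 * (q - \<tau>)\<^sup>2"
        using \<open>(p - q)\<^sup>2 \<le> (q - \<tau>)\<^sup>2\<close> by (rule mult_left_mono) simp
      moreover have "(area A B C)\<^sup>2 > 0" using ar0 by simp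
      ultimately show ?thesis unfolding lag by linarith
    qed
    then have lt: "L * (p - q)\<^sup>2 < sqdist C (X q)" using L(1) by (simp add: power2_eq_square)
    have "h T \<le> h (C, X q, X p)" by (rule T(2)[OF Q'])
    then have "(area A B C)\<^sup>2 / L \<le> ((p - q)\<^sup>2 * (area A B C)\<^sup>2) / sqdist C (X q)"
      by (simp add: ABC h_def ar' L_def power_mult_distrib)
    then have "(area A B C)\<^sup>2 * sqdist C (X q) \<le> (area A B C)\<^sup>2 * (L * (p - q)\<^sup>2)"
      using L(1) sqdist_pos[OF CX] by (simp add: field_simps)
    then show False using lt ar0 by (simp add: mult_le_cancel_left)
  qed
  have key': False if pq: "p \<noteq> q" "(p - \<tau>) * (q - \<tau>) \<ge> 0" and XS: "X p \<in> S" "X q \<in> S" for p q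
    using key[of p q] key[of q p] that by (cases "\<bar>p - \<tau>\<bar> \<le> \<bar>q - \<tau>\<bar>") (auto simp: mult.commute)
  have X01: "X 0 = A" "X 1 = B" by (simp_all add: X_def u_def v_def)
  have "D = A \<or> D = B" if D: "D \<in> S" "area A B D = 0" for D
  proof (rule ccontr)
    assume ne: "\<not> ?thesis"
    define t where "t = (u * (fst D - fst A) + v * (snd D - snd A)) / L"
    have D0: "u * (snd D - snd A) = v * (fst D - fst A)" using D(2) by (simp add: area_def u_def v_def)
    define dx dy where "dx = fst D - fst A" and "dy = snd D - snd A"
    have uv: "u * dy = v * dx" using D0 by (simp add: dx_def dy_def)
    have Lt: "L * t = u * dx + v * dy" using L(1) by (simp add: t_def dx_def dy_def)
    have "L * (t * u) = u * (u * dx) + v * (u * dy)"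
      unfolding mult.assoc[symmetric] Lt by (simp add: algebra_simps)
    then have "L * (t * u) = L * dx" unfolding uv L(2) by (simp add: power2_eq_square algebra_simps)
    moreover have "L * (t * v) = u * (v * dx) + v * (v * dy)"
      unfolding mult.assoc[symmetric] Lt by (simp add: algebra_simps)
    then have "L * (t * v) = L * dy" unfolding uv[symmetric] L(2) by (simp add: power2_eq_square algebra_simps)
    ultimately have "t * u = dx" "t * v = dy" using L(1) by simp_all
    then have "X t = D" by (simp add: X_def prod_eq_iff dx_def dy_def)
    then have "t \<noteq> 0" "t \<noteq> 1" "X t \<in> S" using ne X01 D by auto
    moreover have "(0 - \<tau>) * (1 - \<tau>) \<ge> 0 \<or> (0 - \<tau>) * (t - \<tau>) \<ge> 0 \<or> (1 - \<tau>) * (t - \<tau>) \<ge> 0"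
      by (smt (verit) zero_le_mult_iff)
    ultimately show False using key'[of 0 1] key'[of 0 t] key'[of 1 t] X01 inS by auto
  qed
  then show ?thesis using inS AB by blast
qed

context odd_prime
begin

text \<open>With \<open>E\<close>, \<open>E'\<close> the period sums over the two classes and \<open>f\<close> their size, the closure
  hypothesis reads \<open>E E' = c\<^sub>1 E + c\<^sub>2 E'\<close> with \<open>c\<^sub>1 + c\<^sub>2 = f\<close>. It forces \<open>E E' \<le> 0\<close> at every
  nontrivial frequency, and comparing first and second moments gives \<open>p \<le> 2 f + 2\<close>.\<close>

lemma no_third_class:
  fixes pt :: "int \<Rightarrow> 'd"
  assumes per: "periodic (int p) pt"
    and even: "\<And>x. pt (- x) = pt x"
    and dil: "\<And>x y k. \<not> int p dvd x \<Longrightarrow> \<not> int p dvd y \<Longrightarrow> \<not> int p dvd k \<Longrightarrow> pt x = pt y \<Longrightarrow> pt (k * x) = pt (k * y)"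
    and x0: "\<not> int p dvd x0" and y0: "\<not> int p dvd y0" and ne: "pt x0 \<noteq> pt y0"
    and clos: "\<And>x y. \<not> int p dvd x \<Longrightarrow> \<not> int p dvd y \<Longrightarrow> pt x = pt x0 \<Longrightarrow> pt y = pt y0 \<Longrightarrow> pt (x + y) = pt x0 \<or> pt (x + y) = pt y0"
    and w: "\<not> int p dvd w"
  shows "pt w = pt x0 \<or> pt w = pt y0"
proof (rule ccontr)
  assume w': "\<not> ?thesis"
  let ?Z = "{0..<int p}"
  define Cl where "Cl c = {x \<in> ?Z. \<not> int p dvd x \<and> pt x = pt c}" for c
  have finCl: "finite (Cl c)" for c by (rule finite_subset[of _ ?Z]) (auto simp: Cl_def)
  have ndm: "\<not> int p dvd x * y" if "\<not> int p dvd x" "\<not> int p dvd y" for x y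
    using that prime by (simp add: prime_int_dvd_mult_iff)
  have pcong: "pt x = pt y" if "int p dvd x - y" for x y using periodic_cong[OF per that] .
  have modZ: "x mod int p \<in> ?Z" for x using p_pos by simp
  have inCl: "x mod int p \<in> Cl c \<longleftrightarrow> \<not> int p dvd x \<and> pt x = pt c" for x c
    using modZ[of x] periodicD[OF per, of x] by (simp add: Cl_def dvd_mod_iff)
  have scale: "(k * x) mod int p \<in> Cl (k * c)" if "x \<in> Cl c" "\<not> int p dvd k" "\<not> int p dvd c" for k x c
  proof -
    have "\<not> int p dvd x" "pt x = pt c" using that(1) by (auto simp: Cl_def)
    then show ?thesis using that(2,3) dil[of x c k] by (simp add: inCl ndm)
  qed
  have inj_scale: "inj_on (\<lambda>x. (k * x) mod int p) ?Z" if "\<not> int p dvd k" for k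
  proof -
    have "coprime k (int p)"
      using that prime by (metis coprime_commute prime_imp_coprime prime_nat_int_transfer)
    then show ?thesis using bij_betw_affine_mod[of "int p" k 0] p_pos by (simp add: bij_betw_def)
  qed
  have Cl_cong: "Cl c = Cl d" if "pt c = pt d" for c d using that by (simp add: Cl_def)
  have card_le: "card (Cl c) \<le> card (Cl d)" if c: "\<not> int p dvd c" and d: "\<not> int p dvd d" for c d
  proof -
    obtain k where k: "int p dvd c * k - d" using solve_cong_prime[OF prime c] by blast
    have nk: "\<not> int p dvd k" using k d by (metis dvd_diff_right_iff dvd_mult)
    have "Cl (k * c) = Cl d" using pcong[OF k] by (intro Cl_cong) (simp add: mult.commute)
    then have "(\<lambda>x. (k * x) mod int p) ` Cl c \<subseteq> Cl d" using scale nk c by blast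
    moreover have "inj_on (\<lambda>x. (k * x) mod int p) (Cl c)"
      using inj_scale[OF nk] by (rule inj_on_subset) (auto simp: Cl_def)
    ultimately show ?thesis using finCl by (metis card_inj_on_le)
  qed
  define f where "f = card (Cl x0)"
  have card_f: "card (Cl c) = f" if "\<not> int p dvd c" for c
    unfolding f_def using card_le x0 that by (simp add: order_antisym)
  have f2: "f \<ge> 2"
  proof -
    have "x0 mod int p \<in> Cl x0" "(- x0) mod int p \<in> Cl x0" using x0 even by (simp_all add: inCl)
    moreover have "x0 mod int p \<noteq> (- x0) mod int p"
    proof
      assume "x0 mod int p = (- x0) mod int p"
      then have "int p dvd 2 * x0" by (simp add: mod_eq_dvd_iff)
      then have "int p dvd 2" using x0 prime by (simp add: prime_int_dvd_mult_iff)
      then have "p dvd 2" by presburger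
      then show False using prime odd by (metis dvd_refl two_is_prime_nat primes_dvd_imp_eq)
    qed
    ultimately have "card {x0 mod int p, (- x0) mod int p} \<le> f"
      unfolding f_def by (intro card_mono finCl) auto
    then show ?thesis using \<open>x0 mod int p \<noteq> _\<close> by simp
  qed
  have p3f: "int p - 1 \<ge> 3 * int f"
  proof -
    have dis: "Cl x0 \<inter> Cl y0 = {}" "(Cl x0 \<union> Cl y0) \<inter> Cl w = {}"
      using ne w' by (auto simp: Cl_def)
    then have "card (Cl x0 \<union> Cl y0 \<union> Cl w) = 3 * f"
      using finCl card_f x0 y0 w by (simp add: card_Un_disjoint)
    moreover have "Cl x0 \<union> Cl y0 \<union> Cl w \<subseteq> ?Z - {0}" by (auto simp: Cl_def)
    then have "card (Cl x0 \<union> Cl y0 \<union> Cl w) \<le> card (?Z - {0})" by (intro card_mono) auto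
    ultimately have "3 * f \<le> card (?Z - {0})" by simp
    also have "card (?Z - {0}) = p - 1" using p_pos by (simp add: card_Diff_singleton_if)
    finally show ?thesis using p_pos by linarith
  qed
  \<comment> \<open>Sums of roots of unity over a class that dilations permute: the Gaussian
    periods. They are real because the classes are symmetric.\<close>
  define e where "e c \<xi> = (\<Sum>x\<in>Cl c. ew p (\<xi> * x))" for c \<xi>
  have e_ft: "e c = ft p (\<lambda>t. of_bool (t mod int p \<in> Cl c))" for c
  proof
    fix \<xi>
    have "ft p (\<lambda>t. of_bool (t mod int p \<in> Cl c)) \<xi> = (\<Sum>t\<in>?Z. if t \<in> Cl c then ew p (\<xi> * t) else 0)"
      unfolding ft_def by (rule sum.cong) auto
    also have "\<dots> = (\<Sum>t\<in>?Z \<inter> Cl c. ew p (\<xi> * t))" by (simp add: sum.inter_restrict)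
    also have "?Z \<inter> Cl c = Cl c" by (auto simp: Cl_def)
    finally show "e c \<xi> = ft p (\<lambda>t. of_bool (t mod int p \<in> Cl c)) \<xi>" by (simp add: e_def)
  qed
  have perI: "periodic (int p) (\<lambda>t. of_bool (t mod int p \<in> Cl c) :: complex)" for c
    by (simp add: periodic_def)
  have e_minus: "e c (- \<xi>) = e c \<xi>" for c \<xi>
  proof -
    have bij: "bij_betw (\<lambda>x. (- x) mod int p) (Cl c) (Cl c)"
    proof -
      have i: "inj_on (\<lambda>x. (- x) mod int p) (Cl c)"
      proof (rule inj_on_subset)
        have "\<not> int p dvd - 1" using prime by (metis dvd_minus_iff not_prime_unit prime_nat_int_transfer)
        from inj_scale[OF this] show "inj_on (\<lambda>x. (- x) mod int p) ?Z" by simp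
      qed (auto simp: Cl_def)
      have "(\<lambda>x. (- x) mod int p) ` Cl c \<subseteq> Cl c" using even by (auto simp: inCl) (auto simp: Cl_def)
      then show ?thesis using i finCl by (simp add: bij_betw_def endo_inj_surj)
    qed
    have "e c \<xi> = (\<Sum>x\<in>Cl c. ew p (\<xi> * ((- x) mod int p)))"
      unfolding e_def by (rule sum.reindex_bij_betw[OF bij, symmetric])
    also have "\<dots> = e c (- \<xi>)"
      unfolding e_def using periodicD[OF periodic_ew[OF p_pos, of \<xi>]] by simp
    finally show ?thesis by simp
  qed
  define E where "E c \<xi> = Re (e c \<xi>)" for c \<xi>
  have eE: "e c \<xi> = of_real (E c \<xi>)" for c \<xi>
  proof -
    have "cnj (e c \<xi>) = e c (- \<xi>)" by (simp add: e_def ew_minus)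
    then have "cnj (e c \<xi>) = e c \<xi>" by (simp add: e_minus)
    then show ?thesis by (simp add: complex_eq_iff E_def)
  qed
  have e_nz: "E c \<xi> \<noteq> 0" if c: "\<not> int p dvd c" and xi: "\<not> int p dvd \<xi>" for c \<xi>
  proof -
    have "cft p (\<lambda>t. t mod int p \<in> Cl c) \<xi> True \<noteq> 0"
    proof (rule cft_nonzero[OF _ xi])
      show "periodic (int p) (\<lambda>t. t mod int p \<in> Cl c)" by (simp add: periodic_def)
      show "(c mod int p \<in> Cl c) = True" using c by (simp add: inCl)
      show "(0 mod int p \<in> Cl c) \<noteq> True" by (simp add: Cl_def)
    qed
    then have "e c \<xi> \<noteq> 0" by (simp add: e_ft cft_def)
    then show ?thesis by (simp add: eE)
  qed
  have E_lt: "E c \<xi> < f" if c: "\<not> int p dvd c" and xi: "\<not> int p dvd \<xi>" for c \<xi>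
  proof -
    have "E c \<xi> = (\<Sum>x\<in>Cl c. Re (ew p (\<xi> * x)))" by (simp add: E_def e_def)
    also have "\<dots> < (\<Sum>x\<in>Cl c. 1)"
    proof (rule sum_strict_mono[OF finCl])
      show "Cl c \<noteq> {}" using c inCl by blast
      fix x assume "x \<in> Cl c"
      then have "\<not> int p dvd \<xi> * x" using xi by (simp add: Cl_def ndm)
      then have "ew p (\<xi> * x) \<noteq> 1" by (simp add: ew_eq_1_iff[OF p_pos])
      moreover have "Re (ew p (\<xi> * x)) \<le> 1" using complex_Re_le_cmod[of "ew p (\<xi> * x)"] by simp
      moreover have "ew p (\<xi> * x) = 1" if "Re (ew p (\<xi> * x)) = 1"
        using that norm_ew[of p "\<xi> * x"] by (simp add: complex_eq_iff cmod_def)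
      ultimately show "Re (ew p (\<xi> * x)) < 1" by fastforce
    qed
    finally show ?thesis using card_f[OF c] by simp
  qed
  \<comment> \<open>The number of representations of \<open>t\<close> as a sum from the two classes.
    Dilation by a unit \<open>k\<close> with \<open>pt k = pt 1\<close> preserves both classes, so
    \<open>N\<close> is constant on each class; the closure hypothesis makes it vanish
    elsewhere.\<close>
  define N where "N t = card {(x, y). x \<in> Cl x0 \<and> y \<in> Cl y0 \<and> (x + y) mod int p = t mod int p}" for t
  have finN: "finite {(x, y). x \<in> Cl x0 \<and> y \<in> Cl y0 \<and> Q x y}" for Q
    by (rule finite_subset[of _ "Cl x0 \<times> Cl y0"]) (auto simp: finCl)
  have N_le: "N t \<le> N (k * t)" if k: "\<not> int p dvd k" "pt k = pt 1" for k t
  proof -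
    let ?g = "\<lambda>(x, y). ((k * x) mod int p, (k * y) mod int p)"
    have Clk: "Cl (k * c) = Cl c" if "\<not> int p dvd c" for c
      using dil[of k 1 c] k that prime_gt_1_nat[OF prime] by (intro Cl_cong) (simp add: mult.commute)
    show ?thesis unfolding N_def
    proof (rule card_inj_on_le[OF _ _ finN])
      show "inj_on ?g {(x, y). x \<in> Cl x0 \<and> y \<in> Cl y0 \<and> (x + y) mod int p = t mod int p}"
      proof (rule inj_onI, clarify)
        fix x y x' y'
        assume "x \<in> Cl x0" "y \<in> Cl y0" "x' \<in> Cl x0" "y' \<in> Cl y0"
          and eq: "(k * x) mod int p = (k * x') mod int p" "(k * y) mod int p = (k * y') mod int p"
        then have "x \<in> ?Z" "y \<in> ?Z" "x' \<in> ?Z" "y' \<in> ?Z" by (auto simp: Cl_def)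
        then show "x = x' \<and> y = y'"
          using inj_onD[OF inj_scale[OF k(1)] eq(1)] inj_onD[OF inj_scale[OF k(1)] eq(2)] by blast
      qed
      show "?g ` {(x, y). x \<in> Cl x0 \<and> y \<in> Cl y0 \<and> (x + y) mod int p = t mod int p}
          \<subseteq> {(x, y). x \<in> Cl x0 \<and> y \<in> Cl y0 \<and> (x + y) mod int p = (k * t) mod int p}"
      proof clarsimp
        fix x y assume xy: "x \<in> Cl x0" "y \<in> Cl y0" "(x + y) mod int p = t mod int p"
        have "(k * x) mod int p \<in> Cl x0" using scale[OF xy(1) k(1) x0] Clk[OF x0] by simp
        moreover have "(k * y) mod int p \<in> Cl y0" using scale[OF xy(2) k(1) y0] Clk[OF y0] by simp
        moreover have "((k * x) mod int p + (k * y) mod int p) mod int p = (k * t) mod int p"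
        proof -
          have "((k * x) mod int p + (k * y) mod int p) mod int p = (k * (x + y)) mod int p"
            by (simp add: mod_add_eq distrib_left)
          also have "\<dots> = (k * t) mod int p" using xy(3) by (metis mod_mult_right_eq)
          finally show ?thesis .
        qed
        ultimately show "(k * x) mod int p \<in> Cl x0 \<and> (k * y) mod int p \<in> Cl y0 \<and>
            ((k * x) mod int p + (k * y) mod int p) mod int p = k * t mod int p" by simp
      qed
    qed
  qed
  have N_cong: "N s = N t" if "int p dvd s - t" for s t
    using that by (simp add: N_def mod_eq_dvd_iff[THEN iffD2, OF that])
  have N_le': "N s \<le> N t" if s: "\<not> int p dvd s" and t: "\<not> int p dvd t" and st: "pt s = pt t" for s t
  proof -
    obtain k where k: "int p dvd s * k - t" using solve_cong_prime[OF prime s] by blast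
    have nk: "\<not> int p dvd k" using k t by (metis dvd_diff_right_iff dvd_mult)
    obtain l where l: "int p dvd s * l - 1" using solve_cong_prime[OF prime s] by blast
    have nl: "\<not> int p dvd l" using l prime by (metis dvd_diff_right_iff dvd_mult not_prime_unit prime_nat_int_transfer)
    have "pt (l * t) = pt (l * s)" using dil[OF t s nl] st by simp
    moreover have "pt (l * s) = pt 1" using pcong[OF l] by (simp add: mult.commute)
    moreover have "pt k = pt (l * t)"
    proof (rule pcong)
      have "k - l * t = l * (s * k - t) - k * (s * l - 1)" by (simp add: algebra_simps)
      then show "int p dvd k - l * t" using k l by (metis dvd_diff dvd_mult)
    qed
    ultimately have "N s \<le> N (k * s)" using N_le[OF nk] by simp
    also have "N (k * s) = N t" using k by (intro N_cong) (simp add: mult.commute)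
    finally show ?thesis .
  qed
  define c1 where "c1 = real (N x0)"
  define c2 where "c2 = real (N y0)"
  have N_val: "of_nat (N t) = (of_real c1 * of_bool (t mod int p \<in> Cl x0) + of_real c2 * of_bool (t mod int p \<in> Cl y0) :: complex)" for t
  proof -
    consider "\<not> int p dvd t" "pt t = pt x0" | "\<not> int p dvd t" "pt t = pt y0"
      | "int p dvd t \<or> pt t \<noteq> pt x0 \<and> pt t \<noteq> pt y0" by blast
    then show ?thesis
    proof cases
      case 1
      then have "N t = N x0" using N_le'[of t x0] N_le'[of x0 t] x0 by simp
      then show ?thesis using 1 ne by (simp add: inCl c1_def)
    next
      case 2
      then have "N t = N y0" using N_le'[of t y0] N_le'[of y0 t] y0 by simp
      then show ?thesis using 2 ne by (simp add: inCl c2_def)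
    next
      case 3
      have "{(x, y). x \<in> Cl x0 \<and> y \<in> Cl y0 \<and> (x + y) mod int p = t mod int p} = {}"
      proof (rule ccontr)
        assume "\<not> ?thesis"
        then obtain x y where xy: "x \<in> Cl x0" "y \<in> Cl y0" "(x + y) mod int p = t mod int p" by blast
        then have d: "int p dvd (x + y) - t" by (simp add: mod_eq_dvd_iff)
        have "pt t = pt x0 \<or> pt t = pt y0"
          using clos[of x y] xy pcong[OF d] by (simp add: Cl_def)
        with 3 have "int p dvd t" by blast
        with d have "int p dvd x - (- y)" by (metis add.commute diff_minus_eq_add dvd_diff_right_iff dvd_add_left_iff add_diff_cancel_left' diff_add_cancel)
        then have "pt x = pt y" using pcong even by metis
        then show False using xy ne by (simp add: Cl_def)
      qed
      then have "N t = 0" unfolding N_def by (metis card.empty)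
      then show ?thesis using 3 by (auto simp: inCl)
    qed
  qed
  have prod_e: "e x0 \<xi> * e y0 \<xi> = of_real c1 * e x0 \<xi> + of_real c2 * e y0 \<xi>" for \<xi>
  proof -
    have "e x0 \<xi> * e y0 \<xi> = (\<Sum>(x, y)\<in>Cl x0 \<times> Cl y0. ew p (\<xi> * ((x + y) mod int p)))"
      unfolding e_def sum_product sum.cartesian_product
      by (rule sum.cong) (auto simp: periodicD[OF periodic_ew[OF p_pos]] distrib_left ew_add)
    also have "\<dots> = (\<Sum>t\<in>?Z. \<Sum>z | z \<in> Cl x0 \<times> Cl y0 \<and> (\<lambda>(x, y). (x + y) mod int p) z = t.
        (\<lambda>(x, y). ew p (\<xi> * ((x + y) mod int p))) z)"
      by (rule sum.group[symmetric]) (auto simp: finCl p_pos)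
    also have "\<dots> = (\<Sum>t\<in>?Z. of_nat (N t) * ew p (\<xi> * t))"
    proof (rule sum.cong[OF refl])
      fix t assume t: "t \<in> ?Z"
      have seteq: "{z. z \<in> Cl x0 \<times> Cl y0 \<and> (\<lambda>(x, y). (x + y) mod int p) z = t}
          = {(x, y). x \<in> Cl x0 \<and> y \<in> Cl y0 \<and> (x + y) mod int p = t mod int p}"
        using t by auto
      have "(\<Sum>z | z \<in> Cl x0 \<times> Cl y0 \<and> (\<lambda>(x, y). (x + y) mod int p) z = t. (\<lambda>(x, y). ew p (\<xi> * ((x + y) mod int p))) z)
          = (\<Sum>z | z \<in> Cl x0 \<times> Cl y0 \<and> (\<lambda>(x, y). (x + y) mod int p) z = t. ew p (\<xi> * t))"
        by (rule sum.cong) auto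
      also have "\<dots> = of_nat (card {z. z \<in> Cl x0 \<times> Cl y0 \<and> (\<lambda>(x, y). (x + y) mod int p) z = t}) * ew p (\<xi> * t)"
        by simp
      finally show "(\<Sum>z | z \<in> Cl x0 \<times> Cl y0 \<and> (\<lambda>(x, y). (x + y) mod int p) z = t. (\<lambda>(x, y). ew p (\<xi> * ((x + y) mod int p))) z)
          = of_nat (N t) * ew p (\<xi> * t)" unfolding N_def seteq[symmetric] .
    qed
    also have "\<dots> = of_real c1 * e x0 \<xi> + of_real c2 * e y0 \<xi>"
      unfolding N_val e_ft ft_def by (simp add: distrib_right sum.distrib sum_distrib_left mult.assoc
          del: sum_of_bool_mult_eq sum_mult_of_bool_eq)
    finally show ?thesis .
  qed
  have prodE: "E x0 \<xi> * E y0 \<xi> = c1 * E x0 \<xi> + c2 * E y0 \<xi>" for \<xi>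
    using prod_e[of \<xi>] unfolding eE by (simp flip: of_real_mult of_real_add)
  have E0: "E c 0 = f" if "\<not> int p dvd c" for c using card_f[OF that] by (simp add: E_def e_def)
  have c12: "c1 + c2 = f"
    using prodE[of 0] f2 E0 x0 y0 by (simp flip: distrib_right)
  have c_nn: "c1 \<ge> 0" "c2 \<ge> 0" by (simp_all add: c1_def c2_def)
  have nd1: "\<not> int p dvd 1" using prime by (metis not_prime_unit prime_nat_int_transfer)
  have "c1 \<noteq> 0"
  proof
    assume "c1 = 0"
    then have "E x0 1 * E y0 1 = f * E y0 1" using prodE[of 1] c12 by simp
    then show False using e_nz[OF y0 nd1] E_lt[OF x0 nd1] by simp
  qed
  moreover have "c2 \<noteq> 0"
  proof
    assume "c2 = 0"
    then have "E x0 1 * E y0 1 = f * E x0 1" using prodE[of 1] c12 by simp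
    then show False using e_nz[OF x0 nd1] E_lt[OF y0 nd1] by simp
  qed
  ultimately have c_pos: "c1 > 0" "c2 > 0" using c_nn by auto
  \<comment> \<open>Of the factors in \<open>(c2 - ?x) * (c1 - ?y) = c1 * c2\<close> none is
    negative: two negative ones would be smaller than \<open>c1\<close> and \<open>c2\<close> in
    absolute value. The inequality of the arithmetic and geometric means then gives
    \<open>c1 * ?x + c2 * ?y \<le> 0\<close>.\<close>
  have s_neg: "E x0 \<xi> * E y0 \<xi> \<le> 0" if xi: "\<not> int p dvd \<xi>" for \<xi>
  proof -
    let ?x = "E x0 \<xi>" and ?y = "E y0 \<xi>"
    have fac: "(c2 - ?x) * (c1 - ?y) = c1 * c2" using prodE[of \<xi>] by (simp add: algebra_simps)
    have ub: "c2 - ?x > - c1" "c1 - ?y > - c2" using E_lt[OF x0 xi] E_lt[OF y0 xi] c12 by auto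
    have pos: "c2 - ?x > 0"
    proof (rule ccontr)
      assume "\<not> ?thesis"
      moreover have "c2 - ?x \<noteq> 0" using fac c_pos by auto
      ultimately have "c2 - ?x < 0" by simp
      then have "c1 - ?y < 0" using fac c_pos by (metis mult_pos_pos zero_less_mult_iff not_less_iff_gr_or_eq)
      then have "(?x - c2) * (?y - c1) < c1 * c2"
        using ub \<open>c2 - ?x < 0\<close> by (intro mult_strict_mono) auto
      then show False using fac by (simp add: algebra_simps)
    qed
    then have pos': "c1 - ?y > 0" using fac c_pos by (metis mult_pos_pos zero_less_mult_iff not_less_iff_gr_or_eq)
    have "0 \<le> (c1 * (c2 - ?x) - c2 * (c1 - ?y))\<^sup>2" by simp
    then have "(c1 * (c2 - ?x) + c2 * (c1 - ?y))\<^sup>2 \<ge> 4 * (c1 * c2) * ((c2 - ?x) * (c1 - ?y))"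
      by (simp add: power2_eq_square algebra_simps)
    then have "(c1 * (c2 - ?x) + c2 * (c1 - ?y))\<^sup>2 \<ge> (2 * (c1 * c2))\<^sup>2"
      unfolding fac by (simp add: power2_eq_square)
    moreover have "c1 * (c2 - ?x) + c2 * (c1 - ?y) \<ge> 0" using pos pos' c_pos by simp
    ultimately have "c1 * (c2 - ?x) + c2 * (c1 - ?y) \<ge> 2 * (c1 * c2)" by (rule power2_le_imp_le)
    then show ?thesis using prodE[of \<xi>] by (simp add: algebra_simps)
  qed
  let ?Z' = "?Z - {0}"
  have Zsplit: "?Z = insert 0 ?Z'" using p_pos by auto
  have nd: "\<not> int p dvd \<xi>" if "\<xi> \<in> ?Z'" for \<xi> using that by (auto dest: zdvd_imp_le)
  have sumE2: "(\<Sum>\<xi>\<in>?Z'. E c \<xi> * E d \<xi>) = real p * card (Cl c \<inter> Cl d) - (real f)\<^sup>2"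
    if "\<not> int p dvd c" "\<not> int p dvd d" for c d
  proof -
    have "(\<Sum>\<xi>\<in>?Z. e c \<xi> * e d \<xi>) = (\<Sum>\<xi>\<in>?Z. ft p (\<lambda>t. of_bool (t mod int p \<in> Cl c)) \<xi> * ft p (\<lambda>t. of_bool (t mod int p \<in> Cl d)) (- \<xi>))"
      by (intro sum.cong refl) (metis e_ft e_minus)
    also have "\<dots> = of_nat p * (\<Sum>t\<in>?Z. of_bool (t mod int p \<in> Cl c) * of_bool (t mod int p \<in> Cl d))"
      by (rule ft_plancherel[OF p_pos perI])
    also have "(\<Sum>t\<in>?Z. of_bool (t mod int p \<in> Cl c) * of_bool (t mod int p \<in> Cl d)) = (\<Sum>t\<in>?Z. if t \<in> Cl c \<inter> Cl d then 1 else (0::complex))"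
      by (rule sum.cong) auto
    also have "\<dots> = (\<Sum>t\<in>?Z \<inter> (Cl c \<inter> Cl d). 1)" by (rule sum.inter_restrict[symmetric]) simp
    also have "?Z \<inter> (Cl c \<inter> Cl d) = Cl c \<inter> Cl d" by (auto simp: Cl_def)
    finally have "complex_of_real (\<Sum>\<xi>\<in>?Z. E c \<xi> * E d \<xi>) = complex_of_real (real p * card (Cl c \<inter> Cl d))"
      by (simp add: eE)
    then have "(\<Sum>\<xi>\<in>?Z. E c \<xi> * E d \<xi>) = real p * card (Cl c \<inter> Cl d)" unfolding of_real_eq_iff .
    moreover have "(\<Sum>\<xi>\<in>?Z. E c \<xi> * E d \<xi>) = E c 0 * E d 0 + (\<Sum>\<xi>\<in>?Z'. E c \<xi> * E d \<xi>)"
      by (subst Zsplit, subst sum.insert) auto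
    ultimately show ?thesis using E0 that by (simp add: power2_eq_square)
  qed
  have S1: "(\<Sum>\<xi>\<in>?Z'. E x0 \<xi> * E y0 \<xi>) = - (real f)\<^sup>2"
  proof -
    have "Cl x0 \<inter> Cl y0 = {}" using ne by (auto simp: Cl_def)
    then show ?thesis using sumE2[OF x0 y0] by simp
  qed
  have S2: "(\<Sum>\<xi>\<in>?Z'. E c \<xi> * E c \<xi>) = real p * f - (real f)\<^sup>2" if "\<not> int p dvd c" for c
    using sumE2[OF that that] card_f[OF that] by simp
  have Ecl: "E c \<eta> = E c \<xi>" if c: "\<not> int p dvd c" and xi: "\<not> int p dvd \<xi>" and eta: "\<eta> \<in> Cl \<xi>" for c \<xi> \<eta>
  proof -
    have eta': "\<not> int p dvd \<eta>" "pt \<eta> = pt \<xi>" using eta by (auto simp: Cl_def)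
    obtain k where k: "int p dvd \<xi> * k - \<eta>" using solve_cong_prime[OF prime xi] by blast
    have nk: "\<not> int p dvd k" using k eta' by (metis dvd_diff_right_iff dvd_mult)
    obtain l where l: "int p dvd \<xi> * l - c" using solve_cong_prime[OF prime xi] by blast
    have nl: "\<not> int p dvd l" using l c by (metis dvd_diff_right_iff dvd_mult)
    have Clk: "Cl (k * c) = Cl c"
    proof (rule Cl_cong)
      have "pt (l * \<eta>) = pt (l * \<xi>)" by (rule dil) (use eta' xi nl in auto)
      moreover have "pt (l * \<xi>) = pt c" using pcong[OF l] by (simp add: mult.commute)
      moreover have "pt (l * \<eta>) = pt (k * c)"
      proof (rule pcong)
        have "l * \<eta> - k * c = k * (\<xi> * l - c) - l * (\<xi> * k - \<eta>)" by (simp add: algebra_simps)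
        then show "int p dvd l * \<eta> - k * c" using k l by (metis dvd_diff dvd_mult)
      qed
      ultimately show "pt (k * c) = pt c" by simp
    qed
    have bij: "bij_betw (\<lambda>x. (k * x) mod int p) (Cl c) (Cl c)"
    proof -
      have i: "inj_on (\<lambda>x. (k * x) mod int p) (Cl c)"
        using inj_scale[OF nk] by (rule inj_on_subset) (auto simp: Cl_def)
      have "(\<lambda>x. (k * x) mod int p) ` Cl c \<subseteq> Cl c" using scale[OF _ nk c] Clk by auto
      then show ?thesis using i finCl by (simp add: bij_betw_def endo_inj_surj)
    qed
    have "e c \<xi> = (\<Sum>x\<in>Cl c. ew p (\<xi> * ((k * x) mod int p)))"
      unfolding e_def by (rule sum.reindex_bij_betw[OF bij, symmetric])
    also have "\<dots> = e c \<eta>"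
      unfolding e_def
    proof (rule sum.cong[OF refl])
      fix x
      have "ew p (\<xi> * ((k * x) mod int p)) = ew p (\<xi> * (k * x))" by (rule periodicD[OF periodic_ew[OF p_pos]])
      also have "\<dots> = ew p (\<eta> * x)"
      proof (rule ew_cong[OF p_pos])
        have "\<xi> * (k * x) - \<eta> * x = (\<xi> * k - \<eta>) * x" by (simp add: algebra_simps)
        then show "int p dvd \<xi> * (k * x) - \<eta> * x" using k by simp
      qed
      finally show "ew p (\<xi> * ((k * x) mod int p)) = ew p (\<eta> * x)" .
    qed
    finally show ?thesis by (simp add: E_def)
  qed
  \<comment> \<open>The product takes the same value on a whole class of \<open>f\<close>
    frequencies and is never positive, so its total, minus the square of \<open>f\<close>, bounds
    each value.\<close>
  have s_bound: "- (E x0 \<xi> * E y0 \<xi>) \<le> f" if xi: "\<xi> \<in> ?Z'" for \<xi>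
  proof -
    have "real f * - (E x0 \<xi> * E y0 \<xi>) = (\<Sum>\<eta>\<in>Cl \<xi>. - (E x0 \<eta> * E y0 \<eta>))"
      using Ecl[OF x0 nd[OF xi]] Ecl[OF y0 nd[OF xi]] card_f[OF nd[OF xi]] by simp
    also have "\<dots> \<le> (\<Sum>\<eta>\<in>?Z'. - (E x0 \<eta> * E y0 \<eta>))"
      by (rule sum_mono2) (use s_neg nd in \<open>auto simp: Cl_def\<close>)
    also have "\<dots> = real f * f" using S1 by (simp add: sum_negf power2_eq_square)
    finally show ?thesis by (rule mult_left_le_imp_le) (use f2 in simp)
  qed
  have "(\<Sum>\<xi>\<in>?Z'. (E x0 \<xi> * E y0 \<xi>)\<^sup>2) \<le> (\<Sum>\<xi>\<in>?Z'. f * - (E x0 \<xi> * E y0 \<xi>))"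
  proof (rule sum_mono)
    fix \<xi> assume xi: "\<xi> \<in> ?Z'"
    have "(- (E x0 \<xi> * E y0 \<xi>)) * (- (E x0 \<xi> * E y0 \<xi>)) \<le> f * - (E x0 \<xi> * E y0 \<xi>)"
      using s_bound[OF xi] s_neg[OF nd[OF xi]] by (intro mult_right_mono) auto
    then show "(E x0 \<xi> * E y0 \<xi>)\<^sup>2 \<le> f * - (E x0 \<xi> * E y0 \<xi>)" by (simp add: power2_eq_square)
  qed
  also have "\<dots> = real f * - (\<Sum>\<xi>\<in>?Z'. E x0 \<xi> * E y0 \<xi>)"
    by (simp add: sum_distrib_left sum_negf)
  also have "\<dots> = real f * (real f)\<^sup>2" unfolding S1 by simp
  finally have ub: "(\<Sum>\<xi>\<in>?Z'. (E x0 \<xi> * E y0 \<xi>)\<^sup>2) \<le> real f * (real f)\<^sup>2" .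
  have "(\<Sum>\<xi>\<in>?Z'. (E x0 \<xi> * E y0 \<xi>)\<^sup>2) = (\<Sum>\<xi>\<in>?Z'. c1\<^sup>2 * (E x0 \<xi> * E x0 \<xi>) + 2 * c1 * c2 * (E x0 \<xi> * E y0 \<xi>) + c2\<^sup>2 * (E y0 \<xi> * E y0 \<xi>))"
  proof (rule sum.cong[OF refl])
    fix \<xi>
    have "(E x0 \<xi> * E y0 \<xi>)\<^sup>2 = (c1 * E x0 \<xi> + c2 * E y0 \<xi>)\<^sup>2" by (simp only: prodE)
    then show "(E x0 \<xi> * E y0 \<xi>)\<^sup>2 = c1\<^sup>2 * (E x0 \<xi> * E x0 \<xi>) + 2 * c1 * c2 * (E x0 \<xi> * E y0 \<xi>) + c2\<^sup>2 * (E y0 \<xi> * E y0 \<xi>)"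
      by (simp only:) (simp add: power2_eq_square algebra_simps)
  qed
  also have "\<dots> = c1\<^sup>2 * (real p * f - (real f)\<^sup>2) + 2 * c1 * c2 * (- (real f)\<^sup>2) + c2\<^sup>2 * (real p * f - (real f)\<^sup>2)"
    unfolding sum.distrib sum_distrib_left[symmetric] S1 S2[OF x0] S2[OF y0] ..
  finally have "real f * ((c1\<^sup>2 + c2\<^sup>2) * (real p - f) - 2 * c1 * c2 * f) \<le> real f * (real f)\<^sup>2"
    using ub by (simp add: power2_eq_square algebra_simps)
  then have main: "(c1\<^sup>2 + c2\<^sup>2) * (real p - f) - 2 * c1 * c2 * f \<le> (real f)\<^sup>2"
    using f2 by (simp add: mult_le_cancel_left)
  \<comment> \<open>Three disjoint classes of units give \<open>p - 1 \<ge> 3 * f\<close>. Together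
    with \<open>2 * c1 * c2 \<le> c1\<^sup>2 + c2\<^sup>2\<close> this reduces \<open>main\<close>
    to \<open>f + 1 \<le> 2\<close>, whereas a class contains \<open>x\<close> and
    \<open>- x\<close>.\<close>
  have pf: "real p - f \<ge> 2 * f + 1" using p3f by linarith
  have "0 \<le> (c1 - c2)\<^sup>2" by simp
  then have q: "2 * c1 * c2 \<le> c1\<^sup>2 + c2\<^sup>2" by (simp add: power2_eq_square algebra_simps)
  have "(real f)\<^sup>2 = c1\<^sup>2 + c2\<^sup>2 + 2 * c1 * c2" using c12 by (metis power2_sum)
  then have "(c1\<^sup>2 + c2\<^sup>2) * (2 * f + 1) - (c1\<^sup>2 + c2\<^sup>2) * f \<le> 2 * (c1\<^sup>2 + c2\<^sup>2)"
    using main q mult_left_mono[OF pf, of "c1\<^sup>2 + c2\<^sup>2"] mult_right_mono[OF q, of "real f"] by simp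
  then have "(c1\<^sup>2 + c2\<^sup>2) * (f + 1) \<le> (c1\<^sup>2 + c2\<^sup>2) * 2" by (simp add: algebra_simps)
  moreover have "c1\<^sup>2 + c2\<^sup>2 > 0" using c_pos by (simp add: sum_power2_gt_zero_iff)
  ultimately have "real (f + 1) \<le> 2" by (rule mult_left_le_imp_le)
  then show False using f2 by simp
qed

end

context aligned_coloring
begin

text \<open>Dividing by the coordinate of one color makes each direction a point \<open>pt x\<close>
  of the real plane of two further colors. The identity puts \<open>pt x\<close>,
  \<open>pt y\<close> and \<open>pt (x - y)\<close> on a line for any successor \<open>G\<close>,
  and on an ordinary line this is the closure hypothesis of \<open>no_third_class\<close>.\<close>

lemma real_three_colors:
  assumes rf: "rf3 p a1 a2 a3 b F F G" and perG: "periodic (int p) G"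
    and real: "par (P 1) (P (- 1))"
  shows "card (range F) \<le> 3"
proof (rule ccontr)
  assume "\<not> ?thesis"
  then have card4: "card (range F) \<ge> 4" by simp
  then obtain T where T: "T \<subseteq> range F" "card T = 4" by (metis obtain_subset_with_card_n)
  then obtain X1 T3 where T3: "T = insert X1 T3" "X1 \<notin> T3" "card T3 = 3"
    by (metis card_eq_SucD eval_nat_numeral(2) semiring_norm(26) semiring_norm(27))
  then obtain X2 X3 X4 where X: "T3 = {X2, X3, X4}" "X2 \<noteq> X3" "X2 \<noteq> X4" "X3 \<noteq> X4"
    by (metis card_3_iff)
  have inr: "X1 \<in> range F" "X2 \<in> range F" "X3 \<in> range F" "X4 \<in> range F" using T T3 X by auto
  have dist: "X1 \<noteq> X2" "X1 \<noteq> X3" "X1 \<noteq> X4" using T3 X by auto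
  have P1: "P x X1 \<noteq> 0" if "\<not> int p dvd x" for x by (rule P_nonzero[OF inr(1) that])
  have realx: "par (P x) (P (- x))" if "\<not> int p dvd x" for x using real_iff[OF that] real by simp
  define r where "r Y x = Re (P x Y / P x X1)" for Y x
  have rP: "P x Y = of_real (r Y x) * P x X1" if x: "\<not> int p dvd x" for Y x
  proof -
    have "P x Y * cnj (P x X1) = P x X1 * cnj (P x Y)"
      using parD[OF realx[OF x], of Y X1] unfolding P_uminus .
    then have "P x Y / P x X1 = cnj (P x Y / P x X1)" using P1[OF x] by (simp add: field_simps)
    then have "Im (P x Y / P x X1) = 0" by (metis Reals_cnj_iff complex_is_Real_iff)
    then have "P x Y / P x X1 = of_real (r Y x)" by (simp add: r_def complex_eq_iff)
    then show ?thesis using P1[OF x] by (simp add: field_simps)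
  qed
  define pt where "pt x = (r X2 x, r X3 x)" for x
  have Pi_eq_iff: "pt x = pt y \<longleftrightarrow> minor (P x) (P y) X1 X2 = 0 \<and> minor (P x) (P y) X1 X3 = 0"
    if "\<not> int p dvd x" "\<not> int p dvd y" for x y
    using P1 that by (simp add: pt_def minor_def rP[OF that(1), of X2] rP[OF that(1), of X3] rP[OF that(2), of X2] rP[OF that(2), of X3])
      (auto simp: mult_ac)
  have Pi_per: "periodic (int p) pt"
    by (rule periodicI) (simp add: pt_def r_def P_cong)
  have Pi_even: "pt (- x) = pt x" for x
  proof -
    have "r Y (- x) = r Y x" for Y
      unfolding r_def P_uminus by (simp flip: complex_cnj_divide)
    then show ?thesis by (simp add: pt_def)
  qed
  have Pi_dil: "pt (k * x) = pt (k * y)"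
    if "\<not> int p dvd x" "\<not> int p dvd y" "\<not> int p dvd k" "pt x = pt y" for x y k
  proof -
    have "minor (P (k * x)) (P (k * y)) X1 Y = 0" if "minor (P x) (P y) X1 Y = 0" for Y
      using minor_cft_scale[OF that \<open>\<not> int p dvd k\<close>] by (simp add: mult_ac)
    then show ?thesis using that Pi_eq_iff ndvd_mult by simp
  qed
  \<comment> \<open>The left side is the determinant of three vectors in the colors
    \<open>X1\<close>, \<open>X2\<close>, \<open>X3\<close>; the coordinates at \<open>X1\<close>
    are pulled out.\<close>
  have det_area: "P z X3 * minor (P x) (P y) X1 X2 + P z X1 * minor (P x) (P y) X2 X3 + P z X2 * minor (P x) (P y) X3 X1
      = of_real (area (pt x) (pt y) (pt z)) * (P x X1 * P y X1 * P z X1)"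
    if "\<not> int p dvd x" "\<not> int p dvd y" "\<not> int p dvd z" for x y z
    unfolding minor_def rP[OF that(1), of X2] rP[OF that(1), of X3] rP[OF that(2), of X2] rP[OF that(2), of X3]
      rP[OF that(3), of X2] rP[OF that(3), of X3]
    by (simp add: area_def pt_def algebra_simps)
  have coll: "area (pt x) (pt y) (pt (x - y)) = 0"
    if xy: "\<not> int p dvd x" "\<not> int p dvd y" "\<not> int p dvd x - y" for x y
  proof -
    have yx: "\<not> int p dvd y - x" using xy(3) by (metis dvd_diff_commute)
    have a2nz: "cft p F (a2 * t) X1 \<noteq> 0" if "\<not> int p dvd t" for t
      using cft_range_nonzero[OF inr(1) ndvd_mult[OF a(2) that]] .
    obtain r1 where r1: "r1 \<noteq> 0" "cft p F (a2 * y) = (\<lambda>Y. r1 * P y Y)"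
      using par_scalar[OF dir2 P1[OF xy(2)] a2nz[OF xy(2)]] by blast
    obtain r2 where r2: "cft p F (a2 * (y - x)) = (\<lambda>Y. r2 * P (x - y) Y)"
    proof -
      have "par (P (x - y)) (cft p F (a2 * (y - x)))"
        using par_trans[of "P (x - y)" "P (y - x)" _ X1] realx[OF xy(3)] dir2[of "y - x"] P1[OF yx] by simp
      then show ?thesis using par_scalar[of "P (x - y)" "cft p F (a2 * (y - x))" X1] P1[OF xy(3)] a2nz[OF yx] that by blast
    qed
    let ?z = "P (x - y)"
    \<comment> \<open>Directions being real, \<open>P (y - x)\<close> and \<open>P (x - y)\<close>
      are parallel, so the two terms with \<open>G\<close> share the vector \<open>?z\<close> and
      merge into \<open>minor ?z g\<close>. Expanding against \<open>?z\<close> gives a determinant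
      with a repeated vector.\<close>
    define g where "g Y = ew p (x * b) * r2 * cft p G (- a3 * x) Y - ew p (y * b) * cft p G (- a3 * y) Y" for Y
    have id: "r1 * minor (P x) (P y) X Y + minor ?z g X Y = 0" for X Y
      using succ_identity[OF rf per perG a, of x y X Y] unfolding r1(2) r2
      by (simp add: minor_def g_def algebra_simps)
    have "r1 * (?z X3 * minor (P x) (P y) X1 X2 + ?z X1 * minor (P x) (P y) X2 X3 + ?z X2 * minor (P x) (P y) X3 X1)
        = - (?z X3 * minor ?z g X1 X2 + ?z X1 * minor ?z g X2 X3 + ?z X2 * minor ?z g X3 X1)"
    proof -
      have m: "r1 * minor (P x) (P y) X Y = - minor ?z g X Y" for X Y
        using id[of X Y] by (simp add: eq_neg_iff_add_eq_0)
      have "r1 * (?z X3 * minor (P x) (P y) X1 X2 + ?z X1 * minor (P x) (P y) X2 X3 + ?z X2 * minor (P x) (P y) X3 X1)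
          = ?z X3 * (r1 * minor (P x) (P y) X1 X2) + ?z X1 * (r1 * minor (P x) (P y) X2 X3)
            + ?z X2 * (r1 * minor (P x) (P y) X3 X1)"
        by (simp only: distrib_left mult_ac)
      then show ?thesis unfolding m by simp
    qed
    also have "\<dots> = 0" by (simp add: minor_def algebra_simps)
    finally have "of_real (area (pt x) (pt y) (pt (x - y))) * (P x X1 * P y X1 * ?z X1) = (0 :: complex)"
      using r1(1) det_area[OF xy] by simp
    then show ?thesis using P1 xy by simp
  qed
  have noncoll: "\<exists>A\<in>pt ` {1..<int p}. \<exists>B\<in>pt ` {1..<int p}. \<exists>C\<in>pt ` {1..<int p}. area A B C \<noteq> 0"
  proof (rule ccontr)
    assume "\<not> ?thesis"
    then have all0: "area (pt x) (pt y) (pt z) = 0" if "x \<in> {1..<int p}" "y \<in> {1..<int p}" "z \<in> {1..<int p}" for x y z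
      using that by blast
    have modin: "x mod int p \<in> {1..<int p}" if "\<not> int p dvd x" for x
      using that p_pos pos_mod_sign[of "int p" x] pos_mod_bound[of "int p" x]
      unfolding dvd_eq_mod_eq_0 atLeastLessThan_iff by linarith
    have all: "area (pt x) (pt y) (pt z) = 0" if "\<not> int p dvd x" "\<not> int p dvd y" "\<not> int p dvd z" for x y z
      using all0[OF modin modin modin, OF that] periodicD[OF Pi_per] by simp
    \<comment> \<open>A line through all points is a linear relation between three colors at all
      nontrivial frequencies; a point of the fourth color forces its coefficients to be
      zero.\<close>
    have noline: False if "k1 \<noteq> 0 \<or> k2 \<noteq> 0 \<or> k3 \<noteq> 0" and "\<And>x. \<not> int p dvd x \<Longrightarrow> k1 + k2 * r X2 x + k3 * r X3 x = 0" for k1 k2 k3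
    proof -
      have van: "of_real k1 * P x X1 + of_real k2 * P x X2 + of_real k3 * P x X3 = 0" if x: "\<not> int p dvd x" for x
      proof -
        have "of_real k1 * P x X1 + of_real k2 * P x X2 + of_real k3 * P x X3 = of_real (k1 + k2 * r X2 x + k3 * r X3 x) * P x X1"
          unfolding rP[OF x, of X2] rP[OF x, of X3] by (simp add: algebra_simps)
        then show ?thesis using \<open>\<And>x. \<not> int p dvd x \<Longrightarrow> _ x = 0\<close>[OF x] by simp
      qed
      obtain s1 s2 s3 s4 where s: "F s1 = X1" "F s2 = X2" "F s3 = X3" "F s4 = X4" using inr by (metis imageE)
      have "k1 = 0" using P_const_colors[OF van, of s1 s4] s dist X by auto
      moreover have "k2 = 0" using P_const_colors[OF van, of s2 s4] s dist X by auto
      moreover have "k3 = 0" using P_const_colors[OF van, of s3 s4] s dist X by auto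
      ultimately show False using that(1) by simp
    qed
    show False
    proof (cases "\<forall>x. \<not> int p dvd x \<longrightarrow> pt x = pt 1")
      case True
      then have "- r X2 1 + 1 * r X2 x + 0 * r X3 x = 0" if "\<not> int p dvd x" for x
        using that by (simp add: pt_def)
      then show False using noline[of "- r X2 1" 1 0] by simp
    next
      case False
      then obtain y where y: "\<not> int p dvd y" "pt y \<noteq> pt 1" by blast
      let ?k2 = "- (r X3 y - r X3 1)" and ?k3 = "r X2 y - r X2 1"
      have "(- ?k2 * r X2 1 - ?k3 * r X3 1) + ?k2 * r X2 x + ?k3 * r X3 x = 0" if "\<not> int p dvd x" for x
        using all[OF ndvd_1 y(1) that] by (simp add: area_def pt_def algebra_simps)
      then show False by (rule noline[rotated]) (use y(2) in \<open>auto simp: pt_def\<close>)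
    qed
  qed
  obtain x0 y0 where xy0: "x0 \<in> {1..<int p}" "y0 \<in> {1..<int p}" "pt x0 \<noteq> pt y0"
    and ord: "\<And>z. z \<in> {1..<int p} \<Longrightarrow> area (pt x0) (pt y0) (pt z) = 0 \<Longrightarrow> pt z = pt x0 \<or> pt z = pt y0"
    using sylvester_gallai[OF _ noncoll] by (auto 0 4)
  have nd: "\<not> int p dvd z" if "z \<in> {1..<int p}" for z using that by (auto dest: zdvd_imp_le)
  have modin: "x mod int p \<in> {1..<int p}" if "\<not> int p dvd x" for x
    using that p_pos pos_mod_sign[of "int p" x] pos_mod_bound[of "int p" x]
      unfolding dvd_eq_mod_eq_0 atLeastLessThan_iff by linarith
  have ord': "pt z = pt x0 \<or> pt z = pt y0" if "\<not> int p dvd z" "area (pt x0) (pt y0) (pt z) = 0" for z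
    using ord[OF modin[OF that(1)]] that(2) periodicD[OF Pi_per, of z] by simp
  have "pt z = pt x0 \<or> pt z = pt y0" if z: "\<not> int p dvd z" for z
  proof (rule no_third_class[OF Pi_per Pi_even Pi_dil nd[OF xy0(1)] nd[OF xy0(2)] xy0(3) _ z])
    \<comment> \<open>The points of \<open>x\<close>, \<open>- y\<close> and \<open>x + y\<close>
      are collinear and \<open>pt\<close> is even, so \<open>pt (x + y)\<close> lies on the ordinary
      line.\<close>
    fix x y assume xy: "\<not> int p dvd x" "\<not> int p dvd y" "pt x = pt x0" "pt y = pt y0"
    have "\<not> int p dvd x - (- y)"
      using periodic_cong[OF Pi_per, of x "- y"] Pi_even[of y] xy xy0(3) by auto
    then have n: "\<not> int p dvd x + y" by simp
    have "area (pt x) (pt (- y)) (pt (x - - y)) = 0" by (rule coll) (use xy n in auto)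
    then show "pt (x + y) = pt x0 \<or> pt (x + y) = pt y0"
      using ord'[OF n] Pi_even[of y] xy by simp
  qed
  then have "area (pt x) (pt y) (pt z) = 0" if "\<not> int p dvd x" "\<not> int p dvd y" "\<not> int p dvd z" for x y z
  proof -
    have "area A B C = 0" if "A = B \<or> B = C \<or> A = C" for A B C
      using that by (auto simp: area_def)
    then show ?thesis using that \<open>\<And>z. _ \<Longrightarrow> pt z = pt x0 \<or> pt z = pt y0\<close> by metis
  qed
  then show False using noncoll nd by blast
qed

end

section \<open>The Cauchy--Davenport inequality\<close>

definition sumset_mod :: "int \<Rightarrow> int set \<Rightarrow> int set \<Rightarrow> int set"
  where "sumset_mod m A B = (\<lambda>(x, y). (x + y) mod m) ` (A \<times> B)"

lemma shift_closed_full: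
  fixes m e :: int
  assumes m: "m > 0" and e: "coprime e m" and A: "A \<subseteq> {0..<m}" "a \<in> A"
    and closed: "\<And>x. x \<in> A \<Longrightarrow> (x + e) mod m \<in> A"
  shows "A = {0..<m}"
proof
  have it: "(a + int n * e) mod m \<in> A" for n
  proof (induction n)
    case 0
    then show ?case using A by auto
  next
    case (Suc n)
    have "((a + int n * e) mod m + e) mod m = (a + int (Suc n) * e) mod m"
      unfolding mod_add_left_eq by (simp add: algebra_simps)
    then show ?case using closed[OF Suc] by simp
  qed
  show "{0..<m} \<subseteq> A"
  proof
    fix y assume y: "y \<in> {0..<m}"
    obtain k where k: "k \<in> {0..<m}" "(e * k + a) mod m = y"
    proof -
      have "y \<in> (\<lambda>t. (e * t + a) mod m) ` {0..<m}"
        using bij_betw_affine_mod[OF m e, of a] y by (simp only: bij_betw_def)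
      then show ?thesis using that by blast
    qed
    have "a + int (nat k) * e = e * k + a" using k(1) by simp
    then show "y \<in> A" using it[of "nat k"] k(2) by metis
  qed
qed (rule A)

text \<open>Induction on the size of \<open>B\<close> by the Dyson transform: \<open>A\<close> gains
  \<open>B + e\<close> and \<open>B\<close> keeps its intersection with \<open>A - e\<close>. This
  preserves the sum of the sizes and does not enlarge the sumset. The shift
  \<open>e = a - b1\<close> keeps \<open>b1\<close> and loses \<open>b2\<close>, where
  \<open>a\<close> witnesses that \<open>A\<close> is not invariant under translation by
  \<open>b2 - b1\<close>.\<close>

lemma cauchy_davenport:
  assumes p: "prime p"
  shows "A \<subseteq> {0..<int p} \<Longrightarrow> B \<subseteq> {0..<int p} \<Longrightarrow> A \<noteq> {} \<Longrightarrow> B \<noteq> {} \<Longrightarrow>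
    min p (card A + card B - 1) \<le> card (sumset_mod (int p) A B)"
proof (induction "card B" arbitrary: A B rule: less_induct)
  case less
  let ?Z = "{0..<int p}"
  have p0: "p > 0" using p by (simp add: prime_gt_0_nat)
  have finA: "finite A" and finB: "finite B" using less.prems by (auto intro: finite_subset[of _ ?Z])
  have finS: "finite (sumset_mod (int p) A B)" using finA finB by (simp add: sumset_mod_def)
  have inj: "inj_on (\<lambda>x. (x + c) mod int p) ?Z" for c
    using bij_betw_affine_mod[of "int p" 1 c] p0 by (simp add: bij_betw_def)
  have card_shift: "card ((\<lambda>x. (x + c) mod int p) ` X) = card X" if "X \<subseteq> ?Z" for c X
    by (rule card_image, rule inj_on_subset[OF inj that])
  have A_le: "card A \<le> card (sumset_mod (int p) A B)"
  proof -
    obtain b where b: "b \<in> B" using less.prems by blast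
    have "(\<lambda>x. (x + b) mod int p) ` A \<subseteq> sumset_mod (int p) A B" using b by (auto simp: sumset_mod_def)
    then show ?thesis using card_mono[OF finS] card_shift[OF less.prems(1)] by metis
  qed
  show ?case
  proof (cases "card B = 1 \<or> A = ?Z")
    case True
    then show ?thesis using A_le by auto
  next
    case False
    have "card B \<noteq> 0" using less.prems finB by simp
    then have "card B \<ge> 2" using False by linarith
    then obtain b1 b2 where b: "b1 \<in> B" "b2 \<in> B" "b1 \<noteq> b2"
      by (metis card_le_Suc0_iff_eq finB not_less_eq_eq numeral_2_eq_2)
    have "\<not> int p dvd b2 - b1"
    proof
      assume "int p dvd b2 - b1"
      then have "b2 mod int p = b1 mod int p" by (simp add: mod_eq_dvd_iff)
      then show False using b less.prems(2) by (metis atLeastLessThan_iff mod_pos_pos_trivial subsetD)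
    qed
    then have cop: "coprime (b2 - b1) (int p)"
      using p by (metis coprime_commute prime_imp_coprime prime_nat_int_transfer)
    obtain a0 where "a0 \<in> A" using less.prems by blast
    then obtain a where a: "a \<in> A" "(a + (b2 - b1)) mod int p \<notin> A"
      using shift_closed_full[OF _ cop less.prems(1)] p0 False by (metis of_nat_0_less_iff)
    define e where "e = a - b1"
    define B' where "B' = {b \<in> B. (b + e) mod int p \<in> A}"
    define A' where "A' = A \<union> (\<lambda>x. (x + e) mod int p) ` B"
    have "b1 \<in> B'" using a(1) b(1) less.prems(1) by (auto simp: B'_def e_def)
    have "b2 \<notin> B'" using a(2) by (simp add: B'_def e_def algebra_simps)
    have B'B: "B' \<subset> B" using b(2) \<open>b2 \<notin> B'\<close> by (auto simp: B'_def)
    have cardB': "card B' < card B" by (rule psubset_card_mono[OF finB B'B])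
    have "A' = A \<union> (\<lambda>x. (x + e) mod int p) ` (B - B')" by (auto simp: A'_def B'_def)
    moreover have "A \<inter> (\<lambda>x. (x + e) mod int p) ` (B - B') = {}" by (auto simp: B'_def)
    ultimately have "card A' = card A + card ((\<lambda>x. (x + e) mod int p) ` (B - B'))"
      using finA finB by (simp add: card_Un_disjoint)
    also have "card ((\<lambda>x. (x + e) mod int p) ` (B - B')) = card (B - B')"
      using less.prems(2) by (intro card_shift) auto
    also have "card (B - B') = card B - card B'"
      using B'B finB by (intro card_Diff_subset) (auto intro: finite_subset)
    finally have card_eq: "card A' + card B' = card A + card B" using cardB' by linarith
    have "sumset_mod (int p) A' B' \<subseteq> sumset_mod (int p) A B"
    proof
      fix s assume "s \<in> sumset_mod (int p) A' B'"
      then obtain x y where xy: "x \<in> A'" "y \<in> B'" "s = (x + y) mod int p" by (auto simp: sumset_mod_def)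
      show "s \<in> sumset_mod (int p) A B"
      proof (cases "x \<in> A")
        case True
        then show ?thesis using xy by (auto simp: sumset_mod_def B'_def)
      next
        case False
        then obtain t where t: "t \<in> B" "x = (t + e) mod int p" using xy(1) by (auto simp: A'_def)
        have "s = ((y + e) mod int p + t) mod int p"
          unfolding xy(3) t(2) mod_add_left_eq by (simp add: add_ac)
        moreover have "(y + e) mod int p \<in> A" using xy(2) by (simp add: B'_def)
        ultimately show ?thesis using t(1) unfolding sumset_mod_def by (intro image_eqI[of _ _ "((y + e) mod int p, t)"]) auto
      qed
    qed
    then have "card (sumset_mod (int p) A' B') \<le> card (sumset_mod (int p) A B)" by (rule card_mono[OF finS])
    moreover have "min p (card A' + card B' - 1) \<le> card (sumset_mod (int p) A' B')"
    proof (rule less.hyps[OF cardB'])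
      show "A' \<subseteq> ?Z" using less.prems p0 by (auto simp: A'_def)
      show "B' \<subseteq> ?Z" using less.prems B'B by auto
      show "A' \<noteq> {}" using a(1) by (auto simp: A'_def)
      show "B' \<noteq> {}" using \<open>b1 \<in> B'\<close> by auto
    qed
    ultimately show ?thesis using card_eq by simp
  qed
qed

definition cnt :: "nat \<Rightarrow> (int \<Rightarrow> 'c) \<Rightarrow> 'c set \<Rightarrow> nat"
  where "cnt p F W = card {t \<in> {0..<int p}. F t \<in> W}"

lemma cnt_Un: "U \<inter> V = {} \<Longrightarrow> cnt p F (U \<union> V) = cnt p F U + cnt p F V"
proof -
  assume "U \<inter> V = {}"
  then have "{t \<in> {0..<int p}. F t \<in> U \<union> V} = {t \<in> {0..<int p}. F t \<in> U} \<union> {t \<in> {0..<int p}. F t \<in> V}"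
    "{t \<in> {0..<int p}. F t \<in> U} \<inter> {t \<in> {0..<int p}. F t \<in> V} = {}" by auto
  moreover have "finite {t \<in> {0..<int p}. F t \<in> U}" for U by (rule finite_subset[of _ "{0..<int p}"]) auto
  ultimately show ?thesis unfolding cnt_def by (simp only: card_Un_disjoint)
qed

lemma cnt_UNIV: "range F \<subseteq> W \<Longrightarrow> cnt p F W = p"
proof -
  assume "range F \<subseteq> W"
  then have "{t \<in> {0..<int p}. F t \<in> W} = {0..<int p}" by auto
  then show ?thesis by (simp add: cnt_def)
qed

lemma cnt_sum: "finite W \<Longrightarrow> cnt p F W = (\<Sum>X\<in>W. cnt p F {X})"
proof (induction W rule: finite_induct)
  case empty
  then show ?case by (simp add: cnt_def)
next
  case (insert X W)
  then show ?case using cnt_Un[of "{X}" W p F] by simp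
qed

lemma cnt_0_iff:
  assumes "p > 0" "periodic (int p) F"
  shows "cnt p F {X} = 0 \<longleftrightarrow> X \<notin> range F"
  using card_color_0_iff[OF assms, of X] by (simp add: cnt_def)

lemma cft_0_cnt: "cft p F 0 X = of_nat (cnt p F {X})"
  by (simp add: cft_0 cnt_def)

text \<open>Points of \<open>F\<close> of color \<open>X\<close> and points of \<open>F\<close> with
  a color outside \<open>W\<close> and different from \<open>X\<close> have sums
  \<open>a1 * x + a2 * y\<close> that avoid \<open>b - a3 * z\<close> whenever \<open>G z\<close>
  lies in \<open>W\<close>. The 1 is the defect in the Cauchy-Davenport inequality; \<open>Y\<close>
  ensures that the second set is not empty.\<close>

lemma succ_cnt_le:
  assumes p: "prime p" and rf: "rf3 p a1 a2 a3 b F F G" and per: "periodic (int p) F" "periodic (int p) G"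
    and a: "\<not> int p dvd a1" "\<not> int p dvd a2" "\<not> int p dvd a3"
    and XY: "X \<in> range F - W" "Y \<in> range F - W" "X \<noteq> Y"
  shows "cnt p G W \<le> cnt p F W + 1"
proof (cases "cnt p G W = 0")
  case False
  let ?Z = "{0..<int p}"
  have p0: "p > 0" using p by (simp add: prime_gt_0_nat)
  have cop: "coprime k (int p)" if "\<not> int p dvd k" for k
    using that p by (metis coprime_commute prime_imp_coprime prime_nat_int_transfer)
  have modZ: "x mod int p \<in> ?Z" for x using p0 by simp
  let ?V = "- (W \<union> {X})"
  define A B C where "A = (\<lambda>x. (a1 * x + 0) mod int p) ` {t \<in> ?Z. F t \<in> {X}}"
    and "B = (\<lambda>x. (a2 * x + 0) mod int p) ` {t \<in> ?Z. F t \<in> ?V}"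
    and "C = (\<lambda>x. ((- a3) * x + b) mod int p) ` {t \<in> ?Z. G t \<in> W}"
  have inj: "inj_on (\<lambda>x. (k * x + c) mod int p) T" if "\<not> int p dvd k" "T \<subseteq> ?Z" for k c T
    using bij_betw_affine_mod[OF _ cop[OF that(1)], of c] p0 that(2) by (auto simp: bij_betw_def intro: inj_on_subset)
  have cardA: "card A = cnt p F {X}" unfolding A_def cnt_def by (rule card_image, rule inj[OF a(1)]) auto
  have cardB: "card B = cnt p F ?V" unfolding B_def cnt_def by (rule card_image, rule inj[OF a(2)]) auto
  have cardC: "card C = cnt p G W" unfolding C_def cnt_def by (rule card_image, rule inj) (use a in auto)
  have ABZ: "A \<subseteq> ?Z" "B \<subseteq> ?Z" "C \<subseteq> ?Z" unfolding A_def B_def C_def using modZ by auto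
  have ne: "A \<noteq> {}" "B \<noteq> {}"
  proof -
    obtain s t where st: "F s = X" "F t = Y" using XY by blast
    have "s mod int p \<in> {t \<in> ?Z. F t \<in> {X}}" using modZ st periodicD[OF per(1)] by simp
    then show "A \<noteq> {}" unfolding A_def by blast
    have "t mod int p \<in> {t \<in> ?Z. F t \<in> ?V}" using modZ[of t] st periodicD[OF per(1)] XY by simp
    then show "B \<noteq> {}" unfolding B_def by blast
  qed
  have disj: "sumset_mod (int p) A B \<inter> C = {}"
  proof (rule ccontr)
    assume "\<not> ?thesis"
    then obtain x y z where xyz: "F x = X" "F y \<notin> W" "F y \<noteq> X" "G z \<in> W"
      "((a1 * x + 0) mod int p + (a2 * y + 0) mod int p) mod int p = ((- a3) * z + b) mod int p"
      unfolding sumset_mod_def A_def B_def C_def by auto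
    then have "(a1 * x + a2 * y) mod int p = ((- a3) * z + b) mod int p" by (simp add: mod_add_eq)
    then have "int p dvd a1 * x + a2 * y + a3 * z - b" by (simp add: mod_eq_dvd_iff algebra_simps)
    then have "F x = F y \<or> F y = G z \<or> F x = G z" using rf unfolding rf3_def by blast
    then show False using xyz XY by auto
  qed
  have subZ: "sumset_mod (int p) A B \<subseteq> ?Z" unfolding sumset_mod_def using modZ by auto
  have "card (sumset_mod (int p) A B) + card C = card (sumset_mod (int p) A B \<union> C)"
    using disj subZ ABZ by (intro card_Un_disjoint[symmetric]) (auto intro: finite_subset[of _ ?Z])
  also have "\<dots> \<le> card ?Z" using subZ ABZ by (intro card_mono) auto
  finally have le: "card (sumset_mod (int p) A B) + card C \<le> p" by simp
  have "min p (card A + card B - 1) \<le> card (sumset_mod (int p) A B)"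
    by (rule cauchy_davenport[OF p ABZ(1,2) ne])
  then have "cnt p F {X} + cnt p F ?V + cnt p G W \<le> p + 1"
    using le False cardA cardB cardC by linarith
  moreover have "cnt p F ({X} \<union> ?V \<union> W) = cnt p F {X} + cnt p F ?V + cnt p F W"
    using XY by (subst cnt_Un, force)+ simp
  moreover have "cnt p F ({X} \<union> ?V \<union> W) = p" by (rule cnt_UNIV) auto
  ultimately show ?thesis by linarith
qed simp

section \<open>Successive colorings with different color counts\<close>

context aligned_coloring
begin

abbreviation cdiff :: "(int \<Rightarrow> 'c) \<Rightarrow> 'c \<Rightarrow> complex"
  where "cdiff G X \<equiv> cft p F 0 X - cft p G 0 X"

text \<open>Differences of counts are real numbers, so a direction parallel to them would be
  real.\<close>

lemma cdiff_not_par: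
  assumes nonreal: "\<not> par (P 1) (P (- 1))" and X: "cdiff G X \<noteq> 0" and x: "\<not> int p dvd x"
  shows "\<not> par (cdiff G) (P x)"
proof
  assume par: "par (cdiff G) (P x)"
  have cnj: "cnj (cdiff G Y) = cdiff G Y" for Y by (simp add: cft_0)
  have "cdiff G Y * P (- x) Z = cdiff G Z * P (- x) Y" for Y Z
    using arg_cong[OF parD[OF par, of Y Z], of cnj] unfolding complex_cnj_mult cnj P_uminus[symmetric] .
  then have "par (cdiff G) (P (- x))" by (simp add: par_def minor_def)
  then have "par (P x) (P (- x))" using par_trans[of "P x" "cdiff G" "P (- x)" X] par X par_commute by blast
  then show False using real_iff[OF x] nonreal by simp
qed

lemma dir2_scalar:
  assumes x: "\<not> int p dvd x"
  obtains r where "r \<noteq> 0" "\<And>Y. cft p F (a2 * x) Y = r * P x Y" "\<And>Y. cft p F (- a2 * x) Y = cnj r * P (- x) Y"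
proof -
  have "P x (F 0) \<noteq> 0" "cft p F (a2 * x) (F 0) \<noteq> 0"
    using P_nonzero[of "F 0" x] cft_range_nonzero[of "F 0" "a2 * x"] ndvd_mult[OF a(2) x] x by auto
  from par_scalar[OF dir2 this] obtain r where r: "r \<noteq> 0" "cft p F (a2 * x) = (\<lambda>Y. r * P x Y)" by blast
  have "cft p F (- a2 * x) Y = cnj r * P (- x) Y" for Y
    using cft_minus[of p F "a2 * x" Y] r(2) by (simp add: P_uminus[symmetric])
  then show thesis using r that by simp
qed

context
  fixes G :: "int \<Rightarrow> 'c" and b :: int
  assumes rf: "rf3 p a1 a2 a3 b F F G" and perG: "periodic (int p) G"
    and nonreal: "\<not> par (P 1) (P (- 1))"
begin

lemma succ_range:
  shows "range G \<subseteq> range F"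
proof
  fix c assume c: "c \<in> range G"
  show "c \<in> range F"
  proof (rule ccontr)
    assume nc: "c \<notin> range F"
    have v0: "cft p F \<xi> c = 0" for \<xi> by (rule cft_outside[OF nc])
    have Dc: "cdiff G c \<noteq> 0"
      using c cnt_0_iff[OF p_pos perG, of c] by (simp add: v0 cft_0_cnt[of p G])
    obtain r where r: "r \<noteq> 0" "\<And>Y. cft p F (- a2 * 1) Y = cnj r * P (- 1) Y"
      using dir2_scalar[OF ndvd_1] by metis
    have "(ew p (1 * b) * cft p G (- a3 * 1) c * cnj r / - cdiff G c) * P (- 1) X = P 1 X" for X
    proof -
      have "ew p (1 * b) * (cft p F (- a2 * 1) X * cft p G (- a3 * 1) c) = - cdiff G c * P 1 X"
        using succ_diff[OF rf per perG a, of 1 X c] v0 by (simp add: minor_def)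
      then show ?thesis unfolding r(2) using Dc by (simp add: field_simps)
    qed
    then have "P 1 X = (ew p (1 * b) * cft p G (- a3 * 1) c * cnj r / - cdiff G c) * P (- 1) X" for X by metis
    then have "par (P 1) (P (- 1))" unfolding par_def minor_def by simp
    then show False using nonreal by simp
  qed
qed

text \<open>Both positions of \<open>F\<close> are equivalent, so \<open>succ_diff\<close> may be
  applied with \<open>a1\<close> and \<open>a2\<close> exchanged. The same minor is evaluated twice,
  and the factor \<open>r\<close> between the vectors at \<open>a1 * x\<close> and
  \<open>a2 * x\<close> satisfies \<open>cnj r * r = 1\<close>.\<close>

lemma succ_norm:
  assumes D: "cdiff G X0 \<noteq> 0"
  shows "norm (cft p F (a1 * x) X) = norm (cft p F (a2 * x) X)"
proof (cases "int p dvd x")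
  case True
  then have "cft p F (a1 * x) = cft p F (a2 * x)" by (intro cft_cong[OF p_pos]) (simp flip: left_diff_distrib)
  then show ?thesis by simp
next
  case False
  obtain r where r: "r \<noteq> 0" "\<And>Y. cft p F (a2 * x) Y = r * P x Y" "\<And>Y. cft p F (- a2 * x) Y = cnj r * P (- x) Y"
    by (rule dir2_scalar[OF False]) (rule that)
  obtain Y Z where YZ: "minor (cdiff G) (P x) Y Z \<noteq> 0"
    using cdiff_not_par[OF nonreal D False] by (auto simp: par_def)
  define M where "M = ew p (x * b) * minor (P (- x)) (cft p G (- a3 * x)) Y Z"
  have 1: "cnj r * M = minor (cdiff G) (P x) Y Z"
    using succ_diff[OF rf per perG a, of x Y Z] unfolding M_def minor_def r(3) by (simp add: algebra_simps)
  have 2: "M = r * minor (cdiff G) (P x) Y Z"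
    using succ_diff[OF rf3_swap12[OF rf] per perG a(2) a(1) a(3), of x Y Z]
    unfolding M_def minor_def r(2) by (simp add: algebra_simps)
  have "(cnj r * r) * minor (cdiff G) (P x) Y Z = minor (cdiff G) (P x) Y Z"
    using 1 2 by (simp add: mult.assoc)
  then have "cnj r * r = 1" using YZ by simp
  then have "norm r = 1" by (metis complex_norm_square mult.commute norm_ge_zero norm_one norm_power of_real_1 power2_eq_1_iff of_real_eq_iff of_real_power not_one_le_zero le_minus_one_simps(3))
  then show ?thesis unfolding r(2) by (simp add: norm_mult)
qed

text \<open>If the counts of \<open>F\<close> and \<open>G\<close> differ only in the colors \<open>X\<close> and \<open>Y\<close>, the minors in the other
  colors show that these have real ratios at every frequency, for \<open>F\<close> and for \<open>G\<close>.\<close>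

lemma succ_real_pair:
  assumes D: "cdiff G X \<noteq> 0" "cdiff G Z = 0" "cdiff G W = 0"
    and ran: "X \<in> range F" "Z \<in> range F" "W \<in> range F" and x: "\<not> int p dvd x"
  shows "P x Z * P (- x) W = P x W * P (- x) Z"
    and "P (- x) Z * cft p G (- a3 * x) W = P (- x) W * cft p G (- a3 * x) Z"
proof -
  obtain r where r: "r \<noteq> 0" "\<And>Y. cft p F (- a2 * x) Y = cnj r * P (- x) Y"
    by (rule dir2_scalar[OF x]) (rule that)
  let ?q = "cft p G (- a3 * x)"
  let ?w = "ew p (x * b) * cnj r"
  have m: "?w * (P (- x) Y * ?q Y' - P (- x) Y' * ?q Y) = cdiff G Y * P x Y' - cdiff G Y' * P x Y" for Y Y'
    using succ_diff[OF rf per perG a, of x Y Y'] unfolding minor_def r(2) by (simp add: algebra_simps)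
  have "?w * (P (- x) Z * ?q W - P (- x) W * ?q Z) = 0" unfolding m D by simp
  then show A: "P (- x) Z * ?q W = P (- x) W * ?q Z" using r(1) by simp
  have z: "?w * (P (- x) X * ?q Z - P (- x) Z * ?q X) = cdiff G X * P x Z" unfolding m D by simp
  have w: "?w * (P (- x) X * ?q W - P (- x) W * ?q X) = cdiff G X * P x W" unfolding m D by simp
  have "cdiff G X * (P x Z * P (- x) W - P x W * P (- x) Z)
      = (cdiff G X * P x Z) * P (- x) W - (cdiff G X * P x W) * P (- x) Z" by (simp add: algebra_simps)
  also have "\<dots> = ?w * P (- x) X * (P (- x) W * ?q Z - P (- x) Z * ?q W)"
    unfolding z[symmetric] w[symmetric] by (simp add: algebra_simps)
  also have "\<dots> = 0" unfolding A by simp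
  finally show "P x Z * P (- x) W = P x W * P (- x) Z" using D(1) by simp
qed

end

end

section \<open>Pairs of colors whose transforms have a real quotient\<close>

text \<open>The transform at \<open>- \<xi>\<close> is the conjugate of that at
  \<open>\<xi>\<close>, so this says that the quotient of the transforms of \<open>X\<close> and
  \<open>Y\<close> is real, without dividing.\<close>

definition real_ratio :: "nat \<Rightarrow> (int \<Rightarrow> 'c) \<Rightarrow> 'c \<Rightarrow> 'c \<Rightarrow> bool"
  where "real_ratio p F X Y \<longleftrightarrow> (\<forall>\<xi>. \<not> int p dvd \<xi> \<longrightarrow>
    cft p F \<xi> X * cft p F (- \<xi>) Y = cft p F \<xi> Y * cft p F (- \<xi>) X)"

lemma real_ratio_sym: "real_ratio p F X Y \<longleftrightarrow> real_ratio p F Y X"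
  unfolding real_ratio_def by metis

context aligned_coloring
begin

lemma real_ratio_P: "real_ratio p F X Y \<longleftrightarrow> (\<forall>x. \<not> int p dvd x \<longrightarrow> P x X * P (- x) Y = P x Y * P (- x) X)"
proof
  assume "real_ratio p F X Y"
  then show "\<forall>x. \<not> int p dvd x \<longrightarrow> P x X * P (- x) Y = P x Y * P (- x) X"
    using ndvd_mult[OF a(1)] unfolding real_ratio_def by (metis mult_minus_right)
next
  assume *: "\<forall>x. \<not> int p dvd x \<longrightarrow> P x X * P (- x) Y = P x Y * P (- x) X"
  show "real_ratio p F X Y"
    unfolding real_ratio_def
  proof (intro allI impI)
    fix \<xi> assume xi: "\<not> int p dvd \<xi>"
    obtain x where x: "int p dvd a1 * x - \<xi>" using solve_cong_prime[OF prime a(1)] by blast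
    then have "\<not> int p dvd x" using xi by (metis dvd_diff_right_iff dvd_mult)
    moreover have "P x = cft p F \<xi>" by (rule cft_cong[OF p_pos x])
    moreover have "P (- x) = cft p F (- \<xi>)"
      by (rule cft_cong[OF p_pos]) (use x in \<open>metis dvd_minus_iff minus_diff_eq minus_diff_minus mult_minus_right\<close>)
    ultimately show "cft p F \<xi> X * cft p F (- \<xi>) Y = cft p F \<xi> Y * cft p F (- \<xi>) X" using * by metis
  qed
qed

lemma real_ratio_trans:
  assumes "real_ratio p F X Y" "real_ratio p F Y Z" "Y \<in> range F"
  shows "real_ratio p F X Z"
  unfolding real_ratio_def
proof (intro allI impI)
  fix \<xi> assume xi: "\<not> int p dvd \<xi>"
  let ?u = "cft p F \<xi>" and ?v = "cft p F (- \<xi>)"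
  have n: "?u Y \<noteq> 0" "?v Y \<noteq> 0" using cft_range_nonzero[OF assms(3)] xi by auto
  have e: "?u X * ?v Y = ?u Y * ?v X" "?u Y * ?v Z = ?u Z * ?v Y"
    using assms(1,2) xi by (auto simp: real_ratio_def)
  have "?u Y * ?v Y * (?u X * ?v Z) = (?u X * ?v Y) * (?u Y * ?v Z)" by (simp add: mult_ac)
  also have "\<dots> = ?u Y * ?v Y * (?u Z * ?v X)" unfolding e by (simp add: mult_ac)
  finally show "?u X * ?v Z = ?u Z * ?v X" using n by simp
qed

lemma cft_sum_zero:
  assumes fin: "finite (range F)" and xi: "\<not> int p dvd \<xi>"
  shows "(\<Sum>X\<in>range F. cft p F \<xi> X) = 0"
proof -
  have "(\<Sum>X\<in>range F. cft p F \<xi> X) = (\<Sum>t\<in>{0..<int p}. (\<Sum>X\<in>range F. of_bool (F t = X)) * ew p (\<xi> * t))"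
    unfolding cft_def ft_def sum_distrib_right by (rule sum.swap)
  also have "\<dots> = (\<Sum>t\<in>{0..<int p}. ew p (\<xi> * t))"
  proof (rule sum.cong[OF refl])
    fix t
    have "(\<Sum>X\<in>range F. of_bool (F t = X) :: complex) = (\<Sum>X\<in>range F. if F t = X then 1 else 0)"
      by (rule sum.cong) auto
    also have "\<dots> = 1" using fin by (subst sum.delta') auto
    finally show "(\<Sum>X\<in>range F. of_bool (F t = X)) * ew p (\<xi> * t) = ew p (\<xi> * t)" by simp
  qed
  finally show ?thesis using sum_ew[OF p_pos, of \<xi>] xi by simp
qed

text \<open>A color whose transform is a real multiple of all but one of the others forces everything to
  be real, because the transforms of all colors add up to zero.\<close>

lemma real_ratio_all_but_one:
  assumes fin: "finite (range F)" and nonreal: "\<not> par (P 1) (P (- 1))" and Z: "Z \<in> range F"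
  shows "\<not> (\<forall>X\<in>range F - {Y}. real_ratio p F X Z)"
proof
  assume all: "\<forall>X\<in>range F - {Y}. real_ratio p F X Z"
  have "real_ratio p F Y Z" if Y: "Y \<in> range F"
    unfolding real_ratio_def
  proof (intro allI impI)
    fix \<xi> assume xi: "\<not> int p dvd \<xi>"
    have s: "cft p F \<eta> Y = - (\<Sum>X\<in>range F - {Y}. cft p F \<eta> X)" if "\<not> int p dvd \<eta>" for \<eta>
      using cft_sum_zero[OF fin that] sum.remove[OF fin Y, of "cft p F \<eta>"] by (simp add: eq_neg_iff_add_eq_0)
    have "(\<Sum>X\<in>range F - {Y}. cft p F \<xi> X) * cft p F (- \<xi>) Z = cft p F \<xi> Z * (\<Sum>X\<in>range F - {Y}. cft p F (- \<xi>) X)"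
      unfolding sum_distrib_left sum_distrib_right
      by (rule sum.cong[OF refl]) (use all xi in \<open>simp add: real_ratio_def\<close>)
    then show "cft p F \<xi> Y * cft p F (- \<xi>) Z = cft p F \<xi> Z * cft p F (- \<xi>) Y"
      using s[OF xi] s[of "- \<xi>"] xi by simp
  qed
  then have all': "real_ratio p F X Z" if "X \<in> range F" for X using all that by blast
  have "minor (P 1) (P (- 1)) X Y = 0" for X Y
  proof (cases "X \<in> range F \<and> Y \<in> range F")
    case True
    then have "real_ratio p F X Z" "real_ratio p F Z Y"
      using all' real_ratio_sym[of p F Z Y] by simp_all
    then have "real_ratio p F X Y" by (rule real_ratio_trans) (rule Z)
    then show ?thesis using a(1) by (simp add: real_ratio_def minor_def)
  next
    case False
    then have "(\<forall>\<xi>. cft p F \<xi> X = 0) \<or> (\<forall>\<xi>. cft p F \<xi> Y = 0)" using cft_outside by metis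
    then show ?thesis by (auto simp: minor_def)
  qed
  then show False using nonreal by (simp add: par_def)
qed

text \<open>The colors \<open>X\<close> and \<open>Y\<close>, defined by a comparison of
  \<open>F\<close> with its successor, are recognized from \<open>F\<close> alone. If
  \<open>X\<close> and \<open>Y\<close> had a real ratio, then so would \<open>X + Y\<close>, which
  is minus the sum of the block of other colors, and \<open>X\<close> would join the block.\<close>

lemma lone_colors:
  assumes fin: "finite (range F)" and nonreal: "\<not> par (P 1) (P (- 1))"
    and XY: "X \<in> range F" "Y \<in> range F" "X \<noteq> Y"
    and block: "\<And>Z W. Z \<in> range F - {X, Y} \<Longrightarrow> W \<in> range F - {X, Y} \<Longrightarrow> real_ratio p F Z W"
    and two: "card (range F - {X, Y}) \<ge> 2"
  shows "{c \<in> range F. \<forall>c'\<in>range F - {c}. \<not> real_ratio p F c c'} = {X, Y}"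
proof -
  have one: "\<not> real_ratio p F A Z"
    if "Z \<in> range F - {X, Y}" "{A, B} = {X, Y}" for A B Z
  proof
    assume r: "real_ratio p F A Z"
    have "\<forall>C\<in>range F - {B}. real_ratio p F C Z"
    proof
      fix C assume "C \<in> range F - {B}"
      then have "C = A \<or> C \<in> range F - {X, Y}" using that(2) by blast
      then show "real_ratio p F C Z" using r block that(1) by blast
    qed
    then show False using real_ratio_all_but_one[OF fin nonreal] that(1) by blast
  qed
  obtain Z where Z: "Z \<in> range F - {X, Y}" using two by (metis card.empty equals0I not_numeral_le_zero)
  have nXY: "\<not> real_ratio p F X Y"
  proof
    assume r: "real_ratio p F X Y"
    have "real_ratio p F X Z"
      unfolding real_ratio_def
    proof (intro allI impI)
      fix \<xi> assume xi: "\<not> int p dvd \<xi>"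
      let ?u = "cft p F \<xi>" and ?v = "cft p F (- \<xi>)"
      have s: "cft p F \<eta> X + cft p F \<eta> Y = - (\<Sum>C\<in>range F - {X, Y}. cft p F \<eta> C)" if "\<not> int p dvd \<eta>" for \<eta>
      proof -
        have "range F - {X, Y} = (range F - {X}) - {Y}" by auto
        then show ?thesis
          using cft_sum_zero[OF fin that] sum.remove[OF fin XY(1), of "cft p F \<eta>"]
            sum.remove[of "range F - {X}" Y "cft p F \<eta>"] fin XY
          by (simp add: eq_neg_iff_add_eq_0 add.assoc)
      qed
      \<comment> \<open>The sum is the transform of the set of points colored \<open>X\<close> or
        \<open>Y\<close>, which is neither empty nor everything.\<close>
      have nz: "?v X + ?v Y \<noteq> 0"
      proof -
        obtain s t where st: "F s = X" "F t = Z" using XY Z by (metis DiffD1 imageE)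
        have "cft p (\<lambda>t. F t \<in> {X, Y}) (- \<xi>) True \<noteq> 0"
          by (rule cft_nonzero[of _ _ s _ t]) (use xi per st Z in \<open>auto simp: periodic_def\<close>)
        moreover have "cft p (\<lambda>t. F t \<in> {X, Y}) (- \<xi>) True = ?v X + ?v Y"
          unfolding cft_def ft_def sum.distrib[symmetric] by (rule sum.cong) (use XY(3) in auto)
        ultimately show ?thesis by simp
      qed
      have "(\<Sum>C\<in>range F - {X, Y}. ?u C) * ?v Z = ?u Z * (\<Sum>C\<in>range F - {X, Y}. ?v C)"
        unfolding sum_distrib_left sum_distrib_right
        by (rule sum.cong[OF refl]) (use block Z xi in \<open>auto simp: real_ratio_def\<close>)
      then have e1: "(?u X + ?u Y) * ?v Z = ?u Z * (?v X + ?v Y)"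
        using s[OF xi] s[of "- \<xi>"] xi by simp
      have "?u X * ?v Y = ?u Y * ?v X" using r xi by (simp add: real_ratio_def)
      then have e2: "?u X * (?v X + ?v Y) = (?u X + ?u Y) * ?v X" by (simp add: algebra_simps)
      have "(?v X + ?v Y) * (?u X * ?v Z) = (?u X + ?u Y) * ?v Z * ?v X"
        using arg_cong[OF e2, of "\<lambda>x. x * ?v Z"] by (simp add: mult_ac)
      also have "\<dots> = (?v X + ?v Y) * (?u Z * ?v X)" unfolding e1 by (simp add: mult_ac)
      finally show "?u X * ?v Z = ?u Z * ?v X" using nz by simp
    qed
    then show False using one[OF Z] by blast
  qed
  have notblock: "\<exists>c'\<in>range F - {c}. real_ratio p F c c'" if c: "c \<in> range F - {X, Y}" for c
  proof -
    have "\<not> card (range F - {X, Y}) \<le> Suc 0" using two by simp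
    then obtain c' where "c' \<in> range F - {X, Y}" "c' \<noteq> c"
      using card_le_Suc0_iff_eq[of "range F - {X, Y}"] fin c by (metis finite_Diff)
    then show ?thesis using block[OF c] by blast
  qed
  have loneA: "\<forall>c'\<in>range F - {A}. \<not> real_ratio p F A c'" if AB: "{A, B} = {X, Y}" for A B
  proof
    fix c' assume c': "c' \<in> range F - {A}"
    show "\<not> real_ratio p F A c'"
    proof (cases "c' \<in> {X, Y}")
      case True
      then have "{A, c'} = {X, Y}" using c' AB by auto
      then show ?thesis using nXY real_ratio_sym by (metis doubleton_eq_iff)
    next
      case False
      then show ?thesis using one[OF _ AB] c' by blast
    qed
  qed
  show ?thesis
  proof (intro equalityI subsetI)
    fix c assume "c \<in> {c \<in> range F. \<forall>c'\<in>range F - {c}. \<not> real_ratio p F c c'}"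
    then show "c \<in> {X, Y}" using notblock by blast
  next
    fix c assume "c \<in> {X, Y}"
    then show "c \<in> {c \<in> range F. \<forall>c'\<in>range F - {c}. \<not> real_ratio p F c c'}"
      using loneA[of X Y] loneA[of Y X] XY by auto
  qed
qed

end

lemma ratio_closed_swap23: "ratio_closed p a1 a3 a2 S \<longleftrightarrow> ratio_closed p a1 a2 a3 S"
  unfolding ratio_closed_def by blast

lemma splits_swap23: "splits p a1 a3 a2 \<longleftrightarrow> splits p a1 a2 a3"
  by (simp only: splits_def ratio_closed_swap23[of p a1 a3 a2])

section \<open>Arithmetic restrictions on color counts\<close>

text \<open>A transform of constant modulus means that the points of color \<open>X\<close> form a
  difference set: the number \<open>N t\<close> of pairs with difference \<open>t\<close> does not
  depend on \<open>t \<noteq> 0\<close>. With \<open>n\<close> points, counting all pairs gives n^2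
  = n + (p - 1) N(1).\<close>

lemma (in odd_prime) const_norm_dvd:
  assumes per: "periodic (int p) F"
    and c: "\<And>\<xi>. \<not> int p dvd \<xi> \<Longrightarrow> cft p F \<xi> X * cft p F (- \<xi>) X = c"
  shows "(p - 1) dvd cnt p F {X} * (cnt p F {X} - 1)"
proof -
  let ?Z = "{0..<int p}" and ?n = "cnt p F {X}"
  let ?i = "\<lambda>t. of_bool (F t = X) :: complex"
  define N where "N t = card {y \<in> ?Z. F (y + t) = X \<and> F y = X}" for t
  have finN: "finite {y \<in> ?Z. Q y}" for Q by (rule finite_subset[of _ ?Z]) auto
  have N_sum: "of_nat (N t) = (\<Sum>y\<in>?Z. ?i (y + t) * ?i y)" for t
  proof -
    have "(\<Sum>y\<in>?Z. ?i (y + t) * ?i y) = (\<Sum>y\<in>?Z. if F (y + t) = X \<and> F y = X then 1 else 0)"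
      by (rule sum.cong) auto
    also have "\<dots> = of_nat (N t)"
      unfolding N_def by (subst sum.inter_filter[symmetric]) auto
    finally show ?thesis by simp
  qed
  have cong: "F x = F y" if "int p dvd x - y" for x y using periodic_cong[OF per that] .
  have N_per: "periodic (int p) N"
  proof (rule periodicI)
    fix s t assume "int p dvd s - t"
    then have "F (y + s) = F (y + t)" for y by (intro cong) simp
    then show "N s = N t" by (simp add: N_def)
  qed
  have ftN: "ft p (\<lambda>t. of_nat (N t)) \<xi> = cft p F \<xi> X * cft p F (- \<xi>) X" for \<xi>
  proof -
    have per': "periodic (int p) (\<lambda>t. ?i t * ew p (\<xi> * t))"
      using per periodic_ew[OF p_pos, of \<xi>] by (simp add: periodic_def)
    have "ft p (\<lambda>t. of_nat (N t)) \<xi> = (\<Sum>y\<in>?Z. \<Sum>t\<in>?Z. ?i (y + t) * ?i y * ew p (\<xi> * t))"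
      unfolding ft_def N_sum sum_distrib_right by (rule sum.swap)
    also have "\<dots> = (\<Sum>y\<in>?Z. (?i y * ew p (- \<xi> * y)) * (\<Sum>t\<in>?Z. ?i (t + y) * ew p (\<xi> * (t + y))))"
      unfolding sum_distrib_left
    proof (intro sum.cong refl)
      fix y t
      have "ew p (\<xi> * t) = ew p (- \<xi> * y) * ew p (\<xi> * (t + y))" by (simp add: algebra_simps flip: ew_add)
      then show "?i (y + t) * ?i y * ew p (\<xi> * t) = (?i y * ew p (- \<xi> * y)) * (?i (t + y) * ew p (\<xi> * (t + y)))"
        by (simp only: add.commute[of y t] mult_ac)
    qed
    also have "\<dots> = (\<Sum>y\<in>?Z. (?i y * ew p (- \<xi> * y)) * cft p F \<xi> X)"
      using sum_periodic_shift[OF _ per'] p_pos by (simp add: cft_def ft_def)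
    also have "\<dots> = cft p F \<xi> X * cft p F (- \<xi>) X"
      by (simp only: sum_distrib_right[symmetric] cft_def ft_def mult.commute)
    finally show ?thesis .
  qed
  define f where "f t = of_nat (N t) - c * of_bool (int p dvd t)" for t
  have Zsplit: "?Z = insert 0 (?Z - {0})" using p_pos by auto
  have nd: "\<not> int p dvd t" if "t \<in> ?Z - {0}" for t using that by (auto dest: zdvd_imp_le)
  have const: "f s = f t" for s t
  proof (rule ft_zero_const[OF p_pos])
    show "periodic (int p) f" using N_per by (simp add: f_def periodic_def dvd_mod_iff)
    fix \<xi> assume xi: "\<not> int p dvd \<xi>"
    have "ft p f \<xi> = ft p (\<lambda>t. of_nat (N t)) \<xi> - c * (\<Sum>t\<in>?Z. of_bool (int p dvd t) * ew p (\<xi> * t))"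
      by (simp add: ft_def f_def left_diff_distrib sum_subtractf sum_distrib_left mult.assoc
          del: sum_of_bool_mult_eq sum_mult_of_bool_eq)
    also have "(\<Sum>t\<in>?Z. of_bool (int p dvd t) * ew p (\<xi> * t)) = (\<Sum>t\<in>?Z. if t = 0 then 1 else 0)"
      by (rule sum.cong[OF refl]) (use nd in fastforce)
    also have "\<dots> = 1" using p_pos by simp
    finally show "ft p f \<xi> = 0" using ftN c[OF xi] by simp
  qed
  have N1: "N t = N 1" if "t \<in> ?Z - {0}" for t
  proof -
    have "\<not> int p dvd 1" using prime by (metis not_prime_unit prime_nat_int_transfer)
    then have "(of_nat (N t) :: complex) = of_nat (N 1)"
      using const[of t 1] nd[OF that] by (simp add: f_def)
    then show ?thesis unfolding of_nat_eq_iff .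
  qed
  have N0: "N 0 = ?n" by (simp add: N_def cnt_def)
  have "(\<Sum>t\<in>?Z. N t) = ?n * ?n"
  proof -
    have "ft p (\<lambda>t. of_nat (N t)) 0 = of_nat ?n * of_nat ?n" unfolding ftN by (simp add: cft_0_cnt)
    then have "of_nat (\<Sum>t\<in>?Z. N t) = (of_nat (?n * ?n) :: complex)" by (simp add: ft_def)
    then show ?thesis unfolding of_nat_eq_iff .
  qed
  moreover have "(\<Sum>t\<in>?Z. N t) = N 0 + (\<Sum>t\<in>?Z - {0}. N t)"
    by (subst Zsplit, subst sum.insert) auto
  moreover have "(\<Sum>t\<in>?Z - {0}. N t) = (\<Sum>t\<in>?Z - {0}. N 1)" by (rule sum.cong[OF refl]) (metis N1)
  moreover have "card (?Z - {0}) = p - 1" using p_pos by (subst card_Diff_singleton) auto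
  then have "(\<Sum>t\<in>?Z - {0}. N 1) = (p - 1) * N 1" by simp
  ultimately have "?n * ?n = ?n + (p - 1) * N 1" using N0 by linarith
  then have "?n * (?n - 1) = (p - 1) * N 1" by (simp add: diff_mult_distrib2)
  then show ?thesis by simp
qed

text \<open>The numbers \<open>n\<close> with \<open>n (n - 1)\<close> divisible by \<open>p - 1\<close> are too sparse for two such
  distributions of \<open>p\<close> points on at least three colors to differ by steps of at most one upwards.\<close>

lemma sparse_counts:
  fixes n m :: "'c \<Rightarrow> nat"
  assumes fin: "finite C" and C3: "card C \<ge> 3" and sums: "sum n C = p" "sum m C = p"
    and pos: "\<And>X. X \<in> C \<Longrightarrow> n X \<ge> 1" "\<And>X. X \<in> C \<Longrightarrow> m X \<ge> 1"
    and le: "\<And>X. X \<in> C \<Longrightarrow> m X \<le> n X + 1"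
    and dn: "\<And>X. X \<in> C \<Longrightarrow> (p - 1) dvd n X * (n X - 1)"
    and dm: "\<And>X. X \<in> C \<Longrightarrow> (p - 1) dvd m X * (m X - 1)"
    and ne: "\<exists>X\<in>C. n X \<noteq> m X"
  shows False
proof -
  have two: "f X + f Y \<le> p - 1" if "X \<in> C" "Y \<in> C" "X \<noteq> Y" "sum f C = p" "\<And>X. X \<in> C \<Longrightarrow> f X \<ge> 1"
    for X Y and f :: "'c \<Rightarrow> nat"
  proof -
    have "card (C - {X, Y}) \<noteq> 0" using C3 that fin by (simp add: card_Diff_subset)
    then obtain Z where Z: "Z \<in> C - {X, Y}" by (metis card.empty equals0I)
    have "sum f {X, Y, Z} \<le> sum f C" using that Z fin by (intro sum_mono2) auto
    moreover have "sum f {X, Y, Z} = f X + f Y + f Z" using that(3) Z by (auto simp: sum.insert_if)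
    moreover have "f Z \<ge> 1" using that(5) Z by blast
    ultimately show ?thesis using that(4) by linarith
  qed
  have less: "f X < p - 1" if X: "X \<in> C" and s: "sum f C = p" and f: "\<And>X. X \<in> C \<Longrightarrow> f X \<ge> 1"
    for X and f :: "'c \<Rightarrow> nat"
  proof -
    have "C \<noteq> {X}" using C3 by auto
    then obtain Y where Y: "Y \<in> C" "Y \<noteq> X" using X by blast
    then have "f X + f Y \<le> p - 1" using two[OF X Y(1) _ s f] by blast
    then show ?thesis using f[OF Y(1)] by linarith
  qed
  \<comment> \<open>If \<open>k\<close> and \<open>k + 1\<close> are both admissible counts,
    \<open>p - 1\<close> divides the difference \<open>2 * k\<close> of the two products.\<close>
  have half: "2 * k = p - 1" if "(p - 1) dvd k * (k - 1)" "(p - 1) dvd (k + 1) * k" "k \<ge> 1" "k < p - 1" for k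
  proof -
    have "(p - 1) dvd (k + 1) * k - k * (k - 1)" using that(1,2) by (rule dvd_diff_nat[rotated])
    also have "(k + 1) * k - k * (k - 1) = 2 * k" using that(3) by (cases k) auto
    finally obtain j where j: "2 * k = (p - 1) * j" by blast
    have "(p - 1) * j < (p - 1) * 2" using j that(4) by linarith
    then have "j < 2" by (simp only: mult_less_cancel1)
    moreover have "j \<noteq> 0"
    proof
      assume "j = 0"
      then show False using j that(3) by simp
    qed
    ultimately have "j = 1" by simp
    then show ?thesis using j by simp
  qed
  have up: "2 * n X = p - 1" if "X \<in> C" "m X = n X + 1" for X
    using half[of "n X"] dn[OF that(1)] dm[OF that(1)] pos(1)[OF that(1)] less[OF that(1) sums(1) pos(1)] that(2) by simp
  have "\<exists>X\<in>C. n X < m X"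
  proof (rule ccontr)
    assume no: "\<not> ?thesis"
    then have "\<forall>X\<in>C. m X \<le> n X" by force
    moreover obtain X where "X \<in> C" "m X < n X" using ne no by force
    ultimately have "sum m C < sum n C" using fin by (intro sum_strict_mono_ex1) auto
    then show False using sums by simp
  qed
  then obtain X where X: "X \<in> C" "m X = n X + 1" using le by force
  have others: "m Y \<le> n Y" if "Y \<in> C" "Y \<noteq> X" for Y
  proof (rule ccontr)
    assume "\<not> ?thesis"
    then have "m Y = n Y + 1" using le[OF that(1)] by simp
    then have "m X + m Y = p + 1" using up[OF that(1)] up[OF X] X less[OF X(1) sums(1) pos(1)] by simp
    then show False using two[OF X(1) that(1) _ sums(2) pos(2)] that(2) by simp
  qed
  have rest: "sum n (C - {X}) = sum m (C - {X}) + 1"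
    using sums X sum.remove[OF fin X(1), of n] sum.remove[OF fin X(1), of m] by simp
  have "\<exists>Y\<in>C - {X}. m Y < n Y"
  proof (rule ccontr)
    assume "\<not> ?thesis"
    then have "sum n (C - {X}) \<le> sum m (C - {X})" by (intro sum_mono) force
    then show False using rest by simp
  qed
  then obtain Y where Y: "Y \<in> C" "Y \<noteq> X" "m Y < n Y" by blast
  have "n Y = m Y + 1"
  proof -
    have "sum n (C - {X}) = n Y + sum n (C - {X} - {Y})" "sum m (C - {X}) = m Y + sum m (C - {X} - {Y})"
      using sum.remove[of "C - {X}" Y] fin Y by auto
    moreover have "sum m (C - {X} - {Y}) \<le> sum n (C - {X} - {Y})" by (rule sum_mono) (use others in auto)
    ultimately show ?thesis using rest Y(3) by linarith
  qed
  then have "2 * m Y = p - 1"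
    using half[of "m Y"] dn[OF Y(1)] dm[OF Y(1)] pos(2)[OF Y(1)] less[OF Y(1) sums(2) pos(2)] by (simp add: mult.commute)
  \<comment> \<open>Color \<open>X\<close> has (p - 1)/2 points and \<open>Y\<close> has one more;
    together these are all p points, and a third color has no room.\<close>
  then show False using up[OF X] two[OF X(1) Y(1) _ sums(1) pos(1)] Y \<open>n Y = m Y + 1\<close> by simp
qed

text \<open>Since two colors together gain at most one point, only one color can gain; equality of
  the totals then leaves a single loss of one.\<close>

lemma one_step_counts:
  fixes n m :: "'c \<Rightarrow> nat"
  assumes fin: "finite C" and sums: "sum n C = sum m C"
    and le: "\<And>X. X \<in> C \<Longrightarrow> m X \<le> n X + 1"
    and le2: "\<And>X Y. X \<in> C \<Longrightarrow> Y \<in> C \<Longrightarrow> X \<noteq> Y \<Longrightarrow> m X + m Y \<le> n X + n Y + 1"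
    and ne: "\<exists>X\<in>C. n X \<noteq> m X"
  shows "\<exists>X\<in>C. \<exists>Y\<in>C. X \<noteq> Y \<and> m X = n X + 1 \<and> n Y = m Y + 1 \<and> (\<forall>Z\<in>C - {X, Y}. m Z = n Z)"
proof -
  have "\<exists>X\<in>C. n X < m X"
  proof (rule ccontr)
    assume no: "\<not> ?thesis"
    then have "\<forall>X\<in>C. m X \<le> n X" by force
    moreover obtain X where "X \<in> C" "m X < n X" using ne no by force
    ultimately have "sum m C < sum n C" using fin by (intro sum_strict_mono_ex1) auto
    then show False using sums by simp
  qed
  then obtain X where X: "X \<in> C" "m X = n X + 1" using le by force
  have others: "m Y \<le> n Y" if "Y \<in> C" "Y \<noteq> X" for Y
    using le2[OF X(1) that(1)] X(2) that(2) by simp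
  have rest: "sum n (C - {X}) = sum m (C - {X}) + 1"
    using sums X sum.remove[OF fin X(1), of n] sum.remove[OF fin X(1), of m] by simp
  have "\<exists>Y\<in>C - {X}. m Y < n Y"
  proof (rule ccontr)
    assume "\<not> ?thesis"
    then have "sum n (C - {X}) \<le> sum m (C - {X})" by (intro sum_mono) force
    then show False using rest by simp
  qed
  then obtain Y where Y: "Y \<in> C" "Y \<noteq> X" "m Y < n Y" by blast
  have rest2: "sum n (C - {X}) = n Y + sum n (C - {X} - {Y})" "sum m (C - {X}) = m Y + sum m (C - {X} - {Y})"
    using sum.remove[of "C - {X}" Y] fin Y by auto
  have le3: "sum m (C - {X} - {Y}) \<le> sum n (C - {X} - {Y})" by (rule sum_mono) (use others in auto)
  have "n Y = m Y + 1" using rest rest2 le3 Y(3) by linarith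
  moreover have "m Z = n Z" if Z: "Z \<in> C - {X, Y}" for Z
  proof (rule ccontr)
    assume "m Z \<noteq> n Z"
    then have "m Z < n Z" using others[of Z] Z by simp
    then have "sum m (C - {X} - {Y}) < sum n (C - {X} - {Y})"
      using Z others fin by (intro sum_strict_mono_ex1) auto
    then show False using rest rest2 Y(3) by linarith
  qed
  ultimately show ?thesis using X Y by metis
qed

text \<open>The successor at the third position aligns \<open>a1\<close> with \<open>a2\<close>, the
  one at the second position aligns \<open>a1\<close> with \<open>a3\<close>.\<close>

lemma succ_aligned:
  assumes p: "prime p" "odd p" and a: "\<not> int p dvd a1" "\<not> int p dvd a2" "\<not> int p dvd a3"
    and per: "periodic (int p) F" "periodic (int p) G3" "periodic (int p) G2"
    and rf: "rf3 p a1 a2 a3 b3 F F G3" "rf3 p a1 a3 a2 b2 F F G2"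
    and nonconst: "card (range F) \<ge> 2"
  shows "aligned_coloring p a1 a2 a3 F"
proof -
  interpret odd_prime p by unfold_locales (rule p)+
  show ?thesis
  proof unfold_locales
    show "par (cft p F (a1 * x)) (cft p F (a2 * x))" for x by (rule succ_par[OF rf(1) per(1,2) a])
    show "par (cft p F (a1 * x)) (cft p F (a3 * x))" for x by (rule succ_par[OF rf(2) per(1,3) a(1,3,2)])
    show "\<exists>s t. F s \<noteq> F t"
    proof (rule ccontr)
      assume "\<not> ?thesis"
      then have "range F = {F 0}" by auto
      then have "card (range F) = 1" by simp
      then show False using nonconst by simp
    qed
  qed (use a per in auto)
qed

text \<open>All color sets agree along the cycles of \<open>s\<^sub>3\<close>. Without a splitting set the transforms have
  constant modulus. With one, exactly one point changes its color in each step, always between the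
  same two colors, so that the parity of a color count alternates along cycles of odd total length.\<close>

lemma cosets_few_colors:
  fixes F :: "int \<Rightarrow> int \<Rightarrow> 'c" and d :: nat
  assumes p: "prime p" "p \<ge> 5" and a: "\<not> int p dvd a1" "\<not> int p dvd a2" "\<not> int p dvd a3"
    and d: "odd d" and per: "\<And>j. periodic (int p) (F j)"
    and s3: "bij_betw s3 {0..<int d} {0..<int d}" and s2: "\<And>j. j \<in> {0..<int d} \<Longrightarrow> s2 j \<in> {0..<int d}"
    and rf3: "\<And>j. j \<in> {0..<int d} \<Longrightarrow> \<exists>b. rf3 p a1 a2 a3 b (F j) (F j) (F (s3 j))"
    and rf2: "\<And>j. j \<in> {0..<int d} \<Longrightarrow> \<exists>b. rf3 p a1 a3 a2 b (F j) (F j) (F (s2 j))"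
  shows "\<exists>j\<in>{0..<int d}. card (range (F j)) \<le> (if splits p a1 a2 a3 then 3 else 2)"
proof (rule ccontr)
  let ?D = "{0..<int d}"
  assume "\<not> ?thesis"
  then have card: "card (range (F j)) > (if splits p a1 a2 a3 then 3 else 2)" if "j \<in> ?D" for j
    using that by force
  have card3: "card (range (F j)) \<ge> 3" if "j \<in> ?D" for j using card[OF that] by (simp split: if_splits)
  have card4: "card (range (F j)) \<ge> 4" if "j \<in> ?D" "splits p a1 a2 a3" for j using card[OF that(1)] that(2) by simp
  have oddp: "odd p" using prime_odd_nat[OF p(1)] p(2) by simp
  interpret odd_prime p by unfold_locales (rule p oddp)+
  have fin: "finite (range (F j))" if "j \<in> ?D" for j using card3[OF that] by (metis card.infinite not_numeral_le_zero)
  have s3D: "s3 j \<in> ?D" if "j \<in> ?D" for j using s3 that by (auto simp: bij_betw_def)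
  have al: "aligned_coloring p a1 a2 a3 (F j)" if j: "j \<in> ?D" for j
  proof -
    obtain b3 b2 where "rf3 p a1 a2 a3 b3 (F j) (F j) (F (s3 j))" "rf3 p a1 a3 a2 b2 (F j) (F j) (F (s2 j))"
      using rf3[OF j] rf2[OF j] by blast
    then show ?thesis using succ_aligned[OF p(1) oddp a per per per] card3[OF j] by simp
  qed
  have al': "aligned_coloring p a1 a3 a2 (F j)" if j: "j \<in> ?D" for j
  proof -
    obtain b3 b2 where "rf3 p a1 a2 a3 b3 (F j) (F j) (F (s3 j))" "rf3 p a1 a3 a2 b2 (F j) (F j) (F (s2 j))"
      using rf3[OF j] rf2[OF j] by blast
    then show ?thesis using succ_aligned[OF p(1) oddp a(1,3,2) per per per] card3[OF j] by simp
  qed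
  have nonreal: "\<not> par (cft p (F j) (a1 * 1)) (cft p (F j) (a1 * - 1))" if j: "j \<in> ?D" for j
  proof
    assume real: "par (cft p (F j) (a1 * 1)) (cft p (F j) (a1 * - 1))"
    obtain b where b: "rf3 p a1 a2 a3 b (F j) (F j) (F (s3 j))" using rf3[OF j] by blast
    show False
    proof (cases "splits p a1 a2 a3")
      case True
      then show False using aligned_coloring.real_three_colors[OF al[OF j] b per real] card4[OF j] by simp
    next
      case False
      then show False using aligned_coloring.nosplit_real[OF al[OF j] False real] card3[OF j] by simp
    qed
  qed
  \<comment> \<open>For equal counts the bounds for a coloring with the counts of its successor
    would apply and contradict the assumed number of colors.\<close>
  have diff3: "\<exists>X. cft p (F j) 0 X - cft p (F (s3 j)) 0 X \<noteq> 0" if j: "j \<in> ?D" for j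
  proof (rule ccontr)
    assume "\<not> ?thesis"
    then have D: "\<And>X. cft p (F (s3 j)) 0 X = cft p (F j) 0 X" by simp
    obtain b where b: "rf3 p a1 a2 a3 b (F j) (F j) (F (s3 j))" using rf3[OF j] by blast
    show False
    proof (cases "splits p a1 a2 a3")
      case True
      then show False using aligned_coloring.nonreal_three_colors[OF al[OF j] b per D nonreal[OF j]] card4[OF j] by simp
    next
      case False
      then show False using aligned_coloring.nosplit_nonreal[OF al[OF j] False nonreal[OF j] _ b per D] p by simp
    qed
  qed
  have range_le: "range (F (s3 j)) \<subseteq> range (F j)" if j: "j \<in> ?D" for j
  proof -
    obtain b where b: "rf3 p a1 a2 a3 b (F j) (F j) (F (s3 j))" using rf3[OF j] by blast
    show ?thesis by (rule aligned_coloring.succ_range[OF al[OF j] b per nonreal[OF j]])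
  qed
  \<comment> \<open>Color sets can only shrink along \<open>s3\<close>, but \<open>s3\<close>
    permutes the classes, so the sum of their sizes stays the same.\<close>
  have range_eq: "range (F (s3 j)) = range (F j)" if j: "j \<in> ?D" for j
  proof (rule ccontr)
    assume "range (F (s3 j)) \<noteq> range (F j)"
    then have "range (F (s3 j)) \<subset> range (F j)" using range_le[OF j] by blast
    then have "card (range (F (s3 j))) < card (range (F j))" using fin[OF j] by (rule psubset_card_mono[rotated])
    moreover have "card (range (F (s3 i))) \<le> card (range (F i))" if "i \<in> ?D" for i
      using range_le[OF that] fin[OF that] by (rule card_mono[rotated])
    ultimately have "(\<Sum>i\<in>?D. card (range (F (s3 i)))) < (\<Sum>i\<in>?D. card (range (F i)))"
      using j by (intro sum_strict_mono_ex1) auto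
    moreover have "(\<Sum>i\<in>?D. card (range (F (s3 i)))) = (\<Sum>i\<in>?D. card (range (F i)))"
      by (rule sum.reindex_bij_betw[OF s3])
    ultimately show False by simp
  qed
  define n where "n j X = cnt p (F j) {X}" for j X
  have n_pos: "n j X \<ge> 1" if "X \<in> range (F j)" for j X
    using cnt_0_iff[OF p_pos per, of j X] that by (simp add: n_def Suc_le_eq)
  have n_sum: "sum (n j) (range (F j)) = p" if j: "j \<in> ?D" for j
    using cnt_sum[OF fin[OF j], of p "F j"] cnt_UNIV[of "F j" "range (F j)" p] by (simp add: n_def)
  have n_sum': "sum (n (s3 j)) (range (F j)) = p" if j: "j \<in> ?D" for j
    using n_sum[OF s3D[OF j]] range_eq[OF j] by simp
  have n_diff: "\<exists>X\<in>range (F j). n j X \<noteq> n (s3 j) X" if j: "j \<in> ?D" for j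
  proof -
    obtain X where X: "cft p (F j) 0 X \<noteq> cft p (F (s3 j)) 0 X" using diff3[OF j] by auto
    then have "n j X \<noteq> n (s3 j) X" by (simp add: cft_0_cnt n_def)
    moreover have "X \<in> range (F j)"
    proof (rule ccontr)
      assume "X \<notin> range (F j)"
      then have "X \<notin> range (F j)" "X \<notin> range (F (s3 j))" using range_eq[OF j] by auto
      then show False using X by (simp add: cft_outside)
    qed
    ultimately show ?thesis by blast
  qed
  have avoid: "\<exists>A\<in>range (F j) - W. \<exists>B\<in>range (F j) - W. A \<noteq> B" if "card W + 2 \<le> card (range (F j))" "finite W" for j W
  proof -
    have "card (range (F j) - W) \<ge> card (range (F j)) - card W" by (rule diff_card_le_card_Diff[OF that(2)])
    then have "\<not> card (range (F j) - W) \<le> Suc 0" using that(1) by simp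
    moreover have "finite (range (F j))" using that(1) by (metis add_is_0 card.infinite le_zero_eq zero_neq_numeral)
    ultimately show ?thesis using card_le_Suc0_iff_eq[of "range (F j) - W"] by (metis finite_Diff)
  qed
  have step: "cnt p (F (s3 j)) W \<le> cnt p (F j) W + 1" if j: "j \<in> ?D" and W: "card W + 2 \<le> card (range (F j))" "finite W" for j W
  proof -
    obtain b where b: "rf3 p a1 a2 a3 b (F j) (F j) (F (s3 j))" using rf3[OF j] by blast
    obtain A B where "A \<in> range (F j) - W" "B \<in> range (F j) - W" "A \<noteq> B" using avoid[OF W] by blast
    then show ?thesis by (rule succ_cnt_le[OF p(1) b per per a])
  qed
  have n_le: "n (s3 j) X \<le> n j X + 1" if "j \<in> ?D" for j X
    using step[OF that, of "{X}"] card3[OF that] by (simp add: n_def)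
  have D0: "(0::int) \<in> ?D" using d by (auto intro: odd_pos)
  show False
  proof (cases "splits p a1 a2 a3")
    case False
    have dvd: "(p - 1) dvd n j X * (n j X - 1)" if j: "j \<in> ?D" for j X
      unfolding n_def
    proof (rule const_norm_dvd[OF per])
      obtain X3 where X3: "cft p (F j) 0 X3 - cft p (F (s3 j)) 0 X3 \<noteq> 0" using diff3[OF j] by blast
      obtain b3 where b3: "rf3 p a1 a2 a3 b3 (F j) (F j) (F (s3 j))" using rf3[OF j] by blast
      have e2: "norm (cft p (F j) (a1 * x) X) = norm (cft p (F j) (a2 * x) X)" for x
        by (rule aligned_coloring.succ_norm[OF al[OF j] b3 per nonreal[OF j] X3])
      obtain b2 where b2: "rf3 p a1 a3 a2 b2 (F j) (F j) (F (s2 j))" using rf2[OF j] by blast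
      have "\<exists>X. cft p (F j) 0 X - cft p (F (s2 j)) 0 X \<noteq> 0"
      proof (rule ccontr)
        assume "\<not> ?thesis"
        then have D: "\<And>X. cft p (F (s2 j)) 0 X = cft p (F j) 0 X" by simp
        show False
          using aligned_coloring.nosplit_nonreal[OF al'[OF j] _ nonreal[OF j] _ b2 per D] False p
          by (simp add: splits_swap23)
      qed
      then obtain X2 where X2: "cft p (F j) 0 X2 - cft p (F (s2 j)) 0 X2 \<noteq> 0" by blast
      have e3: "norm (cft p (F j) (a1 * x) X) = norm (cft p (F j) (a3 * x) X)" for x
        by (rule aligned_coloring.succ_norm[OF al'[OF j] b2 per nonreal[OF j] X2])
      \<comment> \<open>The modulus ignores the sign of the frequency and, by \<open>e2\<close> and
        \<open>e3\<close>, the choice among the three coefficients. So \<open>S\<close> is closed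
        under the ratio maps and, without a splitting set, contains all units.\<close>
      define S where "S = {x. norm (cft p (F j) (a1 * x) X) = norm (cft p (F j) (a1 * 1) X)}"
      have neg: "norm (cft p (F j) (- x) X) = norm (cft p (F j) x X)" for x by (simp add: cft_minus)
      have mv: "y \<in> S" if "x \<in> S" "int p dvd au * x + av * y"
        "\<And>x. norm (cft p (F j) (a1 * x) X) = norm (cft p (F j) (au * x) X)"
        "\<And>x. norm (cft p (F j) (a1 * x) X) = norm (cft p (F j) (av * x) X)" for x y au av
      proof -
        have "cft p (F j) (av * y) = cft p (F j) (- (au * x))"
          by (rule cft_cong[OF p_pos]) (use that(2) in \<open>simp add: add.commute\<close>)
        then have "norm (cft p (F j) (a1 * y) X) = norm (cft p (F j) (a1 * x) X)"
          using that(3)[of x] that(4)[of y] neg by simp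
        then show ?thesis using that(1) by (simp add: S_def)
      qed
      have "ratio_closed p a1 a2 a3 S"
        unfolding ratio_closed_def using mv[of _ a1 a2] mv[of _ a1 a3] mv[of _ a2 a1] mv[of _ a2 a3]
          mv[of _ a3 a1] mv[of _ a3 a2] e2 e3 by blast
      moreover have "1 \<in> S" by (simp add: S_def)
      moreover have "\<not> int p dvd 1" using p(1) by (metis not_prime_unit prime_nat_int_transfer)
      ultimately have all: "x \<in> S" if "\<not> int p dvd x" for x using False that unfolding splits_def by blast
      fix \<xi> assume xi: "\<not> int p dvd \<xi>"
      obtain x where x: "int p dvd a1 * x - \<xi>" using solve_cong_prime[OF p(1) a(1)] by blast
      have "\<not> int p dvd x" using x xi by (metis dvd_diff_right_iff dvd_mult)
      then have "norm (cft p (F j) (a1 * x) X) = norm (cft p (F j) (a1 * 1) X)" using all by (simp add: S_def)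
      moreover have "cft p (F j) (a1 * x) = cft p (F j) \<xi>" by (rule cft_cong[OF p_pos x])
      ultimately have "norm (cft p (F j) \<xi> X) = norm (cft p (F j) (a1 * 1) X)" by simp
      then show "cft p (F j) \<xi> X * cft p (F j) (- \<xi>) X = of_real ((norm (cft p (F j) (a1 * 1) X))\<^sup>2)"
        by (simp add: cft_minus complex_norm_square[symmetric])
    qed
    show False
    proof (rule sparse_counts[OF fin[OF D0] card3[OF D0] n_sum[OF D0] n_sum'[OF D0]])
      show "\<And>X. X \<in> range (F 0) \<Longrightarrow> n 0 X \<ge> 1" by (rule n_pos)
      show "\<And>X. X \<in> range (F 0) \<Longrightarrow> n (s3 0) X \<ge> 1" using n_pos[of _ "s3 0"] range_eq[OF D0] by simp
      show "\<And>X. X \<in> range (F 0) \<Longrightarrow> n (s3 0) X \<le> n 0 X + 1" by (rule n_le[OF D0])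
      show "\<And>X. X \<in> range (F 0) \<Longrightarrow> (p - 1) dvd n 0 X * (n 0 X - 1)" by (rule dvd[OF D0])
      show "\<And>X. X \<in> range (F 0) \<Longrightarrow> (p - 1) dvd n (s3 0) X * (n (s3 0) X - 1)" by (rule dvd[OF s3D[OF D0]])
      show "\<exists>X\<in>range (F 0). n 0 X \<noteq> n (s3 0) X" by (rule n_diff[OF D0])
    qed
  next
    case True
    have n_le2: "n (s3 j) X + n (s3 j) Y \<le> n j X + n j Y + 1" if "j \<in> ?D" "X \<noteq> Y" for j X Y
    proof -
      have "cnt p (F i) {X, Y} = n i X + n i Y" for i
        using cnt_Un[of "{X}" "{Y}" p "F i"] that(2) by (simp add: n_def insert_commute)
      then show ?thesis using step[OF that(1), of "{X, Y}"] card4[OF that(1) True] that(2) by simp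
    qed
    have pair: "\<exists>X\<in>range (F j). \<exists>Y\<in>range (F j). X \<noteq> Y \<and> n (s3 j) X = n j X + 1 \<and> n j Y = n (s3 j) Y + 1 \<and>
        (\<forall>Z\<in>range (F j) - {X, Y}. n (s3 j) Z = n j Z)" if j: "j \<in> ?D" for j
      by (rule one_step_counts[OF fin[OF j]]) (use n_sum[OF j] n_sum'[OF j] n_le[OF j] n_le2[OF j] n_diff[OF j] in auto)
    \<comment> \<open>By \<open>lone_colors\<close> these are the two colors whose counts change
      from \<open>F j\<close> to its successor, described in terms of \<open>F j\<close>
      only.\<close>
    define lone where "lone j = {c \<in> range (F j). \<forall>c'\<in>range (F j) - {c}. \<not> real_ratio p (F j) c c'}" for j
    have main: "\<exists>X Y. X \<noteq> Y \<and> lone j = {X, Y} \<and> n (s3 j) X = n j X + 1 \<and> n j Y = n (s3 j) Y + 1 \<and>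
        card (range (F j) - {X, Y}) \<ge> 2 \<and>
        (\<forall>Z\<in>range (F j) - {X, Y}. \<forall>W\<in>range (F j) - {X, Y}. real_ratio p (F (s3 j)) Z W)" if j: "j \<in> ?D" for j
    proof -
      interpret A: aligned_coloring p a1 a2 a3 "F j" by (rule al[OF j])
      interpret A': aligned_coloring p a1 a2 a3 "F (s3 j)" by (rule al[OF s3D[OF j]])
      obtain b where b: "rf3 p a1 a2 a3 b (F j) (F j) (F (s3 j))" using rf3[OF j] by blast
      obtain X Y where XY: "X \<in> range (F j)" "Y \<in> range (F j)" "X \<noteq> Y" "n (s3 j) X = n j X + 1" "n j Y = n (s3 j) Y + 1"
        and eq: "\<And>Z. Z \<in> range (F j) - {X, Y} \<Longrightarrow> n (s3 j) Z = n j Z" using pair[OF j] by blast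
      have two: "card (range (F j) - {X, Y}) \<ge> 2"
        using card4[OF j True] XY fin[OF j] by (simp add: card_Diff_subset)
      have DX: "cft p (F j) 0 X - cft p (F (s3 j)) 0 X \<noteq> 0" using XY(4) by (simp add: cft_0_cnt n_def)
      have DZ: "cft p (F j) 0 Z - cft p (F (s3 j)) 0 Z = 0" if "Z \<in> range (F j) - {X, Y}" for Z
        using eq[OF that] by (simp add: cft_0_cnt n_def)
      note rp = A.succ_real_pair[OF b per nonreal[OF j] DX DZ DZ XY(1)]
      have block: "real_ratio p (F j) Z W" if "Z \<in> range (F j) - {X, Y}" "W \<in> range (F j) - {X, Y}" for Z W
        unfolding A.real_ratio_P using rp(1)[OF that] that by blast
      \<comment> \<open>The unchanged colors also have real ratios in the successor, so the lone
        colors of the successor must be the same two.\<close>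
      have block': "real_ratio p (F (s3 j)) Z W" if ZW: "Z \<in> range (F j) - {X, Y}" "W \<in> range (F j) - {X, Y}" for Z W
        unfolding real_ratio_def
      proof (intro allI impI)
        fix \<xi> assume xi: "\<not> int p dvd \<xi>"
        let ?q = "cft p (F (s3 j))"
        obtain x where x: "int p dvd a3 * x - \<xi>" using solve_cong_prime[OF p(1) a(3)] by blast
        have nx: "\<not> int p dvd x" using x xi by (metis dvd_diff_right_iff dvd_mult)
        have q1: "?q (a3 * x) = ?q \<xi>" by (rule cft_cong[OF p_pos x])
        have q2: "?q (- a3 * x) = ?q (- \<xi>)"
          by (rule cft_cong[OF p_pos]) (use x in \<open>metis dvd_minus_iff minus_diff_eq minus_diff_minus mult_minus_left\<close>)
        have inr: "Z \<in> range (F j)" "W \<in> range (F j)" using ZW by auto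
        let ?u = "A.P x" and ?v = "A.P (- x)"
        have nz: "?u Z \<noteq> 0" "?u W \<noteq> 0" "?v Z \<noteq> 0" "?v W \<noteq> 0"
          using A.P_nonzero[of _ x] A.P_nonzero[of _ "- x"] inr nx by (simp_all del: mult_minus_right)
        have e1: "?u Z * ?v W = ?u W * ?v Z" by (rule rp(1)[OF ZW inr nx])
        have e2: "?v Z * ?q (- \<xi>) W = ?v W * ?q (- \<xi>) Z" using rp(2)[OF ZW inr nx] unfolding q2 .
        have e3: "?u Z * ?q \<xi> W = ?u W * ?q \<xi> Z" using rp(2)[OF ZW inr, of "- x"] nx q1 by simp
        have "(?u Z * ?v W) * (?q \<xi> W * ?q (- \<xi>) Z) = (?u Z * ?q \<xi> W) * (?v W * ?q (- \<xi>) Z)" by (simp only: mult_ac)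
        also have "\<dots> = (?u W * ?q \<xi> Z) * (?v Z * ?q (- \<xi>) W)" unfolding e3 e2 ..
        also have "\<dots> = (?u Z * ?v W) * (?q \<xi> Z * ?q (- \<xi>) W)" unfolding e1 by (simp only: mult_ac)
        finally show "?q \<xi> Z * ?q (- \<xi>) W = ?q \<xi> W * ?q (- \<xi>) Z" using nz by simp
      qed
      have "lone j = {X, Y}"
        unfolding lone_def by (rule A.lone_colors[OF fin[OF j] nonreal[OF j] XY(1,2,3) block two])
      then show ?thesis using XY two block' by blast
    qed
    have lone_s: "lone (s3 j) = lone j" if j: "j \<in> ?D" for j
    proof -
      obtain X Y where XY: "X \<noteq> Y" "lone j = {X, Y}" "card (range (F j) - {X, Y}) \<ge> 2"
        and block': "\<And>Z W. Z \<in> range (F j) - {X, Y} \<Longrightarrow> W \<in> range (F j) - {X, Y} \<Longrightarrow> real_ratio p (F (s3 j)) Z W"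
        using main[OF j] by blast
      obtain X' Y' where XY': "X' \<noteq> Y'" "lone (s3 j) = {X', Y'}" using main[OF s3D[OF j]] by blast
      have "c \<in> {X, Y}" if c: "c \<in> lone (s3 j)" for c
      proof (rule ccontr)
        assume "c \<notin> {X, Y}"
        then have cB: "c \<in> range (F j) - {X, Y}" using c range_eq[OF j] by (auto simp: lone_def)
        have "\<not> card (range (F j) - {X, Y}) \<le> Suc 0" using XY by simp
        then obtain c' where "c' \<in> range (F j) - {X, Y}" "c' \<noteq> c"
          using card_le_Suc0_iff_eq[of "range (F j) - {X, Y}"] fin[OF j] cB by (metis finite_Diff)
        then show False using block'[OF cB] c range_eq[OF j] by (auto simp: lone_def)
      qed
      then have "{X', Y'} \<subseteq> {X, Y}" using XY' by blast
      then show ?thesis using XY XY' by auto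
    qed
    \<comment> \<open>The choice depends only on the set \<open>lone j\<close>, hence is constant
      along the cycles of \<open>s3\<close>, and the count of the chosen color changes by exactly
      one in each step.\<close>
    define ch where "ch j = (SOME c. c \<in> lone j)" for j
    have ch_s: "ch (s3 j) = ch j" if "j \<in> ?D" for j using lone_s[OF that] by (simp add: ch_def)
    have flip: "even (n (s3 j) (ch (s3 j))) \<longleftrightarrow> odd (n j (ch j))" if j: "j \<in> ?D" for j
    proof -
      obtain X Y where XY: "lone j = {X, Y}" "n (s3 j) X = n j X + 1" "n j Y = n (s3 j) Y + 1"
        using main[OF j] by blast
      have "ch j \<in> lone j" unfolding ch_def by (rule someI[of _ X]) (simp add: XY(1))
      then have "ch j = X \<or> ch j = Y" using XY(1) by simp
      then show ?thesis using ch_s[OF j] XY by auto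
    qed
    \<comment> \<open>As \<open>s3\<close> exchanges indices with even and with odd count, there are
      equally many of both, and \<open>d\<close> would be even.\<close>
    let ?E = "{j \<in> ?D. even (n j (ch j))}" and ?O = "{j \<in> ?D. odd (n j (ch j))}"
    have finEO: "finite ?E" "finite ?O" by (auto intro: finite_subset[of _ ?D])
    have inj: "inj_on s3 ?D" using s3 by (simp add: bij_betw_def)
    have injE: "inj_on s3 ?E" "inj_on s3 ?O" by (rule inj_on_subset[OF inj], blast)+
    have "s3 ` ?E \<subseteq> ?O" "s3 ` ?O \<subseteq> ?E" using flip s3D by blast+
    then have "card ?E \<le> card ?O" "card ?O \<le> card ?E"
      using card_inj_on_le[OF injE(1) _ finEO(2)] card_inj_on_le[OF injE(2) _ finEO(1)] by blast+
    moreover have "card ?E + card ?O = d"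
    proof -
      have "card ?E + card ?O = card (?E \<union> ?O)"
        by (rule card_Un_disjoint[symmetric, OF finEO]) blast
      also have "?E \<union> ?O = ?D" by blast
      finally show ?thesis by simp
    qed
    ultimately have "d = 2 * card ?E" by linarith
    then show False using d by (metis dvd_triv_left)
  qed
qed

section \<open>Color sets of residue classes\<close>

definition rainbow_free :: "nat \<Rightarrow> int \<Rightarrow> int \<Rightarrow> int \<Rightarrow> int \<Rightarrow> (int \<Rightarrow> 'c) \<Rightarrow> bool"
  where "rainbow_free n a1 a2 a3 b c \<longleftrightarrow> periodic (int n) c \<and> rf3 n a1 a2 a3 b c c c"

lemma rainbow_free_swap12: "rainbow_free n a1 a2 a3 b c \<Longrightarrow> rainbow_free n a2 a1 a3 b c"
  using rf3_swap12 unfolding rainbow_free_def by blast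

lemma rainbow_free_rotate: "rainbow_free n a1 a2 a3 b c \<Longrightarrow> rainbow_free n a3 a1 a2 b c"
  using rf3_rotate unfolding rainbow_free_def by blast

lemma rainbow_free_swap23: "rainbow_free n a1 a2 a3 b c \<Longrightarrow> rainbow_free n a1 a3 a2 b c"
  using rainbow_free_swap12 rainbow_free_rotate by blast

lemma rainbow_free_comp: "rainbow_free n a1 a2 a3 b c \<Longrightarrow> rainbow_free n a1 a2 a3 b (\<lambda>x. f (c x))"
  unfolding rainbow_free_def rf3_def periodic_def by metis

lemma finite_range_periodic: "m > 0 \<Longrightarrow> periodic m c \<Longrightarrow> finite (range c)"
  by (simp add: periodic_range)

definition class_colors :: "(int \<Rightarrow> 'c) \<Rightarrow> nat \<Rightarrow> int \<Rightarrow> 'c set"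
  where "class_colors c d i = {c x | x. int d dvd x - i}"

lemma class_colors_cong:
  assumes "int d dvd i - j"
  shows "class_colors c d i = class_colors c d j"
proof -
  have "int d dvd x - i \<longleftrightarrow> int d dvd x - j" for x
    using assms by (metis diff_add_cancel diff_add_eq dvd_add_right_iff add.commute diff_diff_eq2)
  then show ?thesis by (simp add: class_colors_def)
qed

lemma class_colors_subset: "class_colors c d i \<subseteq> range c"
  by (auto simp: class_colors_def)

lemma in_class_colors: "c x \<in> class_colors c d x"
  unfolding class_colors_def by (intro CollectI exI[of _ x]) simp

lemma class_colors_range: "class_colors c d i = range (\<lambda>t. c (i + int d * t))"
proof -
  have "(\<exists>x. v = c x \<and> int d dvd x - i) \<longleftrightarrow> (\<exists>t. v = c (i + int d * t))" for v
  proof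
    assume "\<exists>x. v = c x \<and> int d dvd x - i"
    then obtain x where x: "v = c x" "int d dvd x - i" by blast
    then obtain k where "x - i = int d * k" by blast
    with x(1) show "\<exists>t. v = c (i + int d * t)" by (intro exI[of _ k]) (simp add: algebra_simps)
  qed auto
  then show ?thesis by (auto simp: class_colors_def)
qed

lemma solve_cong_coprime:
  fixes k c m :: int
  assumes "coprime k m"
  obtains x where "m dvd k * x - c"
proof -
  obtain y where "[k * y = 1] (mod m)" using cong_solve_coprime_int[OF assms] by blast
  then have "m dvd (k * y - 1) * c" by (simp add: cong_iff_dvd_diff)
  also have "(k * y - 1) * c = k * (y * c) - c" by (simp add: algebra_simps)
  finally show thesis by (rule that)
qed

text \<open>The middle variable is solved for modulo \<open>n\<close>; comparison with the solution
  modulo \<open>d\<close> puts it into the class of \<open>j\<close>, because \<open>a2\<close> is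
  invertible.\<close>

lemma lift_solution:
  assumes cop: "coprime a2 (int n)" and dn: "d dvd n"
    and sol: "int d dvd a1 * x + a2 * j + a3 * z - b"
  obtains y where "int d dvd y - j" "int n dvd a1 * x + a2 * y + a3 * z - b"
proof -
  obtain y where y: "int n dvd a2 * y - (b - a1 * x - a3 * z)" by (rule solve_cong_coprime[OF cop])
  have d: "int d dvd int n" using dn by simp
  have "int d dvd (a2 * y - (b - a1 * x - a3 * z)) - (a1 * x + a2 * j + a3 * z - b)"
    using dvd_trans[OF d y] sol by (rule dvd_diff)
  also have "(a2 * y - (b - a1 * x - a3 * z)) - (a1 * x + a2 * j + a3 * z - b) = a2 * (y - j)"
    by (simp add: algebra_simps)
  finally have "int d dvd y - j"
    using cop d by (metis coprime_dvd_mult_right_iff coprime_divisors coprime_commute dvd_refl)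
  moreover have "int n dvd a1 * x + a2 * y + a3 * z - b" using y by (simp add: algebra_simps)
  ultimately show thesis by (rule that)
qed

lemma index_solution_cong:
  assumes "int d dvd a1 * i + a2 * j + a3 * l - b" "int d dvd x - i" "int d dvd z - l"
  shows "int d dvd a1 * x + a2 * j + a3 * z - b"
proof -
  have "int d dvd (a1 * i + a2 * j + a3 * l - b) + (a1 * (x - i) + a3 * (z - l))"
    using assms by (intro dvd_add dvd_mult)
  also have "\<dots> = a1 * x + a2 * j + a3 * z - b" by (simp add: algebra_simps)
  finally show ?thesis .
qed

text \<open>Completing a point of class \<open>l\<close> and a point of color \<open>A\<close> in
  class \<open>i\<close> gives a point of class \<open>j\<close>, which has not color
  \<open>A\<close>. So the color of class \<open>l\<close> is \<open>A\<close> or occurs in class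
  \<open>j\<close>; with \<open>B\<close> in place of \<open>A\<close> the first alternative is
  ruled out.\<close>

lemma class_colors_two_missing:
  assumes rf: "rainbow_free n a1 a2 a3 b c" and cop: "coprime a2 (int n)" and dn: "d dvd n"
    and sol: "int d dvd a1 * i + a2 * j + a3 * l - b"
    and AB: "A \<in> class_colors c d i - class_colors c d j" "B \<in> class_colors c d i - class_colors c d j" "A \<noteq> B"
  shows "class_colors c d l \<subseteq> class_colors c d j"
proof
  fix v assume "v \<in> class_colors c d l"
  then obtain z where z: "v = c z" "int d dvd z - l" by (auto simp: class_colors_def)
  have *: "v = C \<or> v \<in> class_colors c d j" if C: "C \<in> class_colors c d i - class_colors c d j" for C
  proof -
    obtain x where x: "C = c x" "int d dvd x - i" using C by (auto simp: class_colors_def)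
    obtain y where y: "int d dvd y - j" "int n dvd a1 * x + a2 * y + a3 * z - b"
      by (rule lift_solution[OF cop dn index_solution_cong[OF sol x(2) z(2)]])
    have "c y \<in> class_colors c d j" using y(1) by (auto simp: class_colors_def)
    moreover have "c x = c y \<or> c y = c z \<or> c x = c z"
      using rf y(2) unfolding rainbow_free_def rf3_def by blast
    ultimately show ?thesis using C x z by auto
  qed
  show "v \<in> class_colors c d j" using *[OF AB(1)] *[OF AB(2)] AB(3) by blast
qed

text \<open>Recording for each class one color outside \<open>X\<close> (if any) gives a rainbow-free coloring of the
  index set, provided all classes but one have at most one such color.\<close>

lemma extra_coloring_rainbow_free:
  assumes rf: "rainbow_free n a1 a2 a3 b c" and dn: "d dvd n"
    and cop: "coprime a1 (int n)" "coprime a2 (int n)" "coprime a3 (int n)"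
    and per: "periodic (int d) e"
    and none: "\<And>i. e i = None \<longleftrightarrow> class_colors c d i \<subseteq> X"
    and some: "\<And>i A. e i = Some A \<Longrightarrow> A \<in> class_colors c d i - X"
    and bad: "\<And>i j A B A' B'. A \<in> class_colors c d i - X \<Longrightarrow> B \<in> class_colors c d i - X \<Longrightarrow> A \<noteq> B \<Longrightarrow>
      A' \<in> class_colors c d j - X \<Longrightarrow> B' \<in> class_colors c d j - X \<Longrightarrow> A' \<noteq> B' \<Longrightarrow> int d dvd i - j"
  shows "rainbow_free d a1 a2 a3 b e"
proof -
  define good where "good j \<longleftrightarrow> (\<forall>A\<in>class_colors c d j - X. \<forall>B\<in>class_colors c d j - X. A = B)" for j
  have core: "e i = e l \<or> e j = e i \<or> e j = e l"
    if rf': "rainbow_free n u1 u2 u3 b c" and cop': "coprime u2 (int n)"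
      and sol: "int d dvd u1 * i + u2 * j + u3 * l - b" and g: "good j"
      and A: "e i = Some A" and C: "e l = Some C" for u1 u2 u3 i j l A C
  proof (cases "A = C")
    case False
    obtain x where x: "A = c x" "int d dvd x - i" using some[OF A] by (auto simp: class_colors_def)
    obtain z where z: "C = c z" "int d dvd z - l" using some[OF C] by (auto simp: class_colors_def)
    obtain y where y: "int d dvd y - j" "int n dvd u1 * x + u2 * y + u3 * z - b"
      by (rule lift_solution[OF cop' dn index_solution_cong[OF sol x(2) z(2)]])
    have "c y = A \<or> c y = C" using rf' y(2) x z False unfolding rainbow_free_def rf3_def by metis
    then have cy: "c y \<in> class_colors c d j - X"
      using some[OF A] some[OF C] y(1) by (auto simp: class_colors_def)
    then have "e j \<noteq> None" using none by blast
    then obtain B where B: "e j = Some B" by blast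
    have "B = c y" using g cy some[OF B] unfolding good_def by blast
    then show ?thesis using B A C \<open>c y = A \<or> c y = C\<close> by auto
  qed (use A C in simp)
  have none_good: "good j" if "e j = None" for j using that none unfolding good_def by blast
  have one_bad: "e i = e j" if "\<not> good i" "\<not> good j" for i j
  proof -
    have "int d dvd i - j" using that bad unfolding good_def by blast
    then show ?thesis by (rule periodic_cong[OF per])
  qed
  have "rf3 d a1 a2 a3 b e e e"
    unfolding rf3_def
  proof (intro allI impI)
    fix x y z assume s: "int d dvd a1 * x + a2 * y + a3 * z - b"
    show "e x = e y \<or> e y = e z \<or> e x = e z"
    proof (rule ccontr)
      assume ne: "\<not> ?thesis"
      \<comment> \<open>With three distinct values at most one is \<open>None\<close> and at most
        one class is bad. Hence some good class stands opposite two recorded colors, and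
        \<open>core\<close> applies to it.\<close>
      have 2: "\<not> (good y \<and> e x \<noteq> None \<and> e z \<noteq> None)" using core[OF rf cop(2) s] ne by force
      have "int d dvd a2 * y + a1 * x + a3 * z - b" using s by (simp add: add.commute)
      then have 1: "\<not> (good x \<and> e y \<noteq> None \<and> e z \<noteq> None)"
        using core[OF rainbow_free_swap12[OF rf] cop(1)] ne by force
      have "int d dvd a1 * x + a3 * z + a2 * y - b" using s by (simp add: algebra_simps)
      then have 3: "\<not> (good z \<and> e x \<noteq> None \<and> e y \<noteq> None)"
        using core[OF rainbow_free_swap23[OF rf] cop(3)] ne by force
      show False using 1 2 3 ne none_good one_bad by metis
    qed
  qed
  then show ?thesis using per by (simp add: rainbow_free_def)
qed

lemma card_range_extra:
  assumes fin: "finite X" and fin_e: "finite (range e)" and X: "X \<noteq> {}"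
    and none: "None \<in> range e" and all: "\<And>v. v \<in> range c - X \<Longrightarrow> Some v \<in> range e"
  shows "card (range c) + 1 \<le> card X + card (range e)"
proof -
  have sub: "Some ` (range c - X) \<subseteq> range e - {None}" using all by auto
  have "finite (Some ` (range c - X))" by (rule finite_subset[OF sub]) (simp add: fin_e)
  then have finN: "finite (range c - X)" by (rule finite_imageD) simp
  have "card (range c - X) = card (Some ` (range c - X))" by (simp add: card_image)
  also have "\<dots> \<le> card (range e - {None})" by (rule card_mono[OF _ sub]) (simp add: fin_e)
  also have "\<dots> = card (range e) - 1" by (rule card_Diff_singleton[OF none])
  finally have "card (range c - X) \<le> card (range e) - 1" .
  moreover have "card (range e) \<ge> 1" using none fin_e by (metis One_nat_def Suc_leI card_gt_0_iff empty_iff)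
  moreover have "card (range c) \<le> card (X \<union> (range c - X))" by (rule card_mono) (use fin finN in auto)
  moreover have "card (X \<union> (range c - X)) = card X + card (range c - X)"
    by (rule card_Un_disjoint) (use fin finN in auto)
  ultimately show ?thesis by linarith
qed

lemma rainbow_free_class:
  assumes rf: "rainbow_free (d * m) a1 a2 a3 b c" and d: "d > 0"
    and i: "int d dvd (a1 + a2 + a3) * i - b"
  shows "\<exists>b'. rainbow_free m a1 a2 a3 b' (\<lambda>t. c (i + int d * t))"
proof -
  obtain k where k: "(a1 + a2 + a3) * i - b = int d * k" using i by blast
  have per: "periodic (int (d * m)) c" and rf': "rf3 (d * m) a1 a2 a3 b c c c"
    using rf by (auto simp: rainbow_free_def)
  have "periodic (int m) (\<lambda>t. c (i + int d * t))"
    by (rule periodicI, rule periodic_cong[OF per]) (simp flip: right_diff_distrib)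
  moreover have "rf3 m a1 a2 a3 (- k) (\<lambda>t. c (i + int d * t)) (\<lambda>t. c (i + int d * t)) (\<lambda>t. c (i + int d * t))"
    unfolding rf3_def
  proof (intro allI impI)
    fix x y z assume "int m dvd a1 * x + a2 * y + a3 * z - (- k)"
    then have "int d * int m dvd int d * (a1 * x + a2 * y + a3 * z + k)" by simp
    also have "int d * (a1 * x + a2 * y + a3 * z + k) = a1 * (i + int d * x) + a2 * (i + int d * y) + a3 * (i + int d * z) - b"
      using k by (simp add: algebra_simps)
    finally show "c (i + int d * x) = c (i + int d * y) \<or> c (i + int d * y) = c (i + int d * z) \<or> c (i + int d * x) = c (i + int d * z)"
      using rf' unfolding rf3_def by simp
  qed
  ultimately show ?thesis unfolding rainbow_free_def by blast
qed

section \<open>The upper bound\<close>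

definition gain :: "int \<Rightarrow> int \<Rightarrow> int \<Rightarrow> nat \<Rightarrow> nat"
  where "gain a1 a2 a3 p = (if splits p a1 a2 a3 then 2 else 1)"

definition bound :: "int \<Rightarrow> int \<Rightarrow> int \<Rightarrow> nat \<Rightarrow> nat"
  where "bound a1 a2 a3 n = 1 + (\<Sum>p\<in>#prime_factorization n. gain a1 a2 a3 p)"

lemma bound_prime: "prime p \<Longrightarrow> bound a1 a2 a3 p = 1 + gain a1 a2 a3 p"
  by (simp add: bound_def prime_factorization_prime)

lemma bound_mult:
  "m > 0 \<Longrightarrow> n > 0 \<Longrightarrow> bound a1 a2 a3 (m * n) + 1 = bound a1 a2 a3 m + bound a1 a2 a3 n"
  by (simp add: bound_def prime_factorization_mult)

lemma bound_prime_mult: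
  "prime p \<Longrightarrow> n > 0 \<Longrightarrow> bound a1 a2 a3 (p * n) = gain a1 a2 a3 p + bound a1 a2 a3 n"
  using bound_mult[of p n a1 a2 a3] bound_prime[of p a1 a2 a3] by (simp add: prime_gt_0_nat)

text \<open>Units modulo 3 are 1 and -1, so two coefficients agree. Moving their variables from the
  constant solution \<open>t\<close> by +1 and -1 gives a solution with three distinct
  residues.\<close>

lemma prime_bound_3:
  assumes s: "\<not> 3 dvd a1 + a2 + a3" and a: "\<not> 3 dvd a1" "\<not> 3 dvd a2" "\<not> 3 dvd a3"
    and rf: "rainbow_free 3 a1 a2 a3 b c"
  shows "card (range c) \<le> 2"
proof -
  have per: "periodic 3 c" and rf': "rf3 3 a1 a2 a3 b c c c" using rf by (auto simp: rainbow_free_def)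
  obtain t where t: "int 3 dvd (a1 + a2 + a3) * t - b"
    by (rule solve_cong_prime[of 3 "a1 + a2 + a3" b]) (use s in auto)
  have range: "range c = {c (t - 1), c t, c (t + 1)}"
  proof -
    have "c x \<in> {c (t - 1), c t, c (t + 1)}" for x
    proof -
      have "3 dvd x - (t - 1) \<or> 3 dvd x - t \<or> 3 dvd x - (t + 1)" by presburger
      then show ?thesis using periodic_cong[OF per] by blast
    qed
    then show ?thesis by auto
  qed
  have "c (t - 1) = c t \<or> c t = c (t + 1) \<or> c (t - 1) = c (t + 1)"
  proof -
    have sol: "c x = c y \<or> c y = c z \<or> c x = c z" if "3 dvd a1 * x + a2 * y + a3 * z - b" for x y z
      using rf' that unfolding rf3_def by simp
    have "3 dvd a1 - a2 \<or> 3 dvd a2 - a3 \<or> 3 dvd a1 - a3" using a by presburger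
    then consider "3 dvd a1 - a2" | "3 dvd a2 - a3" | "3 dvd a1 - a3" by blast
    then show ?thesis
    proof cases
      case 1
      have "3 dvd ((a1 + a2 + a3) * t - b) + (a1 - a2)" using t 1 by (intro dvd_add) simp_all
      also have "((a1 + a2 + a3) * t - b) + (a1 - a2) = a1 * (t + 1) + a2 * (t - 1) + a3 * t - b" by (simp add: algebra_simps)
      finally have "3 dvd a1 * (t + 1) + a2 * (t - 1) + a3 * t - b" .
      from sol[OF this] show ?thesis by auto
    next
      case 2
      have "3 dvd ((a1 + a2 + a3) * t - b) + (a2 - a3)" using t 2 by (intro dvd_add) simp_all
      also have "((a1 + a2 + a3) * t - b) + (a2 - a3) = a1 * t + a2 * (t + 1) + a3 * (t - 1) - b" by (simp add: algebra_simps)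
      finally have "3 dvd a1 * t + a2 * (t + 1) + a3 * (t - 1) - b" .
      from sol[OF this] show ?thesis by auto
    next
      case 3
      have "3 dvd ((a1 + a2 + a3) * t - b) + (a1 - a3)" using t 3 by (intro dvd_add) simp_all
      also have "((a1 + a2 + a3) * t - b) + (a1 - a3) = a1 * (t + 1) + a2 * t + a3 * (t - 1) - b" by (simp add: algebra_simps)
      finally have "3 dvd a1 * (t + 1) + a2 * t + a3 * (t - 1) - b" .
      from sol[OF this] show ?thesis by auto
    qed
  qed
  then show ?thesis unfolding range by (auto simp: card_insert_if)
qed

text \<open>A rainbow-free coloring is its own successor at every position, so the color counts
  agree trivially.\<close>

lemma prime_bound:
  assumes p: "prime p" and a: "\<not> int p dvd a1" "\<not> int p dvd a2" "\<not> int p dvd a3"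
    and s: "p = 3 \<Longrightarrow> \<not> 3 dvd a1 + a2 + a3" and rf: "rainbow_free p a1 a2 a3 b c"
  shows "card (range c) \<le> 1 + gain a1 a2 a3 p"
proof -
  have gain1: "gain a1 a2 a3 p \<ge> 1" by (simp add: gain_def)
  have per: "periodic (int p) c" and rf': "rf3 p a1 a2 a3 b c c c" using rf by (auto simp: rainbow_free_def)
  consider "p = 2" | "p = 3" | "p \<noteq> 2" "p \<noteq> 3" by blast
  then show ?thesis
  proof cases
    case 1
    have "card (range c) \<le> card {0..<int p}"
      using periodic_range[OF _ per] card_image_le[of "{0..<int p}" c] 1 by simp
    then show ?thesis using 1 gain1 by simp
  next
    case 2
    then show ?thesis using prime_bound_3[of a1 a2 a3 b c] s a rf gain1 by simp
  next
    case 3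
    have odd: "odd p" using p 3 by (metis prime_odd_nat prime_ge_2_nat le_neq_implies_less)
    show ?thesis
    proof (cases "card (range c) \<ge> 2")
      case True
      have rf'': "rf3 p a1 a3 a2 b c c c" using rainbow_free_swap23[OF rf] by (simp add: rainbow_free_def)
      interpret aligned_coloring p a1 a2 a3 c
        by (rule succ_aligned[OF p odd a per per per rf' rf'' True])
      show ?thesis
      proof (cases "splits p a1 a2 a3")
        case True
        then show ?thesis
          using real_three_colors[OF rf' per] nonreal_three_colors[OF rf' per] by (auto simp: gain_def numeral_3_eq_3)
      next
        case False
        then show ?thesis
          using nosplit_real nosplit_nonreal[OF False _ 3(2) rf' per] by (auto simp: gain_def numeral_2_eq_2)
      qed
    qed (use gain1 in simp)
  qed
qed

text \<open>The prescribed value at \<open>b0\<close> serves a class with two colors outside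
  \<open>X\<close>, where it matters which of them is recorded.\<close>

lemma extra_coloring_exists:
  "\<exists>e. (\<forall>i. e i = None \<longleftrightarrow> class_colors c d i \<subseteq> X) \<and> (\<forall>i A. e i = Some A \<longrightarrow> A \<in> class_colors c d i - X) \<and>
    periodic (int d) e \<and>
    (B \<in> class_colors c d b0 - X \<longrightarrow> e b0 = Some B)"
proof -
  let ?C = "class_colors c d"
  define e where "e i = (if ?C i \<subseteq> X then None else if B \<in> ?C b0 - X \<and> int d dvd i - b0 then Some B
    else Some (SOME A. A \<in> ?C i - X))" for i
  have "A \<in> ?C i - X" if "e i = Some A" for i A
  proof (cases "B \<in> ?C b0 - X \<and> int d dvd i - b0")
    case True
    then show ?thesis using that class_colors_cong[of d i b0 c] by (auto simp: e_def split: if_splits)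
  next
    case False
    then have "\<not> ?C i \<subseteq> X" "A = (SOME A. A \<in> ?C i - X)" using that by (auto simp: e_def split: if_splits)
    then show ?thesis using someI_ex[of "\<lambda>A. A \<in> ?C i - X"] by blast
  qed
  moreover have "periodic (int d) e"
  proof (rule periodicI)
    fix x y assume xy: "int d dvd x - y"
    have "int d dvd x - b0 \<longleftrightarrow> int d dvd y - b0"
      using dvd_add_right_iff[OF xy, of "y - b0"] by simp
    then show "e x = e y" using class_colors_cong[OF xy, of c] by (simp add: e_def)
  qed
  moreover have "e i = None \<longleftrightarrow> ?C i \<subseteq> X" for i by (simp add: e_def)
  moreover have "e b0 = Some B" if "B \<in> ?C b0 - X" using that by (auto simp: e_def)
  ultimately show ?thesis by blast
qed

lemma card_range_from_class:
  assumes per: "periodic (int n) c" and n: "n > 0" and d: "d > 0"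
    and none: "\<And>i. e i = None \<longleftrightarrow> class_colors c d i \<subseteq> class_colors c d i0" and pe: "periodic (int d) e"
    and cov: "\<And>v. v \<in> range c - class_colors c d i0 \<Longrightarrow> Some v \<in> range e"
  shows "card (range c) + 1 \<le> card (class_colors c d i0) + card (range e)"
proof (rule card_range_extra[OF _ _ _ _ cov])
  have "finite (range c)" by (rule finite_range_periodic[OF _ per]) (simp add: n)
  then show "finite (class_colors c d i0)" by (rule finite_subset[OF class_colors_subset])
  show "finite (range e)" using pe d by (intro finite_range_periodic) auto
  show "class_colors c d i0 \<noteq> {}" using in_class_colors by blast
  show "None \<in> range e" using none[of i0] by (metis order_refl rangeI)
qed

lemma few_extra_coloring:
  fixes c :: "int \<Rightarrow> 'c"
  assumes rf: "rainbow_free n a1 a2 a3 b c" and n: "n > 0" and dn: "d dvd n"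
    and cop: "coprime a1 (int n)" "coprime a2 (int n)" "coprime a3 (int n)"
    and few: "\<And>i A B. A \<in> class_colors c d i - class_colors c d i0 \<Longrightarrow> B \<in> class_colors c d i - class_colors c d i0 \<Longrightarrow> A = B"
  obtains e :: "int \<Rightarrow> 'c option" where "rainbow_free d a1 a2 a3 b e"
    "card (range c) + 1 \<le> card (class_colors c d i0) + card (range e)"
proof -
  let ?C = "class_colors c d"
  have d: "d > 0" using dn n by (metis dvd_pos_nat)
  obtain e where e: "\<And>i. e i = None \<longleftrightarrow> ?C i \<subseteq> ?C i0" "\<And>i A. e i = Some A \<Longrightarrow> A \<in> ?C i - ?C i0" "periodic (int d) e"
    using extra_coloring_exists[of c d "?C i0"] by blast
  have "rainbow_free d a1 a2 a3 b e"
  proof (rule extra_coloring_rainbow_free[OF rf dn cop e(3) e(1) e(2)])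
    fix i j A B A' B' assume "A \<in> ?C i - ?C i0" "B \<in> ?C i - ?C i0" "A \<noteq> B"
    then show "int d dvd i - j" using few by metis
  qed
  moreover have "card (range c) + 1 \<le> card (?C i0) + card (range e)"
  proof (rule card_range_from_class[OF _ n d e(1) e(3)])
    show "periodic (int n) c" using rf by (simp add: rainbow_free_def)
    fix v assume v: "v \<in> range c - ?C i0"
    then obtain x where x: "v = c x" by blast
    then have vC: "v \<in> ?C x - ?C i0" using v in_class_colors by blast
    then obtain A where A: "e x = Some A" using e(1)[of x] by (cases "e x") auto
    then have "A = v" using e(2)[OF A] vC few by blast
    then show "Some v \<in> range e" using A by (metis rangeI)
  qed
  ultimately show thesis by (rule that)
qed

lemma not_dvd_of_coprime:
  assumes "prime p" "p dvd n" "coprime a (int n)"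
  shows "\<not> int p dvd a"
proof
  assume "int p dvd a"
  moreover have "int p dvd int n" using assms(2) by simp
  ultimately have "int p dvd 1" using assms(3) by (metis coprime_common_divisor)
  then show False using assms(1) by (metis not_prime_unit prime_nat_int_transfer)
qed

lemma translation_closed_mult:
  fixes d t k :: int and Z :: "int set"
  assumes d: "d > 0" and cong: "\<And>x y. x \<in> Z \<Longrightarrow> d dvd x - y \<Longrightarrow> y \<in> Z"
    and closed: "\<And>x. x \<in> Z \<Longrightarrow> x + t \<in> Z" and x: "x \<in> Z"
  shows "x + k * t \<in> Z"
proof -
  have it: "x + int n * t \<in> Z" for n
  proof (induction n)
    case (Suc n)
    then show ?case using closed[OF Suc] by (simp add: algebra_simps)
  qed (simp add: x)
  have "x + int (nat (k mod d)) * t \<in> Z" by (rule it)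
  then have xk: "x + (k mod d) * t \<in> Z" using d by simp
  have "d dvd (k mod d - k) * t" by (simp add: mod_eq_dvd_iff[symmetric])
  also have "(k mod d - k) * t = (x + (k mod d) * t) - (x + k * t)" by (simp add: algebra_simps)
  finally show ?thesis by (rule cong[OF xk])
qed

lemma translation_closed_reaches:
  fixes d t :: int and Z :: "int set"
  assumes d: "d > 0" and cop: "coprime t d" and cong: "\<And>x y. x \<in> Z \<Longrightarrow> d dvd x - y \<Longrightarrow> y \<in> Z"
    and x: "x \<in> Z" and closed: "\<And>x. x \<in> Z \<Longrightarrow> x + t \<in> Z"
  shows "y \<in> Z"
proof -
  obtain k where k: "d dvd t * k - (y - x)" by (rule solve_cong_coprime[OF cop])
  have xk: "x + k * t \<in> Z" by (rule translation_closed_mult[OF d cong closed x])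
  have "d dvd (x + k * t) - y" using k by (simp add: algebra_simps)
  then show ?thesis by (rule cong[OF xk])
qed

text \<open>Two indices whose classes both have two colors outside the base class would make the set of
  classes with colors in the base class invariant under a translation. If just one such index
  exists, one of its two additional colors reappears in another class.\<close>

lemma bound_fixed_index:
  assumes p: "prime p" and m: "m > 0" and n: "n = p * m" and rf: "rainbow_free n a1 a2 a3 b c"
    and cop: "coprime a1 (int n)" "coprime a2 (int n)" "coprime a3 (int n)"
    and ps: "\<not> int p dvd a1 + a2 + a3" and p3: "p = 3 \<Longrightarrow> \<not> 3 dvd a1 + a2 + a3"
    and IH: "\<And>b (c' :: int \<Rightarrow> 'c). rainbow_free m a1 a2 a3 b c' \<Longrightarrow> card (range c') \<le> bound a1 a2 a3 m"
  shows "card (range (c :: int \<Rightarrow> 'c)) \<le> bound a1 a2 a3 n"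
proof -
  let ?C = "class_colors c p"
  have p0: "p > 0" using p by (simp add: prime_gt_0_nat)
  have pn: "p dvd n" by (simp add: n)
  have n0: "n > 0" using n p0 m by simp
  have nd: "\<not> int p dvd a" if "coprime a (int n)" for a by (rule not_dvd_of_coprime[OF p pn that])
  obtain i0 where i0: "int p dvd (a1 + a2 + a3) * i0 - b" by (rule solve_cong_prime[OF p ps])
  define X where "X = ?C i0"
  have cardX: "card X \<le> bound a1 a2 a3 m"
  proof -
    obtain b' where "rainbow_free m a1 a2 a3 b' (\<lambda>t. c (i0 + int p * t))"
      using rainbow_free_class[of p m a1 a2 a3 b c i0] rf n p0 i0 by auto
    then show ?thesis unfolding X_def class_colors_range by (rule IH)
  qed
  define bad where "bad i \<longleftrightarrow> (\<exists>A\<in>?C i - X. \<exists>B\<in>?C i - X. A \<noteq> B)" for i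
  have one_bad: "int p dvd i - j" if bi: "bad i" and bj: "bad j" for i j
  proof (rule ccontr)
    assume ij: "\<not> int p dvd i - j"
    \<comment> \<open>Passing from \<open>x\<close> to the class \<open>l\<close> completing
      \<open>i\<close> and \<open>x\<close>, and back with \<open>j\<close> in place of
      \<open>i\<close>, shifts \<open>x\<close> by this \<open>t\<close>.\<close>
    obtain t where t: "int p dvd a2 * t - a1 * (i - j)" by (rule solve_cong_prime[OF p nd[OF cop(2)]])
    have "\<not> int p dvd a1 * (i - j)" using ij nd[OF cop(1)] p by (simp add: prime_int_dvd_mult_iff)
    then have "\<not> int p dvd t" using t by (metis dvd_diff_right_iff dvd_mult)
    then have copt: "coprime t (int p)" using p by (metis coprime_commute prime_imp_coprime prime_nat_int_transfer)
    have mv: "?C l \<subseteq> X" if "bad k" "?C x \<subseteq> X" "int p dvd u1 * k + u2 * x + u3 * l - b"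
      "rainbow_free n u1 u2 u3 b c" "coprime u2 (int n)" for k x l u1 u2 u3
    proof -
      obtain A B where "A \<in> ?C k - X" "B \<in> ?C k - X" "A \<noteq> B" using \<open>bad k\<close> by (auto simp: bad_def)
      then have "?C l \<subseteq> ?C x"
        using class_colors_two_missing[OF that(4,5) pn that(3), of A B] that(2) by blast
      then show ?thesis using that(2) by blast
    qed
    have "i \<in> {x. ?C x \<subseteq> X}"
    proof (rule translation_closed_reaches[OF _ copt])
      show "int p > 0" using p0 by simp
      show "i0 \<in> {x. ?C x \<subseteq> X}" by (simp add: X_def)
      show "y \<in> {x. ?C x \<subseteq> X}" if "x \<in> {x. ?C x \<subseteq> X}" "int p dvd x - y" for x y
        using that class_colors_cong[OF that(2), of c] by simp
      fix x assume x: "x \<in> {x. ?C x \<subseteq> X}"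
      obtain l where l: "int p dvd a3 * l - (b - a1 * i - a2 * x)" by (rule solve_cong_prime[OF p nd[OF cop(3)]])
      have "?C l \<subseteq> X"
        by (rule mv[OF bi _ _ rf cop(2)]) (use x l in \<open>auto simp: algebra_simps\<close>)
      moreover have "int p dvd a1 * j + a3 * l + a2 * (x + t) - b"
      proof -
        have "int p dvd (a3 * l - (b - a1 * i - a2 * x)) + (a2 * t - a1 * (i - j))" using l t by simp
        then show ?thesis by (simp add: algebra_simps)
      qed
      ultimately show "x + t \<in> {x. ?C x \<subseteq> X}"
        using mv[OF bj _ _ rainbow_free_swap23[OF rf] cop(3)] by simp
    qed
    then show False using bi unfolding bad_def by blast
  qed
  have bad': "int p dvd i - j" if "A \<in> ?C i - X" "B \<in> ?C i - X" "A \<noteq> B"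
    "A' \<in> ?C j - X" "B' \<in> ?C j - X" "A' \<noteq> B'" for i j A B A' B'
    by (rule one_bad) (use that in \<open>auto simp: bad_def\<close>)
  have "\<exists>e. (\<forall>i. e i = None \<longleftrightarrow> ?C i \<subseteq> X) \<and> (\<forall>i A. e i = Some A \<longrightarrow> A \<in> ?C i - X) \<and>
    periodic (int p) e \<and> (\<forall>v\<in>range c - X. Some v \<in> range e)"
  proof (cases "\<exists>k. bad k")
    case False
    obtain e where e: "\<And>i. e i = None \<longleftrightarrow> ?C i \<subseteq> X" "\<And>i A. e i = Some A \<Longrightarrow> A \<in> ?C i - X" "periodic (int p) e"
      using extra_coloring_exists[of c p X] by blast
    have "Some v \<in> range e" if v: "v \<in> range c - X" for v
    proof -
      obtain x where x: "v = c x" using v by blast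
      then have vC: "v \<in> ?C x - X" using v in_class_colors by blast
      then obtain A where A: "e x = Some A" using e(1)[of x] by auto
      then have "A = v" using e(2)[OF A] vC False unfolding bad_def by blast
      then show ?thesis using A by (metis rangeI)
    qed
    then show ?thesis using e by blast
  next
    case True
    then obtain b0 where b0: "bad b0" by blast
    obtain k where k0: "int p dvd a3 * k - (b - a1 * b0 - a2 * b0)" by (rule solve_cong_prime[OF p nd[OF cop(3)]])
    then have k: "int p dvd a1 * b0 + a2 * b0 + a3 * k - b" by (simp add: algebra_simps)
    \<comment> \<open>Otherwise \<open>b0\<close> would solve the constant equation; its solution
      \<open>i0\<close> is unique because the sum of the coefficients is invertible, and the class
      of \<open>b0\<close> would be the base class.\<close>
    have nk: "\<not> int p dvd k - b0"
    proof
      assume "int p dvd k - b0"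
      then have "int p dvd (a1 * b0 + a2 * b0 + a3 * k - b) - a3 * (k - b0)" using dvd_diff[OF k dvd_mult] by blast
      also have "(a1 * b0 + a2 * b0 + a3 * k - b) - a3 * (k - b0) = (a1 + a2 + a3) * b0 - b" by (simp add: algebra_simps)
      finally have "int p dvd ((a1 + a2 + a3) * b0 - b) - ((a1 + a2 + a3) * i0 - b)" using i0 by (rule dvd_diff)
      also have "((a1 + a2 + a3) * b0 - b) - ((a1 + a2 + a3) * i0 - b) = (a1 + a2 + a3) * (b0 - i0)" by (simp add: algebra_simps)
      finally have "int p dvd b0 - i0" using ps p by (simp add: prime_int_dvd_mult_iff)
      then have "?C b0 = X" unfolding X_def by (rule class_colors_cong)
      then show False using b0 by (simp add: bad_def)
    qed
    have gk: "\<not> bad k" using one_bad b0 nk by blast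
    \<comment> \<open>A point of color \<open>A\<close> and one of color \<open>B\<close> in class
      \<open>b0\<close> are completed in class \<open>k\<close>, by a point with one of these two
      colors. So class \<open>k\<close> records one of them, and \<open>b0\<close> is made to record
      the other.\<close>
    have hit: "A \<in> ?C k - X \<or> B \<in> ?C k - X" if AB: "A \<in> ?C b0 - X" "B \<in> ?C b0 - X" "A \<noteq> B" for A B
    proof -
      obtain x where x: "A = c x" "int p dvd x - b0" using AB(1) by (auto simp: class_colors_def)
      obtain y where y: "B = c y" "int p dvd y - b0" using AB(2) by (auto simp: class_colors_def)
      have s: "int p dvd a1 * x + a3 * k + a2 * y - b"
        using index_solution_cong[of p a1 b0 a3 k a2 b0 b x y] k x y by (simp add: algebra_simps)
      obtain z where z: "int p dvd z - k" "int n dvd a1 * x + a3 * z + a2 * y - b"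
        by (rule lift_solution[OF cop(3) pn s])
      have "int n dvd a1 * x + a2 * y + a3 * z - b" using z(2) by (simp add: algebra_simps)
      then have "c x = c y \<or> c y = c z \<or> c x = c z" using rf unfolding rainbow_free_def rf3_def by blast
      moreover have "c z \<in> ?C k" using z(1) by (auto simp: class_colors_def)
      ultimately show ?thesis using AB x y by auto
    qed
    obtain A1 A2 where A12: "A1 \<in> ?C b0 - X" "A2 \<in> ?C b0 - X" "A1 \<noteq> A2" using b0 by (auto simp: bad_def)
    obtain K B where K: "K \<in> ?C k - X" "B \<in> ?C b0 - X" "B \<noteq> K" using hit[OF A12] A12 by metis
    have Kuniq: "A = K" if "A \<in> ?C k - X" for A using gk K(1) that unfolding bad_def by blast
    have b0_colors: "A = K \<or> A = B" if "A \<in> ?C b0 - X" for A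
      using hit[OF that K(2)] Kuniq K(3) by blast
    obtain e where e: "\<And>i. e i = None \<longleftrightarrow> ?C i \<subseteq> X" "\<And>i A. e i = Some A \<Longrightarrow> A \<in> ?C i - X" "periodic (int p) e"
      and eb: "e b0 = Some B"
      using extra_coloring_exists[of c p X B b0] K(2) by blast
    have ek: "e k = Some K"
    proof -
      obtain A where "e k = Some A" using e(1)[of k] K(1) by (cases "e k") auto
      then show ?thesis using e(2) Kuniq by blast
    qed
    have "Some v \<in> range e" if v: "v \<in> range c - X" for v
    proof -
      obtain x where x: "v = c x" using v by blast
      then have vC: "v \<in> ?C x - X" using v in_class_colors by blast
      show ?thesis
      proof (cases "bad x")
        case True
        have "?C x = ?C b0" by (rule class_colors_cong[OF one_bad[OF True b0]])
        then have "v = K \<or> v = B" using vC b0_colors by blast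
        then show ?thesis using ek eb by (metis rangeI)
      next
        case False
        obtain A where A: "e x = Some A" using e(1)[of x] vC by (cases "e x") auto
        then have "A = v" using e(2)[OF A] vC False unfolding bad_def by blast
        then show ?thesis using A by (metis rangeI)
      qed
    qed
    then show ?thesis using e by blast
  qed
  then obtain e where e: "\<And>i. e i = None \<longleftrightarrow> ?C i \<subseteq> X" "\<And>i A. e i = Some A \<Longrightarrow> A \<in> ?C i - X" "periodic (int p) e"
    and ecov: "\<And>v. v \<in> range c - X \<Longrightarrow> Some v \<in> range e" by blast
  have rfe: "rainbow_free p a1 a2 a3 b e"
    by (rule extra_coloring_rainbow_free[OF rf pn cop e(3) e(1) e(2) bad'])
  have "card (range e) \<le> 1 + gain a1 a2 a3 p"
    by (rule prime_bound[OF p nd[OF cop(1)] nd[OF cop(2)] nd[OF cop(3)] p3 rfe])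
  moreover have "card (range c) + 1 \<le> card X + card (range e)"
  proof -
    have "periodic (int n) c" using rf by (simp add: rainbow_free_def)
    moreover have "n > 0" using n0 by simp
    ultimately show ?thesis
      using card_range_from_class[OF _ _ p0 e(1)[unfolded X_def] e(3) ecov[unfolded X_def]] unfolding X_def by simp
  qed
  ultimately show ?thesis using cardX bound_prime_mult[OF p m, of a1 a2 a3] n by simp
qed

text \<open>Every class is itself a coloring modulo \<open>m\<close> here, so the base can be one with most colors.\<close>

lemma bound_all_fixed_indices:
  fixes c :: "int \<Rightarrow> 'c"
  assumes p: "prime p" and m: "m > 0" and n: "n = p * m" and rf: "rainbow_free n a1 a2 a3 b c"
    and cop: "coprime a1 (int n)" "coprime a2 (int n)" "coprime a3 (int n)"
    and ps: "int p dvd a1 + a2 + a3" and pb: "int p dvd b" and p3: "p = 3 \<Longrightarrow> \<not> 3 dvd a1 + a2 + a3"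
    and IH: "\<And>b (c' :: int \<Rightarrow> 'c). rainbow_free m a1 a2 a3 b c' \<Longrightarrow> card (range c') \<le> bound a1 a2 a3 m"
  shows "card (range c) \<le> bound a1 a2 a3 n"
proof -
  let ?C = "class_colors c p"
  have p0: "p > 0" using p by (simp add: prime_gt_0_nat)
  have pn: "p dvd n" by (simp add: n)
  have n0: "n > 0" using n p0 m by simp
  note nd = not_dvd_of_coprime[OF p pn]
  have fin: "finite (?C i)" for i
  proof (rule finite_subset[OF class_colors_subset])
    show "finite (range c)" using rf n0 by (intro finite_range_periodic) (auto simp: rainbow_free_def)
  qed
  have cardC: "card (?C i) \<le> bound a1 a2 a3 m" for i
  proof -
    have "int p dvd (a1 + a2 + a3) * i - b" using ps pb by simp
    then obtain b' where "rainbow_free m a1 a2 a3 b' (\<lambda>t. c (i + int p * t))"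
      using rainbow_free_class[of p m a1 a2 a3 b c i] rf n p0 by auto
    then show ?thesis unfolding class_colors_range by (rule IH)
  qed
  obtain i0 where i0: "\<And>i. card (?C i) \<le> card (?C i0)"
    using ex_has_greatest_nat[of "\<lambda>_. True" 0 "\<lambda>i. card (?C i)" "bound a1 a2 a3 m + 1"] cardC
    by (metis le_imp_less_Suc Suc_eq_plus1)
  have few: "A = B" if AB: "A \<in> ?C i - ?C i0" "B \<in> ?C i - ?C i0" for i A B
  proof (rule ccontr)
    assume "A \<noteq> B"
    obtain l where l': "int p dvd a3 * l - (b - a1 * i - a2 * i0)" by (rule solve_cong_prime[OF p nd[OF cop(3)]])
    have l: "int p dvd a1 * i + a2 * i0 + a3 * l - b" "int p dvd a1 * i + a3 * l + a2 * i0 - b"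
      "int p dvd a2 * i0 + a1 * i + a3 * l - b"
      using l' by (simp_all add: algebra_simps)
    have "?C l \<subseteq> ?C i0" by (rule class_colors_two_missing[OF rf cop(2) pn l(1) AB \<open>A \<noteq> B\<close>])
    have "\<exists>A'\<in>?C i - ?C l. \<exists>B'\<in>?C i - ?C l. A' \<noteq> B'" using AB \<open>A \<noteq> B\<close> \<open>?C l \<subseteq> ?C i0\<close> by blast
    then have "?C i0 \<subseteq> ?C l"
      using class_colors_two_missing[OF rainbow_free_swap23[OF rf] cop(3) pn l(2)] by blast
    \<comment> \<open>Class \<open>i\<close> has two colors outside the base class, and the base
      class has the most colors, so two of its colors are missing from class
      \<open>i\<close>.\<close>
    have "card {A, B} + card (?C i \<inter> ?C i0) \<le> card (?C i)"
    proof -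
      have "card ({A, B} \<union> (?C i \<inter> ?C i0)) = card {A, B} + card (?C i \<inter> ?C i0)"
        by (rule card_Un_disjoint) (use AB fin in auto)
      moreover have "card ({A, B} \<union> (?C i \<inter> ?C i0)) \<le> card (?C i)" by (rule card_mono) (use AB fin in auto)
      ultimately show ?thesis by simp
    qed
    also have "\<dots> \<le> card (?C i0)" by (rule i0)
    also have "card (?C i0) = card (?C i0 - ?C i) + card (?C i \<inter> ?C i0)"
      using card_Diff_subset_Int[of "?C i0" "?C i"] fin card_mono[of "?C i0" "?C i \<inter> ?C i0"] by (simp add: Int_commute)
    finally have "2 \<le> card (?C i0 - ?C i)" using \<open>A \<noteq> B\<close> by simp
    then have "\<not> card (?C i0 - ?C i) \<le> Suc 0" by simp
    then obtain A' B' where "A' \<in> ?C i0 - ?C i" "B' \<in> ?C i0 - ?C i" "A' \<noteq> B'"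
      using card_le_Suc0_iff_eq[of "?C i0 - ?C i"] fin by blast
    then have "?C l \<subseteq> ?C i"
      using class_colors_two_missing[OF rainbow_free_swap12[OF rf] cop(1) pn l(3)] by blast
    then have "?C i0 - ?C i = {}" using \<open>?C i0 \<subseteq> ?C l\<close> by blast
    then show False using \<open>2 \<le> card (?C i0 - ?C i)\<close> by (metis card.empty not_numeral_le_zero)
  qed
  obtain e :: "int \<Rightarrow> 'c option" where rfe: "rainbow_free p a1 a2 a3 b e"
    and ce: "card (range c) + 1 \<le> card (?C i0) + card (range e)"
    by (rule few_extra_coloring[OF rf n0 pn cop few])
  have "card (range e) \<le> 1 + gain a1 a2 a3 p"
    by (rule prime_bound[OF p nd[OF cop(1)] nd[OF cop(2)] nd[OF cop(3)] p3 rfe])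
  then show ?thesis using ce cardC[of i0] bound_prime_mult[OF p m, of a1 a2 a3] n by simp
qed

text \<open>Keeping \<open>i\<close> at one position of the equation, \<open>class_colors_two_missing\<close> moves along an edge
  between the two other positions; three such moves compose to a reflection.\<close>

lemma missing_colors_reflect:
  assumes rf: "rainbow_free n a1 a2 a3 b c" and dn: "d dvd n"
    and cop: "coprime a1 (int n)" "coprime a2 (int n)" "coprime a3 (int n)"
    and AB: "A \<in> class_colors c d i - class_colors c d j" "B \<in> class_colors c d i - class_colors c d j" "A \<noteq> B"
    and x: "class_colors c d x \<subseteq> class_colors c d j"
    and y: "int d dvd a1 * (x + y - 2 * i) - (b - (a1 + a2 + a3) * i)"
  shows "class_colors c d y \<subseteq> class_colors c d j"
proof -
  let ?C = "class_colors c d"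
  have copd: "coprime a (int d)" if "coprime a (int n)" for a
    using that dn by (meson coprime_divisors dvd_refl int_dvd_int_iff)
  have step: "?C l \<subseteq> ?C j" if "rainbow_free n u1 u2 u3 b c" "coprime u2 (int n)" "?C k \<subseteq> ?C j"
    "int d dvd u1 * i + u2 * k + u3 * l - b" for u1 u2 u3 k l
  proof -
    have "?C l \<subseteq> ?C k"
      by (rule class_colors_two_missing[OF that(1,2) dn that(4), of A B]) (use AB that(3) in auto)
    then show ?thesis using that(3) by blast
  qed
  \<comment> \<open>The moves from \<open>x\<close> to \<open>l1\<close>, \<open>l2\<close> and
    \<open>y\<close> keep \<open>i\<close> at the third, the first and the second position.\<close>
  obtain l1 where l1: "int d dvd a2 * l1 - (b - a3 * i - a1 * x)" by (rule solve_cong_coprime[OF copd[OF cop(2)]])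
  obtain l2 where l2: "int d dvd a3 * l2 - (b - a1 * i - a2 * l1)" by (rule solve_cong_coprime[OF copd[OF cop(3)]])
  have "?C l1 \<subseteq> ?C j"
    by (rule step[OF rainbow_free_rotate[OF rf] cop(1) x]) (use l1 in \<open>simp add: algebra_simps\<close>)
  then have "?C l2 \<subseteq> ?C j"
    by (rule step[OF rf cop(2)]) (use l2 in \<open>simp add: algebra_simps\<close>)
  then show ?thesis
  proof (rule step[OF rainbow_free_rotate[OF rainbow_free_rotate[OF rf]] cop(3)])
    have "int d dvd (a1 * (x + y - 2 * i) - (b - (a1 + a2 + a3) * i)) +
        ((a3 * l2 - (b - a1 * i - a2 * l1)) - (a2 * l1 - (b - a3 * i - a1 * x)))"
      by (intro dvd_add dvd_diff y l1 l2)
    also have "\<dots> = a2 * i + a3 * l2 + a1 * y - b" by (simp add: algebra_simps)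
    finally show "int d dvd a2 * i + a3 * l2 + a1 * y - b" .
  qed
qed

text \<open>With e = b - s i, the reflections belonging to \<open>a1\<close> and to
  \<open>a2\<close> add up their arguments to 2 i + e / a1 and 2 i + e / a2; their composition is
  the translation by e / a2 - e / a1.\<close>

lemma missing_colors_translate:
  assumes rf: "rainbow_free n a1 a2 a3 b c" and dn: "d dvd n"
    and cop: "coprime a1 (int n)" "coprime a2 (int n)" "coprime a3 (int n)"
    and AB: "A \<in> class_colors c d i - class_colors c d j" "B \<in> class_colors c d i - class_colors c d j" "A \<noteq> B"
    and x: "class_colors c d x \<subseteq> class_colors c d j"
    and t: "int d dvd a1 * a2 * t - (b - (a1 + a2 + a3) * i) * (a1 - a2)"
  shows "class_colors c d (x + t) \<subseteq> class_colors c d j"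
proof -
  have copd: "coprime a (int d)" if "coprime a (int n)" for a
    using that dn by (meson coprime_divisors dvd_refl int_dvd_int_iff)
  let ?e = "b - (a1 + a2 + a3) * i"
  obtain z where z: "int d dvd a1 * z - (?e - a1 * (x - 2 * i))" by (rule solve_cong_coprime[OF copd[OF cop(1)]])
  then have z': "int d dvd a1 * (x + z - 2 * i) - ?e" by (simp add: algebra_simps)
  have Cz: "class_colors c d z \<subseteq> class_colors c d j"
    by (rule missing_colors_reflect[OF rf dn cop AB x z'])
  have "int d dvd a2 * (a1 * (x + z - 2 * i) - ?e) + (a1 * a2 * t - ?e * (a1 - a2))"
    using z' t by (intro dvd_add dvd_mult)
  also have "\<dots> = a1 * (a2 * (z + (x + t) - 2 * i) - ?e)" by (simp add: algebra_simps)
  finally have "int d dvd a2 * (z + (x + t) - 2 * i) - ?e"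
    using copd[OF cop(1)] by (simp add: coprime_dvd_mult_right_iff coprime_commute)
  then have s: "int d dvd a2 * (z + (x + t) - 2 * i) - (b - (a2 + a1 + a3) * i)" by (simp add: algebra_simps)
  show ?thesis
    by (rule missing_colors_reflect[OF rainbow_free_swap12[OF rf] dn cop(2,1,3) AB Cz s])
qed

text \<open>The index equation modulo \<open>q\<close> has no constant solution for any prime \<open>q\<close> dividing \<open>n\<close>. The
  translations from \<open>missing_colors_translate\<close> then generate all of \<open>\<int>\<^sub>m\<close>, so any two classes differ in
  at most one color, and every class can serve as base; one with few colors comes from
  \<open>cosets_few_colors\<close>.\<close>

lemma bound_no_fixed_index:
  fixes c :: "int \<Rightarrow> 'c"
  assumes p: "prime p" and m: "m > 0" and n: "n = p * m" and rf: "rainbow_free n a1 a2 a3 b c"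
    and cop: "coprime a1 (int n)" "coprime a2 (int n)" "coprime a3 (int n)"
    and n3: "3 dvd n \<Longrightarrow> \<not> 3 dvd a1 + a2 + a3"
    and qs: "\<And>q. prime q \<Longrightarrow> q dvd n \<Longrightarrow> int q dvd a1 + a2 + a3"
    and qb: "\<And>q. prime q \<Longrightarrow> q dvd n \<Longrightarrow> \<not> int q dvd b"
    and IH: "\<And>b (e :: int \<Rightarrow> 'c option). rainbow_free m a1 a2 a3 b e \<Longrightarrow> card (range e) \<le> bound a1 a2 a3 m"
  shows "card (range c) \<le> bound a1 a2 a3 n"
proof -
  let ?C = "class_colors c m" and ?s = "a1 + a2 + a3"
  have p0: "p > 0" using p by (simp add: prime_gt_0_nat)
  have n0: "n > 0" using n p0 m by simp
  have pn: "p dvd n" and mn: "m dvd n" by (simp_all add: n)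
  have nd: "\<not> int q dvd a1" "\<not> int q dvd a2" "\<not> int q dvd a3" if "prime q" "q dvd n" for q
    using not_dvd_of_coprime[OF that] cop by blast+
  have not3: "q \<noteq> 3" if q: "prime q" "q dvd n" for q using qs[OF q] n3 q by auto
  \<comment> \<open>An even \<open>n\<close> would make the coefficients and their sum odd. Oddness
    of \<open>m\<close> is what the parity argument along cycles rests on.\<close>
  have not2: "q \<noteq> 2" if q: "prime q" "q dvd n" for q
  proof
    assume "q = 2"
    then show False using qs[OF q] nd[OF q] by auto
  qed
  have p5: "p \<ge> 5"
  proof -
    have "p \<noteq> 4" using p by auto
    then show ?thesis using not2[OF p pn] not3[OF p pn] prime_ge_2_nat[OF p] by linarith
  qed
  have oddm: "odd m" using not2[of 2] mn by (metis dvd_trans two_is_prime_nat)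
  have copm: "coprime a (int m)" if "coprime a (int n)" for a
    using that mn by (meson coprime_divisors dvd_refl int_dvd_int_iff)
  have m0: "int m > 0" using m by simp
  have few: "A = B" if AB: "A \<in> ?C i - ?C j" "B \<in> ?C i - ?C j" for i j A B
  proof (rule ccontr)
    assume ne: "A \<noteq> B"
    define e where "e = b - ?s * i"
    have cop12: "coprime (a1 * a2) (int m)" and cop23: "coprime (a2 * a3) (int m)"
      using copm cop by simp_all
    obtain t12 where t12: "int m dvd a1 * a2 * t12 - e * (a1 - a2)" by (rule solve_cong_coprime[OF cop12])
    obtain t23 where t23: "int m dvd a2 * a3 * t23 - e * (a2 - a3)" by (rule solve_cong_coprime[OF cop23])
    define Z where "Z = {x. ?C x \<subseteq> ?C j}"
    have cong: "y \<in> Z" if "x \<in> Z" "int m dvd x - y" for x y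
      using that class_colors_cong[OF that(2), of c] by (simp add: Z_def)
    have cl12: "x + t12 \<in> Z" if "x \<in> Z" for x
      using missing_colors_translate[OF rf mn cop AB ne _ t12[unfolded e_def]] that unfolding Z_def by blast
    have cl23: "x + t23 \<in> Z" if "x \<in> Z" for x
    proof -
      have "int m dvd a2 * a3 * t23 - (b - (a2 + a3 + a1) * i) * (a2 - a3)"
        using t23 unfolding e_def by (simp add: algebra_simps)
      then show ?thesis
        using missing_colors_translate[OF rainbow_free_rotate[OF rainbow_free_rotate[OF rf]] mn cop(2,3,1) AB ne]
          that unfolding Z_def by blast
    qed
    \<comment> \<open>A common prime \<open>q\<close> of both translations and \<open>m\<close>
      would divide \<open>a1 - a2\<close> and \<open>a2 - a3\<close>, so the coefficient sum is
      congruent to \<open>3 * a2\<close>, which forces \<open>q = 3\<close>.\<close>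
    have cop1: "coprime (gcd t12 t23) (int m)"
    proof (rule ccontr)
      assume "\<not> ?thesis"
      then have "gcd (gcd t12 t23) (int m) \<noteq> 1" by (simp add: coprime_iff_gcd_eq_1)
      then have "nat (gcd (gcd t12 t23) (int m)) \<noteq> 1" by auto
      then obtain q where q: "prime q" "q dvd nat (gcd (gcd t12 t23) (int m))" by (metis prime_factor_nat)
      then have "int q dvd gcd (gcd t12 t23) (int m)" by (metis int_dvd_int_iff nat_0_le gcd_ge_0_int)
      then have qt: "int q dvd t12" "int q dvd t23" "int q dvd int m" by auto
      then have qn: "q dvd n" using mn by auto
      have qe: "\<not> int q dvd e"
      proof
        assume "int q dvd e"
        moreover have "int q dvd ?s * i" using qs[OF q(1) qn] by simp
        ultimately have "int q dvd e + ?s * i" by (rule dvd_add)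
        then show False using qb[OF q(1) qn] by (simp add: e_def)
      qed
      have "int q dvd e * (a1 - a2)"
        using dvd_trans[OF qt(3) t12] dvd_diff_right_iff[OF dvd_mult[OF qt(1), of "a1 * a2"]] by blast
      then have q12: "int q dvd a1 - a2" using qe q(1) by (simp add: prime_int_dvd_mult_iff)
      have "int q dvd e * (a2 - a3)"
        using dvd_trans[OF qt(3) t23] dvd_diff_right_iff[OF dvd_mult[OF qt(2), of "a2 * a3"]] by blast
      then have q23: "int q dvd a2 - a3" using qe q(1) by (simp add: prime_int_dvd_mult_iff)
      have "int q dvd ?s - (a1 - a2) + (a2 - a3)"
        by (rule dvd_add[OF dvd_diff[OF qs[OF q(1) qn] q12] q23])
      also have "?s - (a1 - a2) + (a2 - a3) = int 3 * a2" by simp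
      finally have "int q dvd int 3" using nd(2)[OF q(1) qn] q(1) by (simp add: prime_int_dvd_mult_iff)
      then have "q dvd 3" by (simp only: int_dvd_int_iff)
      then have "q = 3" using q(1) by (simp add: primes_dvd_imp_eq)
      then show False using not3[OF q(1) qn] by simp
    qed
    obtain u v where uv: "u * t12 + v * t23 = gcd t12 t23" using bezout_int by blast
    have "i \<in> Z"
    proof (rule translation_closed_reaches[OF m0 cop1])
      show "y \<in> Z" if "x \<in> Z" "int m dvd x - y" for x y by (rule cong[OF that])
      show "j \<in> Z" by (simp add: Z_def)
      fix x assume "x \<in> Z"
      have "x + u * t12 \<in> Z" by (rule translation_closed_mult[OF m0 cong cl12 \<open>x \<in> Z\<close>])
      from translation_closed_mult[OF m0 cong cl23 this] have "x + u * t12 + v * t23 \<in> Z" .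
      then show "x + gcd t12 t23 \<in> Z" using uv by (simp add: add.assoc)
    qed
    then show False using AB by (auto simp: Z_def)
  qed
  define F where "F j t = c (j + int m * t)" for j t
  have perc: "periodic (int n) c" and rfc: "rf3 n a1 a2 a3 b c c c" "rf3 n a1 a3 a2 b c c c"
    using rf rainbow_free_swap23[OF rf] by (auto simp: rainbow_free_def)
  have perF: "periodic (int p) (F j)" for j
    unfolding F_def
    by (rule periodicI, rule periodic_cong[OF perc]) (simp add: n flip: right_diff_distrib)
  have rfF: "\<exists>b'. rf3 p u1 u2 u3 b' (F j) (F j) (F k)"
    if r: "rf3 n u1 u2 u3 b c c c" and k: "int m dvd u1 * j + u2 * j + u3 * k - b" for u1 u2 u3 j k
  proof -
    obtain r where r': "u1 * j + u2 * j + u3 * k - b = int m * r" using k by blast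
    have "rf3 p u1 u2 u3 (- r) (F j) (F j) (F k)"
      unfolding rf3_def
    proof (intro allI impI)
      fix x y z assume "int p dvd u1 * x + u2 * y + u3 * z - - r"
      then have "int m * int p dvd int m * (u1 * x + u2 * y + u3 * z + r)" by simp
      also have "int m * (u1 * x + u2 * y + u3 * z + r) =
          u1 * (j + int m * x) + u2 * (j + int m * y) + u3 * (k + int m * z) - b"
        using r' by (simp add: algebra_simps)
      finally show "F j x = F j y \<or> F j y = F k z \<or> F j x = F k z"
        using r unfolding rf3_def F_def n by (simp add: mult.commute)
    qed
    then show ?thesis by blast
  qed
  \<comment> \<open>Modulo each prime divisor of \<open>n\<close> the sum of the coefficients
    vanishes, so \<open>a1 + a2\<close> is congruent to the unit \<open>- a3\<close>. Hence
    \<open>s3\<close>, which maps a class to its successor, is a bijection.\<close>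
  have cop_sum: "coprime (a1 + a2) (int m)"
  proof (rule ccontr)
    assume "\<not> ?thesis"
    then have "gcd (a1 + a2) (int m) \<noteq> 1" by (simp add: coprime_iff_gcd_eq_1)
    then have "nat (gcd (a1 + a2) (int m)) \<noteq> 1" by auto
    then obtain q where q: "prime q" "q dvd nat (gcd (a1 + a2) (int m))" by (metis prime_factor_nat)
    then have "int q dvd gcd (a1 + a2) (int m)" by (metis int_dvd_int_iff nat_0_le gcd_ge_0_int)
    then have qt: "int q dvd a1 + a2" "int q dvd int m" by auto
    then have qn: "q dvd n" using mn by auto
    have "int q dvd ?s - (a1 + a2)" using qs[OF q(1) qn] qt(1) by (rule dvd_diff)
    then show False using nd(3)[OF q(1) qn] by simp
  qed
  obtain r3 where r3: "int m dvd a3 * r3 - 1" by (rule solve_cong_coprime[OF copm[OF cop(3)]])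
  obtain r2 where r2: "int m dvd a2 * r2 - 1" by (rule solve_cong_coprime[OF copm[OF cop(2)]])
  have cop_r3: "coprime r3 (int m)"
  proof -
    have "[a3 * r3 = 1] (mod int m)" using r3 by (simp add: cong_iff_dvd_diff)
    then show ?thesis by (metis coprime_iff_invertible_int mult.commute)
  qed
  define s3 where "s3 j = (- (r3 * (a1 + a2)) * j + r3 * b) mod int m" for j
  define s2 where "s2 j = (- (r2 * (a1 + a3)) * j + r2 * b) mod int m" for j
  have index: "int m dvd u1 * j + u2 * j + u3 * ((- (r * (u1 + u2)) * j + r * b) mod int m) - b"
    if "int m dvd u3 * r - 1" for u1 u2 u3 r j
  proof -
    let ?w = "- (r * (u1 + u2)) * j + r * b"
    have "int m dvd u3 * (?w mod int m - ?w) + (u3 * r - 1) * (b - (u1 + u2) * j)"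
      using that by (intro dvd_add dvd_mult dvd_mult2) (simp_all add: mod_eq_dvd_iff[symmetric])
    also have "\<dots> = u1 * j + u2 * j + u3 * (?w mod int m) - b" by (simp add: algebra_simps)
    finally show ?thesis .
  qed
  \<comment> \<open>The classes are modulo \<open>m\<close> here, so each has \<open>p\<close>
    points and one of them is small by the result for families of colorings modulo a prime, while
    the coloring of the indices falls under the induction hypothesis.\<close>
  obtain j0 where j0: "card (range (F j0)) \<le> 1 + gain a1 a2 a3 p"
  proof -
    have "\<exists>j\<in>{0..<int m}. card (range (F j)) \<le> (if splits p a1 a2 a3 then 3 else 2)"
    proof (rule cosets_few_colors[OF p p5 nd[OF p pn] oddm perF])
      show "bij_betw s3 {0..<int m} {0..<int m}"
        unfolding s3_def by (rule bij_betw_affine_mod[OF m0]) (use cop_r3 cop_sum in simp)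
      show "s2 j \<in> {0..<int m}" for j using m0 by (simp add: s2_def)
      show "\<exists>b. rf3 p a1 a2 a3 b (F j) (F j) (F (s3 j))" for j
        unfolding s3_def by (rule rfF[OF rfc(1) index[OF r3]])
      show "\<exists>b. rf3 p a1 a3 a2 b (F j) (F j) (F (s2 j))" for j
        unfolding s2_def by (rule rfF[OF rfc(2) index[OF r2]])
    qed
    then obtain j where "card (range (F j)) \<le> (if splits p a1 a2 a3 then 3 else 2)" by blast
    then show thesis using that[of j] by (simp add: gain_def split: if_splits)
  qed
  obtain e :: "int \<Rightarrow> 'c option" where rfe: "rainbow_free m a1 a2 a3 b e"
    and ce: "card (range c) + 1 \<le> card (?C j0) + card (range e)"
    by (rule few_extra_coloring[OF rf n0 mn cop few])
  have "range (F j0) = ?C j0" by (simp add: class_colors_range F_def)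
  then show ?thesis using ce j0 IH[OF rfe] bound_prime_mult[OF p m, of a1 a2 a3] n by simp
qed

lemma upper_bound_nat:
  fixes c :: "int \<Rightarrow> nat"
  assumes "n > 0" "coprime a1 (int n)" "coprime a2 (int n)" "coprime a3 (int n)"
    and "3 dvd n \<Longrightarrow> \<not> 3 dvd a1 + a2 + a3" and "rainbow_free n a1 a2 a3 b c"
  shows "card (range c) \<le> bound a1 a2 a3 n"
  using assms
proof (induction n arbitrary: b c rule: less_induct)
  case (less n)
  show ?case
  proof (cases "n = 1")
    case True
    then have "periodic 1 c" using less.prems(6) by (simp add: rainbow_free_def)
    then have "range c = c ` {0..<1}" by (intro periodic_range) simp_all
    also have "{0..<1::int} = {0}" by auto
    finally have "range c = {c 0}" by simp
    then show ?thesis using True by (simp add: bound_def)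
  next
    case False
    have IH: "card (range c') \<le> bound a1 a2 a3 m"
      if q: "prime q" "n = q * m" and c': "rainbow_free m a1 a2 a3 b' c'" for q m b' and c' :: "int \<Rightarrow> nat"
    proof (rule less.IH[OF _ _ _ _ _ _ c'])
      show "m > 0" using q less.prems(1) by (cases m) auto
      then show "m < n" using q prime_gt_1_nat by simp
      have "int m dvd int n" using q by simp
      then show "coprime a1 (int m)" "coprime a2 (int m)" "coprime a3 (int m)"
        using less.prems(2-4) by (meson coprime_divisors dvd_refl)+
      show "\<not> 3 dvd a1 + a2 + a3" if "3 dvd m" using less.prems(5) q that by simp
    qed
    have m0: "m > 0" if "n = q * m" for q m using less.prems(1) that by (cases m) auto
    have p3: "\<not> 3 dvd a1 + a2 + a3" if "q = 3" "n = q * m" for q m using less.prems(5) that by simp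
    consider (1) q where "prime q" "q dvd n" "\<not> int q dvd a1 + a2 + a3"
      | (2) q where "prime q" "q dvd n" "int q dvd a1 + a2 + a3" "int q dvd b"
      | (3) "\<And>q. prime q \<Longrightarrow> q dvd n \<Longrightarrow> int q dvd a1 + a2 + a3" "\<And>q. prime q \<Longrightarrow> q dvd n \<Longrightarrow> \<not> int q dvd b"
      by blast
    then show ?thesis
    proof cases
      case 1
      obtain m where m: "n = q * m" using 1(2) by blast
      show ?thesis
        by (rule bound_fixed_index[OF 1(1) m0[OF m] m less.prems(6,2,3,4) 1(3) p3[OF _ m] IH[OF 1(1) m]])
    next
      case 2
      obtain m where m: "n = q * m" using 2(2) by blast
      show ?thesis
        by (rule bound_all_fixed_indices[OF 2(1) m0[OF m] m less.prems(6,2,3,4) 2(3,4) p3[OF _ m] IH[OF 2(1) m]])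
    next
      case 3
      obtain q where q: "prime q" "q dvd n" using False by (metis prime_factor_nat)
      obtain m where m: "n = q * m" using q(2) by blast
      show ?thesis
      proof (rule bound_no_fixed_index[OF q(1) m0[OF m] m less.prems(6,2,3,4,5) 3])
        fix b' and e :: "int \<Rightarrow> nat option" assume e: "rainbow_free m a1 a2 a3 b' e"
        \<comment> \<open>The induction hypothesis speaks about colors in \<open>nat\<close>, so the
          optional colors of the index coloring are encoded injectively.\<close>
        define f :: "nat option \<Rightarrow> nat" where "f v = (case v of None \<Rightarrow> 0 | Some k \<Rightarrow> Suc k)" for v
        have "inj f" by (auto simp: f_def inj_def split: option.splits)
        have "range (\<lambda>x. f (e x)) = f ` range e" by auto
        then have "card (range (\<lambda>x. f (e x))) = card (range e)"
          using \<open>inj f\<close> by (simp add: card_image inj_on_subset)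
        then show "card (range e) \<le> bound a1 a2 a3 m"
          using IH[OF q(1) m rainbow_free_comp[OF e, of f]] by simp
      qed
    qed
  qed
qed

section \<open>The lower bound\<close>

text \<open>A ratio map followed by its inverse returns to the residue of \<open>x\<close> only
  modulo \<open>p\<close>, so it reaches every congruent \<open>y\<close>.\<close>

lemma ratio_closed_cong:
  assumes p: "prime p" and a: "\<not> int p dvd a2" and S: "ratio_closed p a1 a2 a3 S"
    and x: "x \<in> S" and xy: "int p dvd x - y"
  shows "y \<in> S"
proof -
  obtain z where z: "int p dvd a2 * z - (- a1 * x)" by (rule solve_cong_prime[OF p a])
  then have xz: "int p dvd a1 * x + a2 * z" by (simp add: algebra_simps)
  then have "z \<in> S" using S x unfolding ratio_closed_def by blast
  moreover have "int p dvd (a1 * x + a2 * z) - a1 * (x - y)" using dvd_diff[OF xz dvd_mult[OF xy]] .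
  then have "int p dvd a2 * z + a1 * y" by (simp add: algebra_simps)
  ultimately show ?thesis using S unfolding ratio_closed_def by blast
qed

lemma exists_color_split:
  assumes "prime p"
  obtains S where "ratio_closed p a1 a2 a3 S" "\<exists>x\<in>S. \<not> int p dvd x"
    "splits p a1 a2 a3 \<longrightarrow> (\<exists>y. \<not> int p dvd y \<and> y \<notin> S)"
proof (cases "splits p a1 a2 a3")
  case True
  then show ?thesis using that unfolding splits_def by blast
next
  case False
  have "\<not> int p dvd 1" using assms by (metis not_prime_unit prime_nat_int_transfer)
  then have "\<exists>x\<in>UNIV. \<not> int p dvd x" by blast
  moreover have "ratio_closed p a1 a2 a3 UNIV" by (simp add: ratio_closed_def)
  ultimately show ?thesis using that[of UNIV] False by blast
qed

text \<open>Multiples of \<open>p\<close> keep the coloring modulo \<open>m\<close>. In a solution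
  with exactly one variable divisible by \<open>p\<close>, the other two are related by a ratio map,
  so both or neither lie in \<open>S\<close>; with none divisible, at most the two new colors occur;
  exactly two divisible variables are impossible.\<close>

lemma extend_coloring:
  fixes c :: "int \<Rightarrow> nat"
  assumes p: "prime p" and m: "m > 0" and a: "\<not> int p dvd a1" "\<not> int p dvd a2" "\<not> int p dvd a3"
    and rf: "rainbow_free m a1 a2 a3 0 c"
  obtains c' :: "int \<Rightarrow> nat" where "rainbow_free (p * m) a1 a2 a3 0 c'"
    "card (range c) + gain a1 a2 a3 p \<le> card (range c')"
proof -
  have per: "periodic (int m) c" and rf3: "rf3 m a1 a2 a3 0 c c c" using rf by (auto simp: rainbow_free_def)
  have fin: "finite (range c)" by (rule finite_range_periodic[OF _ per]) (simp add: m)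
  have p0: "p > 0" using p by (simp add: prime_gt_0_nat)
  obtain S where S: "ratio_closed p a1 a2 a3 S" and Sx: "\<exists>x\<in>S. \<not> int p dvd x"
    and Sy: "splits p a1 a2 a3 \<longrightarrow> (\<exists>y. \<not> int p dvd y \<and> y \<notin> S)"
    by (rule exists_color_split[OF p, of a1 a2 a3])
  define K where "K = Suc (Max (range c))"
  have K: "c x < K" for x using fin by (simp add: K_def le_imp_less_Suc)
  define c' where "c' x = (if int p dvd x then c (x div int p) else if x \<in> S then K else Suc K)" for x
  have c'_mult: "c' (int p * x) = c x" for x using p0 by (simp add: c'_def)
  have S_cong: "x \<in> S \<longleftrightarrow> y \<in> S" if "int p dvd x - y" for x y
    using ratio_closed_cong[OF p a(2) S _ that] ratio_closed_cong[OF p a(2) S, of y x] that by (metis dvd_diff_commute)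
  have "periodic (int (p * m)) c'"
  proof (rule periodicI)
    fix x y assume xy: "int (p * m) dvd x - y"
    then have pxy: "int p dvd x - y" by (metis dvd_mult_left of_nat_mult)
    have "x = y + (x - y)" by simp
    then have dv: "int p dvd x \<longleftrightarrow> int p dvd y" using pxy by (metis dvd_add_left_iff)
    show "c' x = c' y"
    proof (cases "int p dvd x")
      case True
      then obtain u where u: "x = int p * u" by blast
      obtain v where v: "y = int p * v" using True dv by blast
      have "int p * int m dvd int p * (u - v)" using xy u v by (simp add: right_diff_distrib)
      then have "int m dvd u - v" using p0 by simp
      then have "c u = c v" by (rule periodic_cong[OF per])
      then show ?thesis by (simp add: u v c'_mult)
    qed (use dv S_cong[OF pxy] in \<open>simp add: c'_def\<close>)
  qed
  moreover have "rf3 (p * m) a1 a2 a3 0 c' c' c'"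
    unfolding rf3_def
  proof (intro allI impI)
    fix x y z assume s: "int (p * m) dvd a1 * x + a2 * y + a3 * z - 0"
    then have ps: "int p dvd a1 * x + a2 * y + a3 * z" by (metis diff_zero dvd_mult_left of_nat_mult)
    have closed: "v \<in> S \<Longrightarrow> int p dvd a1 * v + a2 * w \<Longrightarrow> w \<in> S" "v \<in> S \<Longrightarrow> int p dvd a2 * v + a1 * w \<Longrightarrow> w \<in> S"
      "v \<in> S \<Longrightarrow> int p dvd a1 * v + a3 * w \<Longrightarrow> w \<in> S" "v \<in> S \<Longrightarrow> int p dvd a3 * v + a1 * w \<Longrightarrow> w \<in> S"
      "v \<in> S \<Longrightarrow> int p dvd a2 * v + a3 * w \<Longrightarrow> w \<in> S" "v \<in> S \<Longrightarrow> int p dvd a3 * v + a2 * w \<Longrightarrow> w \<in> S" for v w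
      using S unfolding ratio_closed_def by blast+
    have pair: "c' v = c' w" if "int p dvd u" "int p dvd u + (k * v + l * w)" "\<not> int p dvd k" "\<not> int p dvd l"
      "\<And>v w. v \<in> S \<Longrightarrow> int p dvd k * v + l * w \<Longrightarrow> w \<in> S" "\<And>v w. v \<in> S \<Longrightarrow> int p dvd l * v + k * w \<Longrightarrow> w \<in> S"
      "\<not> (int p dvd v \<and> int p dvd w)" for u k l v w
    proof -
      have vw: "int p dvd k * v + l * w" using that(1,2) by (simp add: dvd_add_right_iff)
      have "int p dvd v \<longleftrightarrow> int p dvd w"
      proof
        assume "int p dvd v"
        then have "int p dvd l * w" using vw by (simp add: dvd_add_right_iff)
        then show "int p dvd w" using that(4) p by (simp add: prime_int_dvd_mult_iff)
      next
        assume "int p dvd w"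
        then have "int p dvd k * v" using vw by (simp add: dvd_add_left_iff)
        then show "int p dvd v" using that(3) p by (simp add: prime_int_dvd_mult_iff)
      qed
      moreover have "v \<in> S \<longleftrightarrow> w \<in> S" using that(5)[OF _ vw] that(6)[of w v] vw by (auto simp: add.commute)
      ultimately show ?thesis using that(7) by (simp add: c'_def)
    qed
    consider (1) "int p dvd x" "int p dvd y" "int p dvd z" | (2) "int p dvd x" "\<not> (int p dvd y \<and> int p dvd z)"
      | (3) "int p dvd y" "\<not> (int p dvd x \<and> int p dvd z)" | (4) "int p dvd z" "\<not> (int p dvd x \<and> int p dvd y)"
      | (5) "\<not> int p dvd x" "\<not> int p dvd y" "\<not> int p dvd z" by blast
    then show "c' x = c' y \<or> c' y = c' z \<or> c' x = c' z"
    proof cases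
      case 1
      then obtain u v w where uvw: "x = int p * u" "y = int p * v" "z = int p * w" by blast
      have "int p * int m dvd int p * (a1 * u + a2 * v + a3 * w)" using s uvw by (simp add: algebra_simps)
      then have "int m dvd a1 * u + a2 * v + a3 * w - 0" using p0 by simp
      then have "c u = c v \<or> c v = c w \<or> c u = c w" using rf3 unfolding rf3_def by blast
      then show ?thesis by (simp add: uvw c'_mult)
    next
      case 2
      have "c' y = c' z"
      proof (rule pair[OF _ _ a(2) a(3) closed(5,6)])
        show "int p dvd a1 * x" using 2(1) by simp
        show "int p dvd a1 * x + (a2 * y + a3 * z)" using ps by (simp add: algebra_simps)
      qed (use 2(2) in auto)
      then show ?thesis by simp
    next
      case 3
      have "c' x = c' z"
      proof (rule pair[OF _ _ a(1) a(3) closed(3,4)])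
        show "int p dvd a2 * y" using 3(1) by simp
        show "int p dvd a2 * y + (a1 * x + a3 * z)" using ps by (simp add: algebra_simps)
      qed (use 3(2) in auto)
      then show ?thesis by simp
    next
      case 4
      have "c' x = c' y"
      proof (rule pair[OF _ _ a(1) a(2) closed(1,2)])
        show "int p dvd a3 * z" using 4(1) by simp
        show "int p dvd a3 * z + (a1 * x + a2 * y)" using ps by (simp add: algebra_simps)
      qed (use 4(2) in auto)
      then show ?thesis by simp
    qed (auto simp: c'_def)
  qed
  ultimately have rf': "rainbow_free (p * m) a1 a2 a3 0 c'" by (simp add: rainbow_free_def)
  define N where "N = (if splits p a1 a2 a3 then {K, Suc K} else {K})"
  have fin': "finite (range c')"
  proof (rule finite_range_periodic)
    show "int (p * m) > 0" using p0 m by simp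
    show "periodic (int (p * m)) c'" using rf' by (simp add: rainbow_free_def)
  qed
  obtain x0 where "x0 \<in> S" "\<not> int p dvd x0" using Sx by blast
  then have "c' x0 = K" by (simp add: c'_def)
  moreover have "Suc K \<in> range c'" if sp: "splits p a1 a2 a3"
  proof -
    obtain y0 where "\<not> int p dvd y0" "y0 \<notin> S" using Sy sp by blast
    then have "c' y0 = Suc K" by (simp add: c'_def)
    then show ?thesis by (metis rangeI)
  qed
  ultimately have "N \<subseteq> range c'" by (auto simp: N_def)
  moreover have "range c \<subseteq> range c'" using c'_mult by (metis image_subsetI rangeI)
  ultimately have "card (range c \<union> N) \<le> card (range c')" using fin' by (intro card_mono) auto
  moreover have "card (range c \<union> N) = card (range c) + card N"
  proof (rule card_Un_disjoint[OF fin])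
    have "c x \<noteq> K" "c x \<noteq> Suc K" for x using K[of x] by simp_all
    then have "K \<notin> range c" "Suc K \<notin> range c" by force+
    then show "range c \<inter> N = {}" by (auto simp: N_def)
  qed (simp add: N_def)
  moreover have "card N = gain a1 a2 a3 p" by (simp add: N_def gain_def)
  ultimately show thesis using that[OF rf'] by simp
qed

lemma lower_bound:
  assumes "n > 0" "coprime a1 (int n)" "coprime a2 (int n)" "coprime a3 (int n)"
  shows "\<exists>c :: int \<Rightarrow> nat. rainbow_free n a1 a2 a3 0 c \<and> bound a1 a2 a3 n \<le> card (range c)"
  using assms
proof (induction n rule: less_induct)
  case (less n)
  show ?case
  proof (cases "n = 1")
    case True
    have "rainbow_free n a1 a2 a3 0 (\<lambda>_. 0 :: nat)" by (simp add: rainbow_free_def rf3_def periodic_def)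
    moreover have "bound a1 a2 a3 n \<le> card (range (\<lambda>_ :: int. 0 :: nat))" using True by (simp add: bound_def)
    ultimately show ?thesis by blast
  next
    case False
    then obtain p where p: "prime p" "p dvd n" by (metis prime_factor_nat)
    then obtain m where n: "n = p * m" by blast
    have m: "m > 0" using less.prems(1) n by (cases m) auto
    have "m < n" using n m prime_gt_1_nat[OF p(1)] by simp
    moreover have "int m dvd int n" using n by simp
    then have "coprime a1 (int m)" "coprime a2 (int m)" "coprime a3 (int m)"
      using less.prems(2-4) by (meson coprime_divisors dvd_refl)+
    ultimately obtain c :: "int \<Rightarrow> nat" where c: "rainbow_free m a1 a2 a3 0 c" "bound a1 a2 a3 m \<le> card (range c)"
      using less.IH m by blast
    note nd = not_dvd_of_coprime[OF p]
    obtain c' :: "int \<Rightarrow> nat" where "rainbow_free n a1 a2 a3 0 c'" "card (range c) + gain a1 a2 a3 p \<le> card (range c')"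
      using extend_coloring[OF p(1) m nd[OF less.prems(2)] nd[OF less.prems(3)] nd[OF less.prems(4)] c(1)] n by blast
    then show ?thesis using c(2) bound_prime_mult[OF p(1) m, of a1 a2 a3] n by (intro exI[of _ c']) simp
  qed
qed

lemma rainbow_free_shift:
  assumes rf: "rainbow_free n a1 a2 a3 0 c" and t: "int n dvd (a1 + a2 + a3) * t - b"
  shows "rainbow_free n a1 a2 a3 b (\<lambda>x. c (x - t))"
proof -
  have per: "periodic (int n) c" and rf3: "rf3 n a1 a2 a3 0 c c c" using rf by (auto simp: rainbow_free_def)
  have "periodic (int n) (\<lambda>x. c (x - t))" by (rule periodicI, rule periodic_cong[OF per]) simp
  moreover have "rf3 n a1 a2 a3 b (\<lambda>x. c (x - t)) (\<lambda>x. c (x - t)) (\<lambda>x. c (x - t))"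
    unfolding rf3_def
  proof (intro allI impI)
    fix x y z assume "int n dvd a1 * x + a2 * y + a3 * z - b"
    then have "int n dvd (a1 * x + a2 * y + a3 * z - b) - ((a1 + a2 + a3) * t - b)" using t by (rule dvd_diff)
    also have "\<dots> = a1 * (x - t) + a2 * (y - t) + a3 * (z - t) - 0" by (simp add: algebra_simps)
    finally show "c (x - t) = c (y - t) \<or> c (y - t) = c (z - t) \<or> c (x - t) = c (z - t)"
      using rf3 unfolding rf3_def by blast
  qed
  ultimately show ?thesis by (simp add: rainbow_free_def)
qed

section \<open>The rainbow number\<close>

lemma carrier_Zmod: "carrier (Zmod m) = {0..<int m}"
  by (auto simp: residue_ring_def)

lemma rainbow_free_periodic_extension:
  assumes n: "n > 0" and no: "\<not> has_rainbow_solution n a1 a2 a3 b c"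
  shows "rainbow_free n a1 a2 a3 b (\<lambda>x. c (x mod int n))"
proof -
  have "rf3 n a1 a2 a3 b (\<lambda>x. c (x mod int n)) (\<lambda>x. c (x mod int n)) (\<lambda>x. c (x mod int n))"
    unfolding rf3_def
  proof (intro allI impI, rule ccontr)
    fix x y z assume s: "int n dvd a1 * x + a2 * y + a3 * z - b"
      and ne: "\<not> (c (x mod int n) = c (y mod int n) \<or> c (y mod int n) = c (z mod int n) \<or> c (x mod int n) = c (z mod int n))"
    have "[a1 * (x mod int n) + a2 * (y mod int n) + a3 * (z mod int n) = a1 * x + a2 * y + a3 * z] (mod int n)"
      by (intro cong_add cong_mult cong_refl) (simp_all add: cong_def)
    also have "[a1 * x + a2 * y + a3 * z = b] (mod int n)" using s by (simp add: cong_iff_dvd_diff)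
    finally have "(x mod int n, y mod int n, z mod int n) \<in> eq_solutions n a1 a2 a3 b"
      using n by (simp add: eq_solutions_def carrier_Zmod)
    moreover have "card {c (x mod int n), c (y mod int n), c (z mod int n)} = 3" using ne by simp
    ultimately show False using no by (auto simp: has_rainbow_solution_def)
  qed
  then show ?thesis by (simp add: rainbow_free_def periodic_def)
qed

lemma rainbow_free_no_solution:
  assumes "rainbow_free n a1 a2 a3 b c"
  shows "\<not> has_rainbow_solution n a1 a2 a3 b c"
proof
  assume "has_rainbow_solution n a1 a2 a3 b c"
  then obtain x y z where s: "(x, y, z) \<in> eq_solutions n a1 a2 a3 b" and card: "card {c x, c y, c z} = 3"
    by (auto simp: has_rainbow_solution_def)
  have "int n dvd a1 * x + a2 * y + a3 * z - b" using s by (simp add: eq_solutions_def cong_iff_dvd_diff)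
  then have "c x = c y \<or> c y = c z \<or> c x = c z" using assms unfolding rainbow_free_def rf3_def by blast
  then show False using card by (auto simp: card_insert_if split: if_splits)
qed

lemma rainbow_number_eq:
  assumes n: "n > 0" and cop: "coprime a1 (int n)" "coprime a2 (int n)" "coprime a3 (int n)"
    and t: "int n dvd (a1 + a2 + a3) * t - b" and n3: "3 dvd n \<Longrightarrow> \<not> 3 dvd a1 + a2 + a3"
  shows "rainbow_number n a1 a2 a3 b = bound a1 a2 a3 n + 1"
  unfolding rainbow_number_def
proof (rule Least_equality)
  show "0 < bound a1 a2 a3 n + 1 \<and>
    (\<forall>c. exact_coloring n (bound a1 a2 a3 n + 1) c \<longrightarrow> has_rainbow_solution n a1 a2 a3 b c)"
  proof (intro conjI allI impI)
    fix c assume c: "exact_coloring n (bound a1 a2 a3 n + 1) c"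
    show "has_rainbow_solution n a1 a2 a3 b c"
    proof (rule ccontr)
      assume "\<not> ?thesis"
      then have "rainbow_free n a1 a2 a3 b (\<lambda>x. c (x mod int n))" by (rule rainbow_free_periodic_extension[OF n])
      from upper_bound_nat[OF n cop n3 this] have "card (range (\<lambda>x. c (x mod int n))) \<le> bound a1 a2 a3 n" .
      moreover have "range (\<lambda>x. c (x mod int n)) = c ` {0..<int n}"
      proof -
        have "range (\<lambda>x. c (x mod int n)) = (\<lambda>x. c (x mod int n)) ` {0..<int n}"
          by (rule periodic_range) (simp_all add: n periodic_def)
        then show ?thesis by simp
      qed
      ultimately show False using c by (simp add: exact_coloring_def carrier_Zmod)
    qed
  qed simp
next
  fix r assume r: "0 < r \<and> (\<forall>c. exact_coloring n r c \<longrightarrow> has_rainbow_solution n a1 a2 a3 b c)"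
  show "bound a1 a2 a3 n + 1 \<le> r"
  proof (rule ccontr)
    assume "\<not> ?thesis"
    then have rb: "r \<le> bound a1 a2 a3 n" by simp
    obtain c0 :: "int \<Rightarrow> nat" where c0: "rainbow_free n a1 a2 a3 0 c0" "bound a1 a2 a3 n \<le> card (range c0)"
      using lower_bound[OF n cop] by blast
    define c where "c x = c0 (x - t)" for x
    have rf: "rainbow_free n a1 a2 a3 b c" unfolding c_def by (rule rainbow_free_shift[OF c0(1) t])
    have "range c = range c0"
    proof (intro equalityI image_subsetI)
      show "c x \<in> range c0" for x by (simp add: c_def)
      have "c0 x = c (x + t)" for x by (simp add: c_def)
      then show "c0 x \<in> range c" for x by simp
    qed
    then have rc: "r \<le> card (range c)" using c0(2) rb by simp
    have per: "periodic (int n) c" using rf by (simp add: rainbow_free_def)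
    have "finite (range c)" by (rule finite_range_periodic[OF _ per]) (simp add: n)
    then obtain g where g: "bij_betw g (range c) {1..card (range c)}"
      using ex_bij_betw_nat_finite_1 bij_betw_inv by metis
    \<comment> \<open>Minimality needs an exact coloring for every smaller \<open>r\<close>: merging
      all surplus colors into \<open>r\<close> keeps the coloring rainbow-free.\<close>
    define f where "f v = min r (g v)" for v
    have "f ` range c = min r ` {1..card (range c)}"
      using bij_betw_imp_surj_on[OF g] unfolding f_def by (metis image_image)
    also have "\<dots> = {1..r}"
    proof (intro equalityI subsetI)
      fix y assume "y \<in> {1..r}"
      then show "y \<in> min r ` {1..card (range c)}" using rc by (intro image_eqI[of _ _ y]) auto
    qed (use r in auto)
    finally have "f ` range c = {1..r}" .
    moreover have "range c = c ` {0..<int n}" by (rule periodic_range[OF _ per]) (simp add: n)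
    ultimately have "(\<lambda>x. f (c x)) ` {0..<int n} = {1..r}" by (simp add: image_image)
    then have "exact_coloring n r (\<lambda>x. f (c x))" by (simp add: exact_coloring_def carrier_Zmod)
    then show False using r rainbow_free_no_solution[OF rainbow_free_comp[OF rf, of f]] by blast
  qed
qed

lemma bound_prime_power:
  "prime p \<Longrightarrow> bound a1 a2 a3 (p ^ k) = 1 + k * gain a1 a2 a3 p"
  by (induction k) (simp_all add: bound_prime_mult prime_gt_0_nat, simp add: bound_def)

lemma bound_prod_prime_powers:
  assumes "finite I" "\<And>k. k \<in> I \<Longrightarrow> prime (p k)"
  shows "bound a1 a2 a3 (\<Prod>k\<in>I. p k ^ \<alpha> k) = 1 + (\<Sum>k\<in>I. \<alpha> k * gain a1 a2 a3 (p k))"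
  using assms
proof (induction I rule: finite_induct)
  case (insert k I)
  have "p k ^ \<alpha> k > 0" "(\<Prod>k\<in>I. p k ^ \<alpha> k) > 0"
    using insert.prems by (auto intro!: prod_pos simp: prime_gt_0_nat)
  from bound_mult[OF this, of a1 a2 a3] show ?case
    using insert bound_prime_power[of "p k" a1 a2 a3 "\<alpha> k"] by simp
qed (simp add: bound_def)

theorem theorem3p13:
  fixes l n :: nat and p \<alpha> :: "nat \<Rightarrow> nat" and a1 a2 a3 b :: int
  assumes "l \<ge> 1"
    and "\<And>k. k \<in> {1..l} \<Longrightarrow> prime (p k)"
    and "\<And>k. k \<in> {1..l} \<Longrightarrow> \<alpha> k > 0"
    and "n = (\<Prod>k=1..l. p k ^ \<alpha> k)"
    and "a1 \<in> carrier (Zmod n)" and "a2 \<in> carrier (Zmod n)"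
    and "a3 \<in> carrier (Zmod n)" and "b \<in> carrier (Zmod n)"
    and "a1 \<otimes>\<^bsub>Zmod n\<^esub> a2 \<otimes>\<^bsub>Zmod n\<^esub> a3 \<in> Units (Zmod n)"
    and "b \<noteq> \<zero>\<^bsub>Zmod n\<^esub> \<and> a1 \<oplus>\<^bsub>Zmod n\<^esub> a2 \<oplus>\<^bsub>Zmod n\<^esub> a3 \<in> Units (Zmod n) \<or>
         b = \<zero>\<^bsub>Zmod n\<^esub> \<and> \<not> 3 dvd n \<or>
         b = \<zero>\<^bsub>Zmod n\<^esub> \<and> 3 dvd n \<and> (a1 + a2 + a3) mod 3 \<in> Units (Zmod 3)"
  shows "int (rainbow_number n a1 a2 a3 b) =
    2 + (\<Sum>k=1..l. int (\<alpha> k) * (int (rainbow_number (p k) a1 a2 a3 b) - 2))"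
proof -
  note prime = assms(2)
  have pn: "p k dvd n" if "k \<in> {1..l}" for k
  proof -
    have "p k dvd p k ^ \<alpha> k" using assms(3)[OF that] by (simp add: dvd_power)
    also have "\<dots> dvd n" unfolding assms(4) using that by (intro dvd_prodI) auto
    finally show ?thesis .
  qed
  have n0: "n > 0" unfolding assms(4) using prime by (intro prod_pos) (auto simp: prime_gt_0_nat)
  have n1: "n > 1"
  proof -
    have "1 \<in> {1..l}" using assms(1) by simp
    then have "1 < p 1" "p 1 \<le> n" using prime_gt_1_nat[OF prime] dvd_imp_le[OF pn n0] by blast+
    then show ?thesis by simp
  qed
  have units: "x \<in> Units (Zmod m) \<Longrightarrow> coprime x (int m)" if "m > 1" for x m
  proof -
    interpret residues "int m" "Zmod m" by unfold_locales (use that in simp_all)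
    show "x \<in> Units (Zmod m) \<Longrightarrow> coprime x (int m)" by (simp add: res_units_eq)
  qed
  have ops: "x \<otimes>\<^bsub>Zmod n\<^esub> y = (x * y) mod int n" "x \<oplus>\<^bsub>Zmod n\<^esub> y = (x + y) mod int n" "\<zero>\<^bsub>Zmod n\<^esub> = 0" for x y
    by (simp_all add: residue_ring_def)
  have "coprime (a1 * a2 * a3) (int n)"
    using units[OF n1 assms(9)] n0 by (simp add: ops mod_mult_left_eq)
  then have cop: "coprime a1 (int n)" "coprime a2 (int n)" "coprime a3 (int n)" by auto
  \<comment> \<open>Each of the three alternatives gives a constant solution \<open>t\<close> modulo
    \<open>n\<close> and keeps 3 from dividing both \<open>n\<close> and the coefficient sum. Both
    properties pass to the prime divisors of \<open>n\<close>, so one formula gives the rainbow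
    number of \<open>n\<close> and of each prime.\<close>
  have "(\<exists>t. int n dvd (a1 + a2 + a3) * t - b) \<and> (3 dvd n \<longrightarrow> \<not> 3 dvd a1 + a2 + a3)"
  proof (cases "b = 0")
    case True
    have "\<not> 3 dvd a1 + a2 + a3" if n3: "3 dvd n"
    proof
      assume s: "3 dvd a1 + a2 + a3"
      have "(a1 + a2 + a3) mod 3 \<in> Units (Zmod 3)" using assms(10) True n3 by (auto simp: ops)
      then have "coprime ((a1 + a2 + a3) mod 3) (int 3)" by (rule units[rotated]) simp
      then show False using s by simp
    qed
    moreover have "int n dvd (a1 + a2 + a3) * 0 - b" using True by simp
    ultimately show ?thesis by blast
  next
    case False
    then have "(a1 + a2 + a3) mod int n \<in> Units (Zmod n)" using assms(10) by (auto simp: ops mod_add_left_eq)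
    from units[OF n1 this] have s: "coprime (a1 + a2 + a3) (int n)" using n0 by simp
    obtain t where t: "int n dvd (a1 + a2 + a3) * t - b" by (rule solve_cong_coprime[OF s])
    have "\<not> 3 dvd a1 + a2 + a3" if "3 dvd n" using not_dvd_of_coprime[OF _ that s] by simp
    then show ?thesis using t by blast
  qed
  then obtain t where t: "int n dvd (a1 + a2 + a3) * t - b" and n3: "3 dvd n \<Longrightarrow> \<not> 3 dvd a1 + a2 + a3" by blast
  have "rainbow_number (p k) a1 a2 a3 b = gain a1 a2 a3 (p k) + 2" if k: "k \<in> {1..l}" for k
  proof -
    have d: "int (p k) dvd int n" using pn[OF k] by simp
    have "coprime a1 (int (p k))" "coprime a2 (int (p k))" "coprime a3 (int (p k))"
      using cop d by (meson coprime_divisors dvd_refl)+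
    then have "rainbow_number (p k) a1 a2 a3 b = bound a1 a2 a3 (p k) + 1"
      by (rule rainbow_number_eq[OF prime_gt_0_nat[OF prime[OF k]] _ _ _ dvd_trans[OF d t] n3])
        (use pn[OF k] in \<open>auto intro: dvd_trans\<close>)
    then show ?thesis by (simp add: bound_prime[OF prime[OF k]])
  qed
  moreover have "bound a1 a2 a3 n = 1 + (\<Sum>k=1..l. \<alpha> k * gain a1 a2 a3 (p k))"
    unfolding assms(4) by (rule bound_prod_prime_powers) (use prime in auto)
  then have "rainbow_number n a1 a2 a3 b = 2 + (\<Sum>k=1..l. \<alpha> k * gain a1 a2 a3 (p k))"
    using rainbow_number_eq[OF n0 cop t n3] by simp
  ultimately show ?thesis by simp
qed

end
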